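(* Each of the following is a good interval: $[3.05082, 3.122183)$, $[3.1299, 3.285441)$, $[3.28603, 3.28729)$, $[3.29296, 3.29335)$, $[3.33396, 3.33475)$, $[3.359, 3.423)$, $[\sqrt{12},3.8465)$, $[3.873,3.930691)$, $[3.93616, 3.943767)$, $[3.944054, 3.971606)$, $[3.97995, 3.9857)$, $[4.520781, 4.523103)$, $[4.5251, 4.5279)$.
   Context: For $\underline a=(a_i)_{i\in\mathbb Z}\in(\mathbb N_{>0})^{\mathbb Z}$ and $j\in\mathbb Z$ let $\lambda_j(\underline a)=[a_j;a_{j+1},a_{j+2},\ldots]+[0;a_{j-1},a_{j-2},\ldots]$ and $m(\underline a)=\sup_{j\in\mathbb Z}\lambda_j(\underline a)$. Subshifts: a subshift of finite type is the set of bi-infinite sequences over a finite alphabet $\{1,\dots,A\}$ avoiding a finite list of finite words. It is symmetric if it is invariant under transposition $(a_i)\mapsto(a_{-i})$, and transitive (in particular nonempty) if for any two finite words $u,v$ occurring in its elements there is an element in which $u$ and $v$ occur without overlap, in this order. $\Sigma^+(B)=\{(a_n)_{n\ge0}:(a_n)_{n\in\mathbb Z}\in\Sigma(B)\}$. Good interval: $[\nu,\mu)$ is good if it can be covered by intervals $[x,y)$, each having two symmetric transitive subshifts of finite type $\Sigma(B)\subset\Sigma(C)\subset(\mathbb N_{>0})^{\mathbb Z}$ associated with it such that: $x=\sup\{m(\underline b):\underline b\in\Sigma(B)\}$; every $\underline c\in(\mathbb N_{>0})^{\mathbb Z}$ with $m(\underline c)<y$ lies in $\Sigma(C)$; and for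 every $\underline a$ with $m(\underline a)=\lambda_0(\underline a)<y$ the following holds: whenever $N\in\mathbb N$ and $v^1,v^2\in\Sigma^+(C)$ are two continuations with different first terms (with $m(\ldots a_{-1}a_0\ldots a_Nv^i)<y$ for $i=1,2$), there are a (perhaps empty) finite word $\tau$ and $v_B\in\Sigma^+(B)$ such that $$m(\ldots a_{-1}a_0\ldots a_N\tau v_B)\le\max\{m(\ldots a_{-1}a_0\ldots a_Nv^1),\,m(\ldots a_{-1}a_0\ldots a_Nv^2),\,x\}.$$ *)

theory Defs
  imports "HOL-Analysis.Analysis"
begin

fun cf_convergent :: "(nat \<Rightarrow> nat) \<Rightarrow> nat \<Rightarrow> real" where
  "cf_convergent s 0 = real (s 0)"
| "cf_convergent s (Suc n) = real (s 0) + 1 / cf_convergent (\<lambda>k. s (Suc k)) n"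

text \<open>The value of [s 0; s 1, s 2, ...]; meaningful when all terms after the first are positive,
  in which case the convergents converge.\<close>

definition cf_value :: "(nat \<Rightarrow> nat) \<Rightarrow> real" where
  "cf_value s = lim (cf_convergent s)"

type_synonym biseq = "int \<Rightarrow> nat"

definition positive_biseq :: "biseq \<Rightarrow> bool" where
  "positive_biseq a \<longleftrightarrow> (\<forall>i. 0 < a i)"

definition lam :: "int \<Rightarrow> biseq \<Rightarrow> real" where
  "lam j a = cf_value (\<lambda>n. a (j + int n)) + cf_value (\<lambda>n. if n = 0 then 0 else a (j - int n))"

text \<open>Extended-real valued, since the supremum is infinite for unbounded sequences.\<close>

definition markov_value :: "biseq \<Rightarrow> ereal" where
  "markov_value a = (SUP j. ereal (lam j a))"

definition occurs_at :: "nat list \<Rightarrow> biseq \<Rightarrow> int \<Rightarrow> bool" where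
  "occurs_at w a i \<longleftrightarrow> (\<forall>k<length w. a (i + int k) = w ! k)"

definition occurs_in :: "nat list \<Rightarrow> biseq \<Rightarrow> bool" where
  "occurs_in w a \<longleftrightarrow> (\<exists>i. occurs_at w a i)"

definition subshift_of_finite_type :: "biseq set \<Rightarrow> bool" where
  "subshift_of_finite_type S \<longleftrightarrow>
     (\<exists>(A::nat) (F::nat list set). finite F \<and>
        S = {a. (\<forall>i. a i \<in> {1..A}) \<and> (\<forall>w\<in>F. \<not> occurs_in w a)})"

definition symmetric_subshift :: "biseq set \<Rightarrow> bool" where
  "symmetric_subshift S \<longleftrightarrow> (\<lambda>a i. a (- i)) ` S = S"

definition transitive_subshift :: "biseq set \<Rightarrow> bool" where
  "transitive_subshift S \<longleftrightarrow> S \<noteq> {} \<and>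
     (\<forall>u v. (\<exists>a\<in>S. occurs_in u a) \<longrightarrow> (\<exists>a\<in>S. occurs_in v a) \<longrightarrow>
        (\<exists>a\<in>S. \<exists>i j. occurs_at u a i \<and> occurs_at v a j \<and> i + int (length u) \<le> j))"

definition symmetric_transitive_sft :: "biseq set \<Rightarrow> bool" where
  "symmetric_transitive_sft S \<longleftrightarrow>
     subshift_of_finite_type S \<and> symmetric_subshift S \<and> transitive_subshift S"

definition one_sided :: "biseq set \<Rightarrow> (nat \<Rightarrow> nat) set" where
  "one_sided S = (\<lambda>a n. a (int n)) ` S"

text \<open>The sequence (... a (-1), a 0, ..., a N, w, v 0, v 1, ...), with a 0 kept at index 0.\<close>

definition splice_at :: "biseq \<Rightarrow> nat \<Rightarrow> nat list \<Rightarrow> (nat \<Rightarrow> nat) \<Rightarrow> biseq" where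
  "splice_at a N w v i =
     (if i \<le> int N then a i
      else let k = nat (i - int N - 1) in
        if k < length w then w ! k else v (k - length w))"

definition good_piece :: "real \<Rightarrow> real \<Rightarrow> bool" where
  "good_piece x y \<longleftrightarrow>
     (\<exists>SB SC. symmetric_transitive_sft SB \<and> symmetric_transitive_sft SC \<and> SB \<subseteq> SC \<and>
        ereal x = (SUP b\<in>SB. markov_value b) \<and>
        (\<forall>c. positive_biseq c \<and> markov_value c < ereal y \<longrightarrow> c \<in> SC) \<and>
        (\<forall>a. positive_biseq a \<and> markov_value a = ereal (lam 0 a) \<and> ereal (lam 0 a) < ereal y \<longrightarrow>
           (\<forall>N::nat. \<forall>v1\<in>one_sided SC. \<forall>v2\<in>one_sided SC.
              v1 0 \<noteq> v2 0 \<and>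
              markov_value (splice_at a N [] v1) < ereal y \<and>
              markov_value (splice_at a N [] v2) < ereal y \<longrightarrow>
              (\<exists>t. \<exists>vB\<in>one_sided SB. (\<forall>d\<in>set t. 0 < d) \<and>
                 markov_value (splice_at a N t vB)
                   \<le> max (max (markov_value (splice_at a N [] v1))
                              (markov_value (splice_at a N [] v2)))
                         (ereal x)))))"

definition good_interval :: "real \<Rightarrow> real \<Rightarrow> bool" where
  "good_interval \<nu> \<mu> \<longleftrightarrow>
     (\<exists>P :: (real \<times> real) set.
        (\<forall>(x, y)\<in>P. good_piece x y) \<and> {\<nu>..<\<mu>} \<subseteq> (\<Union>(x, y)\<in>P. {x..<y}))"

end

(* The larger subshift can be taken to be the full shift on {1..A}, because a Markov value below y
   bounds the digits.  Suppose that two admissible continuations of a past differ in their first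
   digits b1 < b2, and let T(v) = [0; v0, v1, ...].  Every lambda_j with j <= N is a monotone or
   antitone function of the value of the tail, so any tail w with T(v2) <= T(w) <= T(v1) keeps these
   lambda_j below the two given Markov values.  For w one takes an eventually periodic extremal
   continuation, the greatest with first digit b2 or the least with first digit b1 (or any with a
   digit strictly between): wherever an admissible continuation leaves w towards the wrong side, a
   finite word occurs that already forces a value of at least y.  Since w is extremal, its lambda_j
   with j > N are at most a level theta; in the periodic part they are bounded instead by those of
   the periodic orbit itself, as the given past deviates downwards from that orbit.

   The smaller subshift consists of the sequences all of whose windows of a fixed length occur in
   one periodic sequence.  It is transitive for free, symmetric if the period is, and its Markov
   supremum x only has to satisfy theta <= x <= nu.  Everything else is a finite computation with
   convergents over a finite tree of left contexts. *)
theory Submission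
  imports Defs
begin

section \<open>Continued fractions of positive sequences\<close>

text \<open>The comparison of an admissible continuation with w is decided at the first digit where
  they differ. The value that refutes a wrong deviation may however sit further to the right, where
  the continuation is unknown. This is why a word without a large value of its own is also declared
  forbidden once all its one-digit extensions are (\<open>Ext\<close>).

  The tail w is infinite and the certificate finite. Two facts let one period speak for all:
  forbidden words have length at most \<open>K\<close>, so the tests for deviations repeat from some
  point on; and the difference between the left tails of the new sequence and of the periodic orbit
  does not grow, its sign being restored after an even number of digits. Periods therefore have even
  length.

  Outside the piece at sqrt 12 the supremum x is only squeezed between two rationals: the level
  \<open>th\<close> of the leaves, reached at a digit of the defining period, and a bound
  \<open>X\<close> read off windows of fixed length. A larger level y admits more sequences and may
  call for a larger x, so some intervals are cut into pieces with different subshifts.\<close>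

definition fr :: "(nat \<Rightarrow> nat) \<Rightarrow> real" where
  "fr s = 1 / cf_value s"

lemma cf_convergent_bounds:
  assumes "\<And>k. 0 < s k"
  shows "real (s 0) \<le> cf_convergent s n \<and> cf_convergent s n \<le> real (s 0) + 1"
  using assms
proof (induction n arbitrary: s)
  case 0
  then show ?case by simp
next
  case (Suc n)
  have "real (s (Suc 0)) \<le> cf_convergent (\<lambda>k. s (Suc k)) n"
    using Suc.IH[of "\<lambda>k. s (Suc k)"] Suc.prems by simp
  moreover have "1 \<le> real (s (Suc 0))"
    using Suc.prems[of "Suc 0"] by simp
  ultimately have "1 \<le> cf_convergent (\<lambda>k. s (Suc k)) n" by linarith
  then show ?case by (simp add: field_simps)
qed

lemma cf_convergent_ge_1:
  assumes "\<And>k. 0 < s k"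
  shows "1 \<le> cf_convergent s n"
proof -
  have "real (s 0) \<le> cf_convergent s n"
    using cf_convergent_bounds[of s n] assms by simp
  then show ?thesis using assms[of 0] by simp
qed

lemma inverse_diff_abs:
  fixes x y :: real
  assumes "0 < x" "0 < y"
  shows "\<bar>1 / x - 1 / y\<bar> = \<bar>x - y\<bar> / (x * y)"
proof -
  have "1 / x - 1 / y = (y - x) / (x * y)"
    using assms by (simp add: field_simps)
  then show ?thesis
    using assms by (simp add: abs_minus_commute)
qed

text \<open>A single step changes a difference |u - v| by the factor 1/(u v), which need not be less
  than 1. Two steps give the factor 1/((c u + 1)(c v + 1)), at most 1/4; hence \<open>k\<close>
  counts pairs of digits.\<close>

lemma cf_convergent_Cauchy_bound:
  assumes "\<And>k. 0 < s k" "2 * k \<le> m" "2 * k \<le> n"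
  shows "\<bar>cf_convergent s m - cf_convergent s n\<bar> \<le> (1 / 4) ^ k"
  using assms
proof (induction k arbitrary: s m n)
  case 0
  then show ?case
    using cf_convergent_bounds[of s m] cf_convergent_bounds[of s n] by (simp add: abs_le_iff)
next
  case (Suc k)
  obtain m' n' where m: "m = Suc (Suc m')" and n: "n = Suc (Suc n')"
    using Suc.prems(2,3) by (cases m; cases "m - 1"; cases n; cases "n - 1") auto
  define s'' where "s'' = (\<lambda>i. s (Suc (Suc i)))"
  define u where "u = cf_convergent s'' m'"
  define v where "v = cf_convergent s'' n'"
  have u1: "1 \<le> u" and v1: "1 \<le> v"
    unfolding u_def v_def s''_def using Suc.prems(1) by (auto intro!: cf_convergent_ge_1)
  have IH: "\<bar>u - v\<bar> \<le> (1 / 4) ^ k"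
    unfolding u_def v_def s''_def by (rule Suc.IH) (use Suc.prems m n in auto)
  define c where "c = real (s (Suc 0))"
  have c1: "1 \<le> c" using Suc.prems(1)[of "Suc 0"] by (simp add: c_def)
  have m'': "cf_convergent s m = real (s 0) + 1 / (c + 1 / u)"
    by (simp add: m u_def s''_def c_def)
  have n'': "cf_convergent s n = real (s 0) + 1 / (c + 1 / v)"
    by (simp add: n v_def s''_def c_def)
  have pu: "0 < c + 1 / u" and pv: "0 < c + 1 / v"
    using c1 u1 v1 by (auto intro!: add_pos_nonneg)
  have "\<bar>cf_convergent s m - cf_convergent s n\<bar> = \<bar>1 / (c + 1 / u) - 1 / (c + 1 / v)\<bar>"
    by (simp add: m'' n'')
  also have "\<dots> = \<bar>1 / u - 1 / v\<bar> / ((c + 1 / u) * (c + 1 / v))"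
    using inverse_diff_abs[OF pu pv] by simp
  also have "\<dots> = \<bar>u - v\<bar> / (((c + 1 / u) * u) * ((c + 1 / v) * v))"
    using inverse_diff_abs[of u v] u1 v1 by (simp add: mult_ac)
  also have "\<dots> \<le> \<bar>u - v\<bar> / 4"
  proof -
    have "(c + 1 / u) * u = c * u + 1" "(c + 1 / v) * v = c * v + 1"
      using u1 v1 by (auto simp: field_simps)
    moreover have "1 * 1 \<le> c * u" "1 * 1 \<le> c * v"
      using c1 u1 v1 by (intro mult_mono; simp)+
    ultimately have "2 * 2 \<le> ((c + 1 / u) * u) * ((c + 1 / v) * v)"
      by (intro mult_mono) auto
    then show ?thesis by (intro divide_left_mono) auto
  qed
  also have "\<dots> \<le> (1 / 4) ^ Suc k" using IH by simp
  finally show ?case .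
qed

lemma cf_convergent_convergent:
  assumes "\<And>k. 0 < s k"
  shows "cf_convergent s \<longlonglongrightarrow> cf_value s"
proof -
  have "Cauchy (cf_convergent s)"
  proof (rule CauchyI)
    fix e :: real assume "0 < e"
    then obtain k where k: "(1 / 4) ^ k < e"
      using real_arch_pow_inv[of e "1 / 4"] by auto
    show "\<exists>M. \<forall>m\<ge>M. \<forall>n\<ge>M. norm (cf_convergent s m - cf_convergent s n) < e"
    proof (intro exI allI impI)
      fix m n assume "2 * k \<le> m" "2 * k \<le> n"
      then show "norm (cf_convergent s m - cf_convergent s n) < e"
        using cf_convergent_Cauchy_bound[of s k m n] assms k by simp
    qed
  qed
  then show ?thesis
    unfolding cf_value_def by (metis Cauchy_convergent_iff convergent_LIMSEQ_iff)
qed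

lemma cf_value_ge_1:
  assumes "\<And>k. 0 < s k"
  shows "1 \<le> cf_value s"
  by (rule LIMSEQ_le_const[OF cf_convergent_convergent[OF assms]])
     (use cf_convergent_ge_1[OF assms] in auto)

text \<open>The head is allowed to vanish because the left half of \<^const>\<open>lam\<close> is encoded with a leading 0.\<close>

lemma cf_value_unfold:
  assumes "\<And>k. 0 < s (Suc k)"
  shows "cf_value s = real (s 0) + fr (\<lambda>k. s (Suc k))"
proof -
  let ?t = "\<lambda>k. s (Suc k)"
  have t: "cf_convergent ?t \<longlonglongrightarrow> cf_value ?t" "1 \<le> cf_value ?t"
    using assms by (auto intro!: cf_convergent_convergent cf_value_ge_1)
  have "(\<lambda>n. real (s 0) + 1 / cf_convergent ?t n) \<longlonglongrightarrow> real (s 0) + 1 / cf_value ?t"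
    using t by (intro tendsto_intros) auto
  then have "(\<lambda>n. cf_convergent s (Suc n)) \<longlonglongrightarrow> real (s 0) + fr ?t"
    by (simp add: fr_def)
  then have "cf_convergent s \<longlonglongrightarrow> real (s 0) + fr ?t"
    by (subst (asm) filterlim_sequentially_Suc)
  then show ?thesis unfolding cf_value_def by (rule limI)
qed

lemma fr_bounds:
  assumes "\<And>k. 0 < s k"
  shows "0 < fr s" "fr s \<le> 1"
  using cf_value_ge_1[of s] assms by (auto simp: fr_def)

lemma fr_unfold:
  assumes "\<And>k. 0 < s k"
  shows "fr s = 1 / (real (s 0) + fr (\<lambda>k. s (Suc k)))"
  using cf_value_unfold[of s] assms by (simp add: fr_def)

definition fr_right :: "biseq \<Rightarrow> int \<Rightarrow> real" where
  "fr_right a j = fr (\<lambda>n. a (j + 1 + int n))"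

definition fr_left :: "biseq \<Rightarrow> int \<Rightarrow> real" where
  "fr_left a j = fr (\<lambda>n. a (j - 1 - int n))"

lemma lam_eq:
  assumes "positive_biseq a"
  shows "lam j a = real (a j) + fr_right a j + fr_left a j"
proof -
  have "cf_value (\<lambda>n. a (j + int n)) = real (a j) + fr_right a j"
    using assms cf_value_unfold[of "\<lambda>n. a (j + int n)"]
    by (simp add: positive_biseq_def fr_right_def algebra_simps)
  moreover have "cf_value (\<lambda>n. if n = 0 then 0 else a (j - int n)) = fr_left a j"
    using assms cf_value_unfold[of "\<lambda>n. if n = 0 then 0 else a (j - int n)"]
    by (simp add: positive_biseq_def fr_left_def algebra_simps)
  ultimately show ?thesis by (simp add: lam_def)
qed

lemma fr_right_unfold:
  assumes "positive_biseq a"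
  shows "fr_right a j = 1 / (real (a (j + 1)) + fr_right a (j + 1))"
  using assms fr_unfold[of "\<lambda>n. a (j + 1 + int n)"]
  by (simp add: positive_biseq_def fr_right_def algebra_simps)

lemma fr_left_unfold:
  assumes "positive_biseq a"
  shows "fr_left a j = 1 / (real (a (j - 1)) + fr_left a (j - 1))"
  using assms fr_unfold[of "\<lambda>n. a (j - 1 - int n)"]
  by (simp add: positive_biseq_def fr_left_def algebra_simps)

lemma fr_right_bounds:
  assumes "positive_biseq a"
  shows "0 < fr_right a j" "fr_right a j \<le> 1"
  unfolding fr_right_def using assms by (auto intro!: fr_bounds simp: positive_biseq_def)

lemma fr_left_bounds:
  assumes "positive_biseq a"
  shows "0 < fr_left a j" "fr_left a j \<le> 1"
  unfolding fr_left_def using assms by (auto intro!: fr_bounds simp: positive_biseq_def)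

lemma fr_mono_first_difference:
  assumes "\<And>k. 0 < s k" "\<And>k. 0 < t k" "\<And>k. k < n \<Longrightarrow> s k = t k"
    and "if even n then t n < s n else s n < t n"
  shows "fr s \<le> fr t"
  using assms
proof (induction n arbitrary: s t)
  case 0
  have b: "0 < fr (\<lambda>k. s (Suc k))" "fr (\<lambda>k. t (Suc k)) \<le> 1" "0 < fr (\<lambda>k. t (Suc k))"
    using 0 by (auto intro!: fr_bounds)
  have "real (t 0) + fr (\<lambda>k. t (Suc k)) \<le> real (s 0) + fr (\<lambda>k. s (Suc k))"
    using b 0(4) by auto
  then show ?case
    using b 0 by (subst (1 2) fr_unfold) (auto intro!: divide_left_mono mult_pos_pos add_nonneg_pos)
next
  case (Suc n)
  let ?s = "\<lambda>k. s (Suc k)" and ?t = "\<lambda>k. t (Suc k)"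
  have b: "0 < fr ?s" "0 < fr ?t" using Suc.prems by (auto intro!: fr_bounds)
  have "fr ?t \<le> fr ?s"
    by (rule Suc.IH) (use Suc.prems in \<open>auto split: if_splits\<close>)
  moreover have "s 0 = t 0" using Suc.prems(3) by simp
  ultimately show ?case
    using b Suc.prems by (subst (1 2) fr_unfold) (auto intro!: divide_left_mono mult_pos_pos add_nonneg_pos)
qed

text \<open>Only the first disagreement matters. The hypothesis is conditional on agreement before
  \<open>n\<close> because a certificate can exclude a deviation only from the digits that precede
  it.\<close>

lemma fr_le_if_no_wrong_deviation:
  assumes "\<And>k. 0 < s k" "\<And>k. 0 < t k"
    and "\<And>n. (\<And>k. k < n \<Longrightarrow> s k = t k) \<Longrightarrow> \<not> (if even n then s n < t n else t n < s n)"
  shows "fr s \<le> fr t"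
proof (cases "s = t")
  case False
  then obtain m where "s m \<noteq> t m" by auto
  define n where "n = (LEAST n. s n \<noteq> t n)"
  have n: "s n \<noteq> t n" unfolding n_def by (rule LeastI) fact
  have eq: "s k = t k" if "k < n" for k
    using not_less_Least[of k "\<lambda>n. s n \<noteq> t n"] that by (auto simp: n_def)
  have "\<not> (if even n then s n < t n else t n < s n)"
    using assms(3) eq by blast
  then show ?thesis
    using n by (intro fr_mono_first_difference[OF assms(1,2) eq]) (auto split: if_splits)
qed simp

text \<open>The infimum \<open>m\<close> of all tails over the alphabet bounds itself: every tail is
  at most 1/(1 + m), hence at least 1/(A + 1/(1 + m)). This yields A m^2 + A m \<ge> 1, so any
  \<open>lo\<close> on the other side of that inequality is at most \<open>m\<close>. The extremal
  tail [0; A, 1, A, 1, ...] never has to be evaluated.\<close>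

lemma fr_digit_bounds:
  fixes lo :: real and A :: nat
  assumes lo: "0 \<le> lo" "real A * lo * lo + real A * lo \<le> 1"
    and s: "\<And>k. s k \<in> {1..A}"
  shows "lo \<le> fr s" "fr s \<le> 1 / (1 + lo)"
proof -
  define S where "S = fr ` {s. \<forall>k. s k \<in> {1..A}}"
  define m where "m = Inf S"
  have A: "0 < A" using s[of 0] by auto
  have pos: "0 < t k" if "\<forall>k. t k \<in> {1..A}" for t k
    using that[rule_format, of k] by simp
  have ge0: "\<And>z. z \<in> S \<Longrightarrow> 0 \<le> z"
  proof -
    fix z assume "z \<in> S"
    then obtain t where t: "\<forall>k. t k \<in> {1..A}" "z = fr t" by (auto simp: S_def)
    then show "0 \<le> z" using fr_bounds(1)[of t] pos[OF t(1)] by simp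
  qed
  have ne: "S \<noteq> {}" using s by (auto simp: S_def)
  have bdd: "bdd_below S" using ge0 by (intro bdd_belowI) auto
  have m0: "0 \<le> m" unfolding m_def using ne ge0 by (intro cInf_greatest)
  have m_le: "m \<le> fr t" if "\<forall>k. t k \<in> {1..A}" for t
    unfolding m_def by (rule cInf_lower[OF _ bdd]) (use that in \<open>auto simp: S_def\<close>)
  have up: "fr t \<le> 1 / (1 + m)" if t: "\<forall>k. t k \<in> {1..A}" for t
  proof -
    have "1 + m \<le> real (t 0) + fr (\<lambda>k. t (Suc k))"
      using m_le[of "\<lambda>k. t (Suc k)"] t[rule_format, of 0] t by (intro add_mono) auto
    then show ?thesis
      using pos[OF t] m0 by (subst fr_unfold) (auto intro!: divide_left_mono)
  qed
  have low: "1 / (real A + 1 / (1 + m)) \<le> fr t" if t: "\<forall>k. t k \<in> {1..A}" for t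
  proof -
    have "real (t 0) + fr (\<lambda>k. t (Suc k)) \<le> real A + 1 / (1 + m)"
      using up[of "\<lambda>k. t (Suc k)"] t[rule_format, of 0] t by (intro add_mono) auto
    moreover have "0 < real (t 0) + fr (\<lambda>k. t (Suc k))"
      using t pos by (intro add_pos_pos fr_bounds(1)) auto
    ultimately show ?thesis
      using pos[OF t] m0 A by (subst fr_unfold) (auto intro!: divide_left_mono add_pos_nonneg)
  qed
  have "1 / (real A + 1 / (1 + m)) \<le> m"
    unfolding m_def using ne by (intro cInf_greatest) (use low in \<open>auto simp: S_def m_def\<close>)
  moreover have "1 / (real A + 1 / (1 + m)) = (1 + m) / (real A * (1 + m) + 1)"
    using m0 A by (simp add: field_simps add_nonneg_eq_0_iff)
  ultimately have "(1 + m) / (real A * (1 + m) + 1) \<le> m" by simp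
  then have "1 + m \<le> m * (real A * (1 + m) + 1)"
    using m0 A by (subst (asm) pos_divide_le_eq) (auto intro!: add_nonneg_pos)
  then have ge1: "1 \<le> real A * m * m + real A * m" by (simp add: algebra_simps)
  have "lo \<le> m"
  proof (rule ccontr)
    assume "\<not> lo \<le> m"
    then have lt: "m < lo" by simp
    have "real A * m * m \<le> real A * lo * lo"
      using lt m0 by (intro mult_mono) auto
    moreover have "real A * m < real A * lo" using lt A by simp
    ultimately show False using ge1 lo by linarith
  qed
  then show "lo \<le> fr s" "fr s \<le> 1 / (1 + lo)"
    using m_le[of s] up[of s] s lo by (auto intro: order_trans intro!: divide_left_mono order_trans[OF up])
qed

section \<open>The subshift of the windows of a periodic sequence\<close>

text \<open>Prescribing the allowed windows makes finite type immediate: the words of length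
  \<open>L\<close> over the alphabet that do not occur in \<open>c\<close> are finitely many. It
  also lets every value be estimated from a stretch of \<open>c\<close>.\<close>

definition window_shift :: "nat \<Rightarrow> biseq \<Rightarrow> biseq set" where
  "window_shift L c = {a. \<forall>i. \<exists>j. \<forall>k<L. a (i + int k) = c (j + int k)}"

lemma window_shift_digit:
  assumes "a \<in> window_shift L c" "0 < L"
  shows "\<exists>j. a i = c j"
proof -
  obtain j where "\<forall>k<L. a (i + int k) = c (j + int k)"
    using assms(1) by (auto simp: window_shift_def)
  then have "a (i + int 0) = c (j + int 0)" using assms(2) by blast
  then show ?thesis by auto
qed

lemma window_shift_self: "c \<in> window_shift L c"
  by (auto simp: window_shift_def)

lemma window_shift_sft:
  assumes "0 < L" "\<And>i. c i \<in> {1..A}"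
  shows "subshift_of_finite_type (window_shift L c)"
proof -
  define F where "F = {w. set w \<subseteq> {1..A} \<and> length w = L \<and> \<not> occurs_in w c}"
  have "finite F"
    by (rule finite_subset[OF _ finite_lists_length_eq[of "{1..A}" L]]) (auto simp: F_def)
  moreover have "window_shift L c = {a. (\<forall>i. a i \<in> {1..A}) \<and> (\<forall>w\<in>F. \<not> occurs_in w a)}"
  proof (intro set_eqI iffI)
    fix a assume a: "a \<in> window_shift L c"
    have "a i \<in> {1..A}" for i
      using window_shift_digit[OF a assms(1), of i] assms(2) by metis
    moreover have "\<not> occurs_in w a" if w: "w \<in> F" for w
    proof
      assume "occurs_in w a"
      then obtain i where i: "\<forall>k<length w. a (i + int k) = w ! k"
        by (auto simp: occurs_in_def occurs_at_def)
      obtain j where "\<forall>k<L. a (i + int k) = c (j + int k)"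
        using a by (auto simp: window_shift_def)
      then have "occurs_in w c"
        using i w by (auto simp: occurs_in_def occurs_at_def F_def intro!: exI[of _ j])
      then show False using w by (auto simp: F_def)
    qed
    ultimately show "a \<in> {a. (\<forall>i. a i \<in> {1..A}) \<and> (\<forall>w\<in>F. \<not> occurs_in w a)}" by auto
  next
    fix a assume a: "a \<in> {a. (\<forall>i. a i \<in> {1..A}) \<and> (\<forall>w\<in>F. \<not> occurs_in w a)}"
    show "a \<in> window_shift L c"
      unfolding window_shift_def
    proof (intro CollectI allI)
      fix i
      define w where "w = map (\<lambda>k. a (i + int k)) [0..<L]"
      have "occurs_in w a"
        by (auto simp: occurs_in_def occurs_at_def w_def intro!: exI[of _ i])
      then have "w \<notin> F" using a by auto
      moreover have "set w \<subseteq> {1..A}" using a by (auto simp: w_def)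
      ultimately obtain j where "occurs_at w c j" by (auto simp: F_def w_def occurs_in_def)
      then show "\<exists>j. \<forall>k<L. a (i + int k) = c (j + int k)"
        by (intro exI[of _ j]) (simp add: occurs_at_def w_def)
    qed
  qed
  ultimately show ?thesis unfolding subshift_of_finite_type_def by blast
qed

lemma window_shift_symmetric:
  assumes "\<And>i. c (- i) = c (s + i)"
  shows "symmetric_subshift (window_shift L c)"
proof -
  have rev: "(\<lambda>i. a (- i)) \<in> window_shift L c" if a: "a \<in> window_shift L c" for a
    unfolding window_shift_def
  proof (intro CollectI allI)
    fix i
    \<comment> \<open>The window of the reversed sequence that starts at \<open>i\<close> is the
      window of \<open>a\<close> that starts at 1 - i - L, read backwards.\<close>
    obtain j where j: "\<forall>k<L. a ((1 - i - int L) + int k) = c (j + int k)"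
      using a by (auto simp: window_shift_def)
    have "a (- (i + int k)) = c ((s + 1 - j - int L) + int k)" if "k < L" for k
    proof -
      have "a ((1 - i - int L) + int (L - 1 - k)) = c (j + int (L - 1 - k))"
        using j[rule_format, of "L - 1 - k"] that by linarith
      moreover have "(1 - i - int L) + int (L - 1 - k) = - (i + int k)"
        using that by auto
      moreover have "c (j + int (L - 1 - k)) = c (s + - (j + int (L - 1 - k)))"
        using assms[of "- (j + int (L - 1 - k))"] by (metis minus_minus)
      moreover have "s + - (j + int (L - 1 - k)) = (s + 1 - j - int L) + int k"
        using that by auto
      ultimately show ?thesis by metis
    qed
    then show "\<exists>j. \<forall>k<L. a (- (i + int k)) = c (j + int k)" by blast
  qed
  show ?thesis
    unfolding symmetric_subshift_def
  proof (intro equalityI subsetI)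
    fix a assume "a \<in> (\<lambda>a i. a (- i)) ` window_shift L c"
    then show "a \<in> window_shift L c" using rev by auto
  next
    fix a assume "a \<in> window_shift L c"
    then have "(\<lambda>i. a (- i)) \<in> window_shift L c" by (rule rev)
    then show "a \<in> (\<lambda>a i. a (- i)) ` window_shift L c"
      by (rule rev_image_eqI) simp
  qed
qed

lemma periodic_add_mult:
  fixes c :: "int \<Rightarrow> 'a"
  assumes "\<And>i. c (i + n) = c i"
  shows "c (i + n * m) = c i"
proof -
  have nat: "c (i + n * int k) = c i" for k i
  proof (induction k)
    case (Suc k)
    have "c (i + n * int (Suc k)) = c ((i + n * int k) + n)" by (simp add: algebra_simps)
    then show ?case using Suc assms by simp
  qed simp
  show ?thesis
  proof (cases "0 \<le> m")
    case True
    then show ?thesis using nat[of i "nat m"] by simp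
  next
    case False
    then show ?thesis using nat[of "i + n * m" "nat (- m)"] by simp
  qed
qed

text \<open>Both occurrences continue along the periodic orbit, so one can follow that orbit until it
  is in phase with the second occurrence.\<close>

lemma window_shift_transitive:
  assumes per: "\<And>i. c (i + int n) = c i" and n: "0 < n"
  shows "transitive_subshift (window_shift L c)"
  unfolding transitive_subshift_def
proof (intro conjI allI impI)
  show "window_shift L c \<noteq> {}" using window_shift_self by blast
next
  fix u v
  assume "\<exists>a\<in>window_shift L c. occurs_in u a" "\<exists>a\<in>window_shift L c. occurs_in v a"
  then obtain a i b j where a: "a \<in> window_shift L c" "occurs_at u a i"
    and b: "b \<in> window_shift L c" "occurs_at v b j"
    by (auto simp: occurs_in_def)
  define e where "e = i + int (length u)"
  obtain j1 where j1: "\<And>k. k < L \<Longrightarrow> a (e + int k) = c (j1 + int k)"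
    using a(1) by (fastforce simp: window_shift_def)
  obtain j2 where j2: "\<And>k. k < L \<Longrightarrow> b (j - int L + int k) = c (j2 + int k)"
    using b(1) unfolding window_shift_def by (smt (verit) mem_Collect_eq)
  define r where "r = (j2 - j1) mod int n"
  have r0: "0 \<le> r" using n by (simp add: r_def)
  have cr: "c (j1 + r + t) = c (j2 + t)" for t
  proof -
    have "j2 + t = (j1 + r + t) + int n * ((j2 - j1) div int n)"
      using mult_div_mod_eq[of "int n" "j2 - j1"] by (simp add: r_def)
    then show ?thesis using periodic_add_mult[of c "int n", OF per] by metis
  qed
  \<comment> \<open>Three pieces: \<open>a\<close> through \<open>u\<close>, then
    \<open>r + L\<close> digits of the orbit, then \<open>b\<close> from \<open>v\<close> on.
    Adjacent pieces also agree on \<open>L\<close> further digits beyond their seam, so each window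
    lies in a single one of them.\<close>
  define d where "d = (\<lambda>k. if k < e then a k else if k < e + r + int L then c (j1 + (k - e))
                            else b (k - (e + r + int L) + j))"
  have da: "d k = a k" if "k < e + int L" for k
  proof (cases "k < e")
    case False
    then show ?thesis using that r0 j1[of "nat (k - e)"] by (simp add: d_def)
  qed (simp add: d_def)
  have dc: "d k = c (j1 + (k - e))" if "e \<le> k" "k < e + r + int L" for k
    using that by (simp add: d_def)
  have db: "d k = b (k - (e + r + int L) + j)" if "e + r \<le> k" for k
  proof (cases "k < e + r + int L")
    case True
    have "b (j - int L + int (nat (k - e - r))) = c (j2 + int (nat (k - e - r)))"
      using that True by (intro j2) auto
    moreover have "c (j1 + r + (k - e - r)) = c (j2 + (k - e - r))" by (rule cr)
    moreover have "d k = c (j1 + (k - e))" using that True r0 by (intro dc) auto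
    ultimately show ?thesis using that by (simp add: algebra_simps)
  next
    case False
    then show ?thesis using r0 that by (simp add: d_def)
  qed
  have "d \<in> window_shift L c"
    unfolding window_shift_def
  proof (intro CollectI allI)
    fix q
    consider "q \<le> e" | "e < q" "q \<le> e + r" | "e + r < q" by linarith
    then show "\<exists>j. \<forall>k<L. d (q + int k) = c (j + int k)"
    proof cases
      case 1
      obtain j' where "\<forall>k<L. a (q + int k) = c (j' + int k)"
        using a(1) by (auto simp: window_shift_def)
      then show ?thesis using 1 da by (intro exI[of _ j']) auto
    next
      case 2
      then show ?thesis
        by (intro exI[of _ "j1 + (q - e)"]) (auto simp: dc algebra_simps)
    next
      case 3
      obtain j' where "\<forall>k<L. b (q - (e + r + int L) + j + int k) = c (j' + int k)"
        using b(1) by (auto simp: window_shift_def)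
      then show ?thesis using 3
        by (intro exI[of _ j']) (auto simp: db algebra_simps)
    qed
  qed
  moreover have "occurs_at u d i"
    using a(2) by (auto simp: occurs_at_def da e_def)
  moreover have "occurs_at v d (e + r + int L)"
    using b(2) by (auto simp: occurs_at_def db algebra_simps)
  moreover have "i + int (length u) \<le> e + r + int L" using r0 by (simp add: e_def)
  ultimately show "\<exists>a\<in>window_shift L c. \<exists>i j. occurs_at u a i \<and> occurs_at v a j
      \<and> i + int (length u) \<le> j"
    by blast
qed

text \<open>Modulo the period every window starts below \<open>m\<close>, so a stretch of
  \<open>m + L\<close> digits displays them all. This turns membership into a finite
  comparison.\<close>

lemma window_shift_mem:
  assumes per: "\<And>i. a (i + int m) = a i" and m: "0 < m"
    and match: "\<And>k. k < m + L \<Longrightarrow> a (int k) = c (j + int k)"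
  shows "a \<in> window_shift L c"
  unfolding window_shift_def
proof (intro CollectI allI)
  fix i
  define r where "r = nat (i mod int m)"
  have r: "int r = i mod int m" "r < m" using m by (auto simp: r_def nat_less_iff)
  have "a (i + int k) = c (j + int r + int k)" if "k < L" for k
  proof -
    have "i + int k = int (r + k) + int m * (i div int m)"
      using mult_div_mod_eq[of "int m" i] by (simp add: r)
    then have "a (i + int k) = a (int (r + k))"
      using periodic_add_mult[of a "int m", OF per] by metis
    then show ?thesis using match[of "r + k"] that r(2) by (simp add: algebra_simps)
  qed
  then show "\<exists>j. \<forall>k<L. a (i + int k) = c (j + int k)" by blast
qed

section \<open>The full shift on the digits 1 to A\<close>

lemma full_shift_sft: "subshift_of_finite_type {a. \<forall>i. a i \<in> {1..A}}"
  unfolding subshift_of_finite_type_def by (intro exI[of _ A] exI[of _ "{}"]) auto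

lemma full_shift_symmetric: "symmetric_subshift {a. \<forall>i. a i \<in> {1..A}}"
  unfolding symmetric_subshift_def
proof (intro equalityI subsetI)
  fix a :: biseq assume "a \<in> {a. \<forall>i. a i \<in> {1..A}}"
  then show "a \<in> (\<lambda>a i. a (- i)) ` {a. \<forall>i. a i \<in> {1..A}}"
    by (intro rev_image_eqI[of "\<lambda>i. a (- i)"]) auto
qed auto

lemma full_shift_transitive:
  assumes "0 < A"
  shows "transitive_subshift {a. \<forall>i. a i \<in> {1..A}}"
  unfolding transitive_subshift_def
proof (intro conjI allI impI)
  show "{a. \<forall>i. a i \<in> {1..A}} \<noteq> {}" using assms by (auto intro!: exI[of _ "\<lambda>_. 1"])
next
  fix u v
  assume "\<exists>a\<in>{a. \<forall>i. a i \<in> {1..A}}. occurs_in u a" "\<exists>a\<in>{a. \<forall>i. a i \<in> {1..A}}. occurs_in v a"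
  then obtain a i b j where a: "\<forall>i. a i \<in> {1..A}" "occurs_at u a i"
    and b: "\<forall>i. b i \<in> {1..A}" "occurs_at v b j"
    by (auto simp: occurs_in_def)
  define e where "e = i + int (length u)"
  define d where "d = (\<lambda>k. if k < e then a k else b (k - e + j))"
  have "occurs_at u d i" "occurs_at v d e"
    using a b by (auto simp: occurs_at_def d_def e_def algebra_simps)
  moreover have "\<forall>i. d i \<in> {1..A}" using a b by (auto simp: d_def)
  ultimately show "\<exists>a\<in>{a. \<forall>i. a i \<in> {1..A}}. \<exists>i j. occurs_at u a i \<and> occurs_at v a j
      \<and> i + int (length u) \<le> j"
    unfolding e_def by blast
qed

lemma full_shift_symmetric_transitive_sft:
  "0 < A \<Longrightarrow> symmetric_transitive_sft {a. \<forall>i. a i \<in> {1..A}}"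
  unfolding symmetric_transitive_sft_def
  using full_shift_sft full_shift_symmetric full_shift_transitive by blast

section \<open>Checking certificates\<close>

text \<open>A pair \<open>(p, q)\<close> stands for the fraction \<open>p / q\<close>.  Contexts to the left of a position are
  stored in reverse, the nearest digit first.  The first argument of \<open>cf_bound\<close> is the bound in
  force at the current digit; the two bounds swap at each digit because \<open>x \<mapsto> 1 / (d + x)\<close> is antitone.\<close>

fun mobius :: "int \<Rightarrow> int \<times> int \<Rightarrow> int \<times> int" where
  "mobius d (p, q) = (q, d * q + p)"

fun cf_bound :: "int \<times> int \<Rightarrow> int \<times> int \<Rightarrow> int list \<Rightarrow> int \<times> int" where
  "cf_bound e f [] = e"
| "cf_bound e f (d # ds) = mobius d (cf_bound f e ds)"

fun cf_bound_upto :: "nat \<Rightarrow> int \<times> int \<Rightarrow> int \<times> int \<Rightarrow> int list \<Rightarrow> int \<times> int" where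
  "cf_bound_upto 0 e f ds = e"
| "cf_bound_upto (Suc n) e f [] = e"
| "cf_bound_upto (Suc n) e f (d # ds) = mobius d (cf_bound_upto n f e ds)"

fun sum_le :: "int \<times> int \<Rightarrow> int \<times> int \<Rightarrow> int \<Rightarrow> int \<times> int \<Rightarrow> bool" where
  "sum_le (p1, q1) (p2, q2) d (p, q) \<longleftrightarrow> (d * (q1 * q2) + p1 * q2 + p2 * q1) * q \<le> p * (q1 * q2)"

fun sum_ge :: "int \<times> int \<Rightarrow> int \<times> int \<Rightarrow> int \<Rightarrow> int \<times> int \<Rightarrow> bool" where
  "sum_ge (p1, q1) (p2, q2) d (p, q) \<longleftrightarrow> p * (q1 * q2) \<le> (d * (q1 * q2) + p1 * q2 + p2 * q1) * q"

fun is_pref :: "int list \<Rightarrow> int list \<Rightarrow> bool" where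
  "is_pref [] ys \<longleftrightarrow> True"
| "is_pref (x # xs) [] \<longleftrightarrow> False"
| "is_pref (x # xs) (y # ys) \<longleftrightarrow> x = y \<and> is_pref xs ys"

text \<open>Forbidden words are reversed like the contexts, so a forbidden word that has just been
  completed by its last digit is a prefix.\<close>

fun hit :: "int list list \<Rightarrow> int list \<Rightarrow> bool" where
  "hit [] r \<longleftrightarrow> False"
| "hit (f # F) r \<longleftrightarrow> is_pref f r \<or> hit F r"

fun hit_any :: "int list list \<Rightarrow> int list \<Rightarrow> bool" where
  "hit_any F [] \<longleftrightarrow> False"
| "hit_any F (x # r) \<longleftrightarrow> hit F (x # r) \<or> hit_any F r"

fun hit_all :: "int list list \<Rightarrow> int list \<Rightarrow> int list \<Rightarrow> bool" where
  "hit_all F [] r \<longleftrightarrow> True"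
| "hit_all F (d # ds) r \<longleftrightarrow> hit F (d # r) \<and> hit_all F ds r"

text \<open>\<open>Centre l d r\<close> is the word \<open>rev l @ d # r\<close>, forbidden by its value at \<open>d\<close>; \<open>Ext w\<close> is a
  reversed word that is forbidden because all its extensions to the right are.\<close>

datatype forb = Centre "int list" int "int list" | Ext "int list"

fun forb_word :: "forb \<Rightarrow> int list" where
  "forb_word (Centre l d r) = rev r @ d # l"
| "forb_word (Ext w) = w"

fun forb_ok :: "int \<times> int \<Rightarrow> int \<times> int \<Rightarrow> int list \<Rightarrow> int \<times> int \<Rightarrow> int list list \<Rightarrow> forb \<Rightarrow> bool" where
  "forb_ok lo hi ds y F (Centre l d r) \<longleftrightarrow> sum_ge (cf_bound lo hi l) (cf_bound lo hi r) d y"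
| "forb_ok lo hi ds y F (Ext w) \<longleftrightarrow> hit_all F ds w"

text \<open>The list of known words grows during the check, so an \<open>Ext\<close> entry may rely
  on all the entries before it.\<close>

fun forbs_ok :: "int \<times> int \<Rightarrow> int \<times> int \<Rightarrow> int list \<Rightarrow> int \<times> int \<Rightarrow> int list list \<Rightarrow> forb list \<Rightarrow> bool" where
  "forbs_ok lo hi ds y F [] \<longleftrightarrow> True"
| "forbs_ok lo hi ds y F (e # es) \<longleftrightarrow> forb_ok lo hi ds y F e \<and> forbs_ok lo hi ds y (forb_word e # F) es"

fun wrong :: "bool \<Rightarrow> int \<Rightarrow> int \<Rightarrow> bool" where
  "wrong True d x \<longleftrightarrow> d < x"
| "wrong False d x \<longleftrightarrow> x < d"

text \<open>The sign \<open>sg\<close> records the parity of the position: a digit smaller than that of the reference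
  word raises the value of the tail at an even position and lowers it at an odd one.\<close>

fun dev_hit :: "int list list \<Rightarrow> bool \<Rightarrow> int \<Rightarrow> int list \<Rightarrow> int list \<Rightarrow> bool" where
  "dev_hit F sg x r [] \<longleftrightarrow> True"
| "dev_hit F sg x r (d # ds) \<longleftrightarrow> (\<not> wrong sg d x \<or> hit F (d # r)) \<and> dev_hit F sg x r ds"

fun dev_ok :: "int list \<Rightarrow> int list list \<Rightarrow> bool \<Rightarrow> int list \<Rightarrow> int list \<Rightarrow> bool" where
  "dev_ok ds F sg r [] \<longleftrightarrow> True"
| "dev_ok ds F sg r (x # w) \<longleftrightarrow> dev_hit F sg x r ds \<and> dev_ok ds F (\<not> sg) (x # r) w"

text \<open>An alternating comparison of two tails known only by finite prefixes. An undecided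
  comparison counts as failure, so a success holds for all extensions of both prefixes.\<close>

fun below :: "bool \<Rightarrow> int list \<Rightarrow> int list \<Rightarrow> bool" where
  "below sg [] e \<longleftrightarrow> False"
| "below sg (x # r) [] \<longleftrightarrow> False"
| "below sg (x # r) (y # e) \<longleftrightarrow> (x = y \<and> below (\<not> sg) r e) \<or> wrong sg y x"

text \<open>The short contexts of length \<open>m\<close> usually suffice; the longer ones are costly.\<close>

fun safe_at :: "nat \<times> nat \<Rightarrow> int \<times> int \<Rightarrow> int \<times> int \<Rightarrow> int \<times> int \<Rightarrow> int list \<Rightarrow> int \<Rightarrow> int list \<Rightarrow> bool" where
  "safe_at (m, n) lo hi th r x w \<longleftrightarrow>
     sum_le (cf_bound_upto m hi lo r) (cf_bound_upto m hi lo w) x th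
     \<or> sum_le (cf_bound_upto n hi lo r) (cf_bound_upto n hi lo w) x th"

fun safe_num :: "nat \<times> nat \<Rightarrow> int \<times> int \<Rightarrow> int \<times> int \<Rightarrow> int \<times> int \<Rightarrow> int list \<Rightarrow> nat \<Rightarrow> int list \<Rightarrow> bool" where
  "safe_num R lo hi th r 0 w \<longleftrightarrow> True"
| "safe_num R lo hi th r (Suc n) [] \<longleftrightarrow> False"
| "safe_num R lo hi th r (Suc n) (x # w) \<longleftrightarrow>
     safe_at R lo hi th r x w \<and> safe_num R lo hi th (x # r) n w"

text \<open>\<open>e\<close> is the left half of the periodic orbit.  If \<open>r\<close> lies below it, then the value at the
  current position is at most that of the orbit, whatever precedes \<open>r\<close>.\<close>

fun safe_tail :: "nat \<times> nat \<Rightarrow> int \<times> int \<Rightarrow> int \<times> int \<Rightarrow> int \<times> int \<Rightarrow> int list \<Rightarrow> int list \<Rightarrow> nat \<Rightarrow> int list \<Rightarrow> bool" where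
  "safe_tail R lo hi th r e 0 w \<longleftrightarrow> True"
| "safe_tail R lo hi th r e (Suc n) [] \<longleftrightarrow> False"
| "safe_tail R lo hi th r e (Suc n) (x # w) \<longleftrightarrow>
     (below True r e \<or> safe_at R lo hi th r x w)
     \<and> safe_tail R lo hi th (x # r) (x # e) n w"

fun unroll :: "nat \<Rightarrow> int list \<Rightarrow> int list \<Rightarrow> int list" where
  "unroll 0 t p = []"
| "unroll (Suc n) (x # t) p = x # unroll n t p"
| "unroll (Suc n) [] [] = []"
| "unroll (Suc n) [] (x # p) = x # unroll n p (x # p)"


text \<open>A certificate for the connection: a tree over the left contexts.  At a leaf the continuation
  \<open>t p p p \<dots>\<close> is used; \<open>Dead\<close> marks left contexts that do not admit both digits.\<close>

datatype tree = Dead | Leaf "int list" "int list" | Node "tree list"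

text \<open>A word with first digit \<open>b1\<close> automatically lies above every tail beginning
  with \<open>b2\<close>, so only minimality among the continuations beginning with
  \<open>b1\<close> has to be checked; the case \<open>b2\<close> is dual. For a digit strictly
  between them both comparisons are settled by the first digit.\<close>

fun first_ok :: "int list \<Rightarrow> int list list \<Rightarrow> int \<Rightarrow> int \<Rightarrow> int list \<Rightarrow> int list \<Rightarrow> bool" where
  "first_ok ds F b1 b2 u [] \<longleftrightarrow> False"
| "first_ok ds F b1 b2 u (c # w) \<longleftrightarrow>
     (c = b1 \<and> dev_ok ds F True (c # u) w) \<or> (c = b2 \<and> dev_ok ds F False (c # u) w) \<or> (b1 < c \<and> c < b2)"

fun mem_list :: "int list list \<Rightarrow> int list \<Rightarrow> bool" where
  "mem_list [] x \<longleftrightarrow> False"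
| "mem_list (y # ys) x \<longleftrightarrow> x = y \<or> mem_list ys x"

fun digits_ok :: "int \<Rightarrow> int list \<Rightarrow> bool" where
  "digits_ok A [] \<longleftrightarrow> True"
| "digits_ok A (d # ds) \<longleftrightarrow> 1 \<le> d \<and> d \<le> A \<and> digits_ok A ds"

text \<open>\<open>K\<close> bounds the lengths of the forbidden words: after \<open>t\<close>, one
  period and \<open>K\<close> more digits all deviation tests repeat. The reversed period is
  unrolled to the length of \<open>rev t @ u\<close>, the left context with which it is
  compared.\<close>

fun leaf_ok :: "nat \<times> nat \<Rightarrow> nat \<Rightarrow> int \<times> int \<Rightarrow> int \<times> int \<Rightarrow> int \<times> int \<Rightarrow> int list \<Rightarrow> int list list \<Rightarrow> int list list
    \<Rightarrow> int \<Rightarrow> int \<Rightarrow> int list \<Rightarrow> int list \<Rightarrow> int list \<Rightarrow> bool" where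
  "leaf_ok R K lo hi th ds F ps b1 b2 u t p \<longleftrightarrow>
     mem_list ps p \<and> digits_ok (int (length ds)) t
     \<and> first_ok ds F b1 b2 u (unroll (length t + length p + K) t p)
     \<and> safe_num R lo hi th u (length t) (unroll (length t + snd R) t p)
     \<and> safe_tail R lo hi th (rev t @ u) (unroll (length t + length u) [] (rev p)) (length p)
         (unroll (length p + snd R) [] p)"

text \<open>As contexts are reversed, looking one digit further into the past appends a digit at the
  end of \<open>u\<close>.\<close>

fun tree_ok :: "nat \<times> nat \<Rightarrow> nat \<Rightarrow> int \<times> int \<Rightarrow> int \<times> int \<Rightarrow> int \<times> int \<Rightarrow> int list \<Rightarrow> int list list \<Rightarrow> int list list
    \<Rightarrow> int \<Rightarrow> int \<Rightarrow> int list \<Rightarrow> tree \<Rightarrow> bool"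
  and trees_ok :: "nat \<times> nat \<Rightarrow> nat \<Rightarrow> int \<times> int \<Rightarrow> int \<times> int \<Rightarrow> int \<times> int \<Rightarrow> int list \<Rightarrow> int list list \<Rightarrow> int list list
    \<Rightarrow> int \<Rightarrow> int \<Rightarrow> int list \<Rightarrow> int list \<Rightarrow> tree list \<Rightarrow> bool" where
  "tree_ok R K lo hi th ds F ps b1 b2 u Dead \<longleftrightarrow> hit_any F (b1 # u) \<or> hit_any F (b2 # u)"
| "tree_ok R K lo hi th ds F ps b1 b2 u (Leaf t p) \<longleftrightarrow> leaf_ok R K lo hi th ds F ps b1 b2 u t p"
| "tree_ok R K lo hi th ds F ps b1 b2 u (Node ts) \<longleftrightarrow> trees_ok R K lo hi th ds F ps b1 b2 u ds ts"
| "trees_ok R K lo hi th ds F ps b1 b2 u [] ts \<longleftrightarrow> True"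
| "trees_ok R K lo hi th ds F ps b1 b2 u (d # es) [] \<longleftrightarrow> False"
| "trees_ok R K lo hi th ds F ps b1 b2 u (d # es) (t # ts) \<longleftrightarrow>
     tree_ok R K lo hi th ds F ps b1 b2 (u @ [d]) t \<and> trees_ok R K lo hi th ds F ps b1 b2 u es ts"

fun row_ok :: "nat \<times> nat \<Rightarrow> nat \<Rightarrow> int \<times> int \<Rightarrow> int \<times> int \<Rightarrow> int \<times> int \<Rightarrow> int list \<Rightarrow> int list list \<Rightarrow> int list list
    \<Rightarrow> int \<Rightarrow> int list \<Rightarrow> tree list \<Rightarrow> bool" where
  "row_ok R K lo hi th ds F ps b1 [] ts \<longleftrightarrow> True"
| "row_ok R K lo hi th ds F ps b1 (b2 # bs) [] \<longleftrightarrow> False"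
| "row_ok R K lo hi th ds F ps b1 (b2 # bs) (t # ts) \<longleftrightarrow>
     tree_ok R K lo hi th ds F ps b1 b2 [] t \<and> row_ok R K lo hi th ds F ps b1 bs ts"

fun rows_ok :: "nat \<times> nat \<Rightarrow> nat \<Rightarrow> int \<times> int \<Rightarrow> int \<times> int \<Rightarrow> int \<times> int \<Rightarrow> int list \<Rightarrow> int list list \<Rightarrow> int list list
    \<Rightarrow> int list \<Rightarrow> tree list list \<Rightarrow> bool" where
  "rows_ok R K lo hi th ds F ps [] tss \<longleftrightarrow> True"
| "rows_ok R K lo hi th ds F ps (b # bs) [] \<longleftrightarrow> False"
| "rows_ok R K lo hi th ds F ps (b # bs) (ts # tss) \<longleftrightarrow>
     row_ok R K lo hi th ds F ps b bs ts \<and> rows_ok R K lo hi th ds F ps bs tss"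

fun short_words :: "nat \<Rightarrow> int list list \<Rightarrow> bool" where
  "short_words K [] \<longleftrightarrow> True"
| "short_words K (f # F) \<longleftrightarrow> length f \<le> K \<and> short_words K F"

text \<open>With even length a shift by one period preserves the parity of positions, hence the
  direction in which a digit acts on the value.\<close>

fun periods_ok :: "int \<Rightarrow> int list list \<Rightarrow> bool" where
  "periods_ok A [] \<longleftrightarrow> True"
| "periods_ok A (p # ps) \<longleftrightarrow> p \<noteq> [] \<and> even (length p) \<and> digits_ok A p \<and> periods_ok A ps"

text \<open>The inequality A x^2 + A x \<le> 1 at x = p/q. Its positive root is
  [0; A, 1, A, 1, ...], the least tail over the alphabet; the fractions used below are slightly
  smaller.\<close>

fun lo_ok :: "int \<Rightarrow> int \<times> int \<Rightarrow> bool" where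
  "lo_ok A (p, q) \<longleftrightarrow> 0 < p \<and> 0 < q \<and> A * p * p + A * p * q \<le> q * q"

fun level_ok :: "int \<Rightarrow> int \<times> int \<Rightarrow> bool" where
  "level_ok A (p, q) \<longleftrightarrow> 0 < q \<and> p * (A + 2) \<le> ((A + 1) * (A + 2) + 2) * q"

fun hi_of :: "int \<times> int \<Rightarrow> int \<times> int" where
  "hi_of (p, q) = (q, p + q)"

fun connect_with :: "nat \<times> nat \<Rightarrow> nat \<Rightarrow> int \<times> int \<Rightarrow> int \<times> int \<Rightarrow> int \<Rightarrow> int list \<Rightarrow> int \<times> int \<Rightarrow> int \<times> int \<Rightarrow> forb list
    \<Rightarrow> int list list \<Rightarrow> tree list list \<Rightarrow> int list list \<Rightarrow> bool" where
  "connect_with R K lo hi A ds y th fs ps tss F \<longleftrightarrow>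
     lo_ok A lo \<and> level_ok A y \<and> 0 < snd th \<and> ds = [1..A] \<and> 0 < K \<and> periods_ok A ps \<and> short_words K F
     \<and> forbs_ok lo hi ds y [] fs \<and> rows_ok R K lo hi th ds F ps ds tss"

text \<open>\<open>[1..A]\<close> is the alphabet, \<open>lo\<close> a lower bound of the tails over it, \<open>y\<close> the level of the
  admissible sequences, \<open>th\<close> the level that the new sequences must respect, \<open>ps\<close> the list of the
  periods at the leaves, and \<open>tss\<close> has one row of trees for each smaller first digit.\<close>

definition connect_ok :: "nat \<times> nat \<Rightarrow> nat \<Rightarrow> int \<times> int \<Rightarrow> int \<Rightarrow> int list \<Rightarrow> int \<times> int \<Rightarrow> int \<times> int \<Rightarrow> forb list
    \<Rightarrow> int list list \<Rightarrow> tree list list \<Rightarrow> bool" where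
  "connect_ok R K lo A ds y th fs ps tss \<longleftrightarrow>
     connect_with R K lo (hi_of lo) A ds y th fs ps tss (map forb_word fs)"

text \<open>A common stretch of \<open>length p + L\<close> digits is what
  \<open>window_shift_mem\<close> needs to place the whole orbit of \<open>p\<close> in the subshift
  of \<open>c\<close>.\<close>

fun offsets_ok :: "nat \<Rightarrow> int list \<Rightarrow> int list list \<Rightarrow> nat list \<Rightarrow> bool" where
  "offsets_ok L c [] os \<longleftrightarrow> True"
| "offsets_ok L c (p # ps) [] \<longleftrightarrow> False"
| "offsets_ok L c (p # ps) (k # os) \<longleftrightarrow>
     is_pref (unroll (length p + L) [] p) (drop k (unroll (k + (length p + L)) [] c)) \<and> offsets_ok L c ps os"

fun high_ok :: "int \<times> int \<Rightarrow> int \<times> int \<Rightarrow> int \<times> int \<Rightarrow> int list \<Rightarrow> int list \<Rightarrow> bool" where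
  "high_ok lo hi th l [] \<longleftrightarrow> False"
| "high_ok lo hi th l (x # r) \<longleftrightarrow> sum_ge (cf_bound lo hi l) (cf_bound lo hi r) x th"

text \<open>\<open>c\<close> is the period that defines the subshift, cut so that its highest value is at its first
  digit; \<open>X\<close> bounds the values at the centres of the windows of length \<open>2 * snd h + 1\<close>; reversing
  \<open>c\<close> rotates it by \<open>s\<close>; and \<open>os\<close> says where the periods \<open>ps\<close> are found in the orbit.\<close>

definition orbit_ok :: "nat \<times> nat \<Rightarrow> nat \<Rightarrow> int \<times> int \<Rightarrow> int \<Rightarrow> int \<times> int \<Rightarrow> int \<times> int \<Rightarrow> int list \<Rightarrow> nat
    \<Rightarrow> int list list \<Rightarrow> nat list \<Rightarrow> bool" where
  "orbit_ok h g lo A th X c s ps os \<longleftrightarrow>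
     c \<noteq> [] \<and> digits_ok A c \<and> s \<le> length c \<and> rev c = drop s c @ take s c \<and> fst h \<le> snd h
     \<and> 0 < snd X
     \<and> high_ok lo (hi_of lo) th (unroll g [] (rev c)) (unroll g [] c)
     \<and> safe_num h lo (hi_of lo) X (unroll (snd h) [] (rev c)) (length c) (unroll (length c + snd h) [] c)
     \<and> offsets_ok (2 * snd h + 1) c ps os"

section \<open>Soundness of the checker\<close>

definition rv :: "int \<times> int \<Rightarrow> real" where
  "rv x = real_of_int (fst x) / real_of_int (snd x)"

definition pos_pair :: "int \<times> int \<Rightarrow> bool" where
  "pos_pair x \<longleftrightarrow> 0 < fst x \<and> 0 < snd x"

fun reads :: "int list \<Rightarrow> (nat \<Rightarrow> nat) \<Rightarrow> bool" where
  "reads [] s \<longleftrightarrow> True"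
| "reads (d # ds) s \<longleftrightarrow> int (s 0) = d \<and> reads ds (\<lambda>k. s (Suc k))"

lemma reads_nth: "reads ds s \<longleftrightarrow> (\<forall>k<length ds. int (s k) = ds ! k)"
proof (induction ds arbitrary: s)
  case (Cons d ds)
  show ?case
    unfolding reads.simps Cons by (auto simp: less_Suc_eq_0_disj)
qed simp

lemma reads_append: "reads (xs @ ys) s \<longleftrightarrow> reads xs s \<and> reads ys (\<lambda>k. s (k + length xs))"
  by (induction xs arbitrary: s) auto

lemma reads_cong:
  assumes "reads ds s" "\<And>k. k < length ds \<Longrightarrow> t k = s k"
  shows "reads ds t"
  using assms by (simp add: reads_nth)

lemma mobius_pos: "1 \<le> d \<Longrightarrow> pos_pair x \<Longrightarrow> pos_pair (mobius d x)"
  by (cases x) (auto simp: pos_pair_def intro!: add_nonneg_pos)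

lemma rv_mobius: "1 \<le> d \<Longrightarrow> pos_pair x \<Longrightarrow> rv (mobius d x) = 1 / (real_of_int d + rv x)"
  by (cases x) (auto simp: rv_def pos_pair_def field_simps)

lemma rv_pos: "pos_pair x \<Longrightarrow> 0 < rv x"
  by (simp add: rv_def pos_pair_def)

lemma sum_le_iff:
  assumes "pos_pair a" "pos_pair b" "0 < snd c"
  shows "sum_le a b d c \<longleftrightarrow> real_of_int d + rv a + rv b \<le> rv c"
proof -
  obtain p1 q1 p2 q2 p q where abc: "a = (p1, q1)" "b = (p2, q2)" "c = (p, q)"
    by (metis surj_pair)
  have q: "0 < q1" "0 < q2" "0 < q" using assms by (auto simp: abc pos_pair_def)
  then have "real_of_int d + rv a + rv b = of_int (d * (q1 * q2) + p1 * q2 + p2 * q1) / of_int (q1 * q2)"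
    by (simp add: abc rv_def field_simps)
  then have "real_of_int d + rv a + rv b \<le> rv c \<longleftrightarrow>
    real_of_int ((d * (q1 * q2) + p1 * q2 + p2 * q1) * q) \<le> real_of_int (p * (q1 * q2))"
    using q by (simp add: abc rv_def pos_divide_le_eq pos_le_divide_eq mult.commute)
  then show ?thesis by (simp only: abc sum_le.simps of_int_le_iff)
qed

lemma sum_ge_iff:
  assumes "pos_pair a" "pos_pair b" "0 < snd c"
  shows "sum_ge a b d c \<longleftrightarrow> rv c \<le> real_of_int d + rv a + rv b"
proof -
  obtain p1 q1 p2 q2 p q where abc: "a = (p1, q1)" "b = (p2, q2)" "c = (p, q)"
    by (metis surj_pair)
  have q: "0 < q1" "0 < q2" "0 < q" using assms by (auto simp: abc pos_pair_def)
  then have "real_of_int d + rv a + rv b = of_int (d * (q1 * q2) + p1 * q2 + p2 * q1) / of_int (q1 * q2)"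
    by (simp add: abc rv_def field_simps)
  then have "rv c \<le> real_of_int d + rv a + rv b \<longleftrightarrow>
    real_of_int (p * (q1 * q2)) \<le> real_of_int ((d * (q1 * q2) + p1 * q2 + p2 * q1) * q)"
    using q by (simp add: abc rv_def pos_divide_le_eq pos_le_divide_eq mult.commute)
  then show ?thesis by (simp only: abc sum_ge.simps of_int_le_iff)
qed

lemma is_pref_iff: "is_pref f r \<longleftrightarrow> take (length f) r = f"
  by (induction f r rule: is_pref.induct) auto

lemma is_pref_reads: "is_pref f r \<Longrightarrow> reads r s \<Longrightarrow> reads f s"
  by (induction f r arbitrary: s rule: is_pref.induct) auto

lemma hit_iff: "hit F r \<longleftrightarrow> (\<exists>f\<in>set F. is_pref f r)"
  by (induction F) auto

lemma hit_all_iff: "hit_all F ds r \<longleftrightarrow> (\<forall>d\<in>set ds. hit F (d # r))"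
  by (induction ds) auto

lemma hit_any_iff: "hit_any F r \<longleftrightarrow> (\<exists>k<length r. hit F (drop k r))"
proof (induction r)
  case (Cons x r)
  then show ?case by (auto simp: less_Suc_eq_0_disj)
qed simp

lemma dev_hit_iff: "dev_hit F sg x r ds \<longleftrightarrow> (\<forall>d\<in>set ds. wrong sg d x \<longrightarrow> hit F (d # r))"
  by (induction ds) auto

lemma dev_ok_nth:
  assumes "dev_ok ds F sg r w" "n < length w" "d \<in> set ds" "wrong (sg = even n) d (w ! n)"
  shows "hit F (d # rev (take n w) @ r)"
  using assms
proof (induction w arbitrary: sg r n)
  case (Cons x w)
  show ?case
  proof (cases n)
    case 0
    then show ?thesis using Cons.prems by (auto simp: dev_hit_iff)
  next
    case (Suc m)
    have sg: "((\<not> sg) = even m) = (sg = even n)" using Suc by auto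
    have "hit F (d # rev (take m w) @ (x # r))"
      by (rule Cons.IH[of "\<not> sg"]) (use Cons.prems Suc in \<open>auto simp: sg\<close>)
    then show ?thesis by (simp add: Suc)
  qed
qed simp

lemma below_sound:
  assumes "below sg r e" "reads r s" "reads e t" "\<And>k. 0 < s k" "\<And>k. 0 < t k"
  shows "if sg then fr s \<le> fr t else fr t \<le> fr s"
  using assms
proof (induction sg r e arbitrary: s t rule: below.induct)
  case (3 sg x r y e)
  let ?s = "\<lambda>k. s (Suc k)" and ?t = "\<lambda>k. t (Suc k)"
  have st: "int (s 0) = x" "int (t 0) = y" using 3 by auto
  show ?case
  proof (cases "wrong sg y x")
    case True
    then show ?thesis
      using st 3(5,6) fr_mono_first_difference[of s t 0] fr_mono_first_difference[of t s 0]
      by (cases sg) auto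
  next
    case False
    then have eq: "x = y" "below (\<not> sg) r e" using 3(2) by auto
    have IH: "if \<not> sg then fr ?s \<le> fr ?t else fr ?t \<le> fr ?s"
      by (rule 3(1)) (use 3 eq in auto)
    have "0 < fr ?s" "0 < fr ?t" using 3(5,6) by (auto intro!: fr_bounds)
    moreover have "fr s = 1 / (real (s 0) + fr ?s)" "fr t = 1 / (real (t 0) + fr ?t)"
      using 3(5,6) by (auto intro!: fr_unfold)
    moreover have "s 0 = t 0" using st eq by simp
    ultimately show ?thesis
      using IH by (cases sg) (auto intro!: divide_left_mono mult_pos_pos add_nonneg_pos)
  qed
qed auto

lemma cf_bound_upto_eq: "cf_bound_upto n e f ds = cf_bound e f (take n ds)"
  by (induction n e f ds rule: cf_bound_upto.induct) auto

text \<open>All that the soundness of the finite computations needs to know about \<open>lo\<close>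
  and \<open>hi\<close>: both are positive, and they enclose every tail over the alphabet.\<close>

locale digit_bounds =
  fixes A :: nat and lo hi :: "int \<times> int"
  assumes lo_pos: "pos_pair lo" and hi_pos: "pos_pair hi"
    and lo_le: "\<And>s. (\<And>k. s k \<in> {1..A}) \<Longrightarrow> rv lo \<le> fr s"
    and le_hi: "\<And>s. (\<And>k. s k \<in> {1..A}) \<Longrightarrow> fr s \<le> rv hi"
begin

definition bounded :: "biseq \<Rightarrow> bool" where
  "bounded c \<longleftrightarrow> (\<forall>i. c i \<in> {1..A})"

lemma bounded_positive: "bounded c \<Longrightarrow> positive_biseq c"
  by (simp add: bounded_def positive_biseq_def Suc_le_eq)

text \<open>Upper and lower bound are proved together, because prepending a digit turns each into
  the other.\<close>

lemma cf_bound_sound: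
  assumes "reads ds s" "\<And>k. s k \<in> {1..A}"
  shows "pos_pair (cf_bound hi lo ds) \<and> pos_pair (cf_bound lo hi ds)
    \<and> fr s \<le> rv (cf_bound hi lo ds) \<and> rv (cf_bound lo hi ds) \<le> fr s"
  using assms
proof (induction ds arbitrary: s)
  case Nil
  then show ?case using lo_pos hi_pos lo_le le_hi by simp
next
  case (Cons d ds)
  let ?s = "\<lambda>k. s (Suc k)"
  have IH: "pos_pair (cf_bound hi lo ds)" "pos_pair (cf_bound lo hi ds)"
    "fr ?s \<le> rv (cf_bound hi lo ds)" "rv (cf_bound lo hi ds) \<le> fr ?s"
    using Cons.IH[of ?s] Cons.prems by auto
  have pos: "0 < s k" for k using Cons.prems(2)[of k] by simp
  have d: "int (s 0) = d" "1 \<le> d" using Cons.prems(1) pos[of 0] by auto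
  have fs: "fr s = 1 / (real_of_int d + fr ?s)"
    using fr_unfold[of s] pos d(1) by auto
  have "0 < fr ?s" using pos by (intro fr_bounds)
  then show ?case
    using IH d rv_pos[OF IH(1)] rv_pos[OF IH(2)]
    by (auto simp: mobius_pos rv_mobius fs intro!: divide_left_mono mult_pos_pos add_nonneg_pos)
qed

lemma lam_le:
  assumes c: "bounded c" and sum: "sum_le (cf_bound hi lo l) (cf_bound hi lo r) d th" and th: "0 < snd th"
    and l: "reads l (\<lambda>k. c (j - 1 - int k))" and r: "reads r (\<lambda>k. c (j + 1 + int k))"
    and d: "int (c j) = d"
  shows "lam j c \<le> rv th"
proof -
  have "fr_left c j \<le> rv (cf_bound hi lo l)" "fr_right c j \<le> rv (cf_bound hi lo r)"
    "pos_pair (cf_bound hi lo l)" "pos_pair (cf_bound hi lo r)"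
    using cf_bound_sound[OF l] cf_bound_sound[OF r] c
    by (auto simp: bounded_def fr_left_def fr_right_def)
  then show ?thesis
    using sum th d sum_le_iff lam_eq[OF bounded_positive[OF c], of j] by fastforce
qed

lemma lam_ge:
  assumes c: "bounded c" and sum: "sum_ge (cf_bound lo hi l) (cf_bound lo hi r) d th" and th: "0 < snd th"
    and l: "reads l (\<lambda>k. c (j - 1 - int k))" and r: "reads r (\<lambda>k. c (j + 1 + int k))"
    and d: "int (c j) = d"
  shows "rv th \<le> lam j c"
proof -
  have "rv (cf_bound lo hi l) \<le> fr_left c j" "rv (cf_bound lo hi r) \<le> fr_right c j"
    "pos_pair (cf_bound lo hi l)" "pos_pair (cf_bound lo hi r)"
    using cf_bound_sound[OF l] cf_bound_sound[OF r] c
    by (auto simp: bounded_def fr_left_def fr_right_def)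
  then show ?thesis
    using sum th d sum_ge_iff lam_eq[OF bounded_positive[OF c], of j] by fastforce
qed

lemma safe_at_sound:
  assumes "bounded c" "safe_at R lo hi th r x w" "0 < snd th"
    and r: "reads r (\<lambda>k. c (j - 1 - int k))" and w: "reads (x # w) (\<lambda>k. c (j + int k))"
  shows "lam j c \<le> rv th"
proof -
  have take: "reads (take n r) (\<lambda>k. c (j - 1 - int k))" "reads (take n w) (\<lambda>k. c (j + 1 + int k))" for n
    using r w by (auto simp: reads_nth algebra_simps)
  have x: "int (c j) = x" using w by simp
  obtain m n where "R = (m, n)" by fastforce
  then show ?thesis
    using assms(2) lam_le[OF assms(1) _ assms(3) take x, of m m] lam_le[OF assms(1) _ assms(3) take x, of n n]
    by (auto simp: cf_bound_upto_eq)
qed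

lemma safe_num_sound:
  assumes "bounded c" "0 < snd th" "safe_num R lo hi th r n w"
    and "reads r (\<lambda>k. c (j - 1 - int k))" "reads w (\<lambda>k. c (j + int k))" "i < n"
  shows "lam (j + int i) c \<le> rv th"
  using assms(3-)
proof (induction n arbitrary: r w j i)
  case (Suc n)
  then obtain x w' where w: "w = x # w'" by (cases w) auto
  show ?case
  proof (cases i)
    case 0
    have "lam j c \<le> rv th"
      by (rule safe_at_sound[where R = R and r = r and x = x and w = w'])
         (use assms Suc.prems in \<open>auto simp: w\<close>)
    then show ?thesis by (simp add: 0)
  next
    case (Suc m)
    have "lam (j + 1 + int m) c \<le> rv th"
      by (rule Suc.IH[of "x # r" w'])
         (use Suc.prems \<open>i = Suc m\<close> in \<open>auto simp: w algebra_simps\<close>)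
    then show ?thesis by (simp add: Suc algebra_simps)
  qed
qed simp

lemma safe_tail_sound:
  assumes "bounded c" "bounded c'" "0 < snd th" "safe_tail R lo hi th r e n w"
    and "reads r (\<lambda>k. c (j - 1 - int k))" "reads w (\<lambda>k. c (j + int k))"
    and "reads e (\<lambda>k. c' (j - 1 - int k))" "\<And>k. 0 \<le> k \<Longrightarrow> c' (j + k) = c (j + k)" "i < n"
  shows "lam (j + int i) c \<le> max (rv th) (lam (j + int i) c')"
  using assms(4-)
proof (induction n arbitrary: r e w j i)
  case (Suc n)
  then obtain x w' where w: "w = x # w'" by (cases w) auto
  show ?case
  proof (cases i)
    case 0
    show ?thesis
    proof (cases "below True r e")
      case True
      have "fr_left c j \<le> fr_left c' j"
        unfolding fr_left_def
        using below_sound[OF True Suc.prems(2,4)] bounded_positive assms(1,2)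
        by (auto simp: positive_biseq_def)
      moreover have "fr_right c j = fr_right c' j"
        unfolding fr_right_def using Suc.prems(5)[of "1 + int n" for n] by (simp add: algebra_simps)
      moreover have "c j = c' j" using Suc.prems(5)[of 0] by simp
      ultimately show ?thesis
        using lam_eq bounded_positive assms(1,2) by (simp add: 0 le_max_iff_disj)
    next
      case False
      have "lam j c \<le> rv th"
        by (rule safe_at_sound[where R = R and r = r and x = x and w = w'])
           (use assms Suc.prems False in \<open>auto simp: w\<close>)
      then show ?thesis by (simp add: 0 le_max_iff_disj)
    qed
  next
    case (Suc m)
    have "lam (j + 1 + int m) c \<le> max (rv th) (lam (j + 1 + int m) c')"
    proof (rule Suc.IH[of "x # r" "x # e" w'])
      show "reads (x # e) (\<lambda>k. c' (j + 1 - 1 - int k))"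
        using Suc.prems(3,4) Suc.prems(5)[of 0] by (simp add: w algebra_simps)
      show "c' (j + 1 + k) = c (j + 1 + k)" if "0 \<le> k" for k
        using Suc.prems(5)[of "1 + k"] that by (simp add: algebra_simps)
    qed (use Suc.prems \<open>i = Suc m\<close> in \<open>auto simp: w algebra_simps\<close>)
    then show ?thesis by (simp add: Suc algebra_simps)
  qed
qed simp

text \<open>The level is assumed at every position, not only inside the word: for an
  \<open>Ext\<close> word the offending value may lie to the right of it.\<close>

definition forbidden :: "real \<Rightarrow> int list \<Rightarrow> bool" where
  "forbidden y f \<longleftrightarrow>
     (\<forall>c j. bounded c \<longrightarrow> (\<forall>i. lam i c < y) \<longrightarrow> \<not> reads f (\<lambda>k. c (j - int k)))"

lemma forb_ok_sound:
  assumes "forb_ok lo hi ds y F e" "0 < snd y" "set ds = {1..int A}" "\<And>f. f \<in> set F \<Longrightarrow> forbidden (rv y) f"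
  shows "forbidden (rv y) (forb_word e)"
  unfolding forbidden_def
proof (intro allI impI notI)
  fix c j
  assume c: "bounded c" "\<forall>i. lam i c < rv y" "reads (forb_word e) (\<lambda>k. c (j - int k))"
  show False
  proof (cases e)
    case (Centre l d r)
    \<comment> \<open>The word is read leftwards from its last digit at \<open>j\<close>, so its
      centre stands \<open>length r\<close> places earlier.\<close>
    let ?j = "j - int (length r)"
    have "reads (rev r) (\<lambda>k. c (j - int k))" "reads (d # l) (\<lambda>k. c (?j - int k))"
      using c(3) by (simp_all add: Centre reads_append algebra_simps)
    then have dl: "int (c ?j) = d" "reads l (\<lambda>k. c (?j - 1 - int k))"
      and rr: "\<And>k. k < length r \<Longrightarrow> int (c (j - int k)) = rev r ! k"
      by (auto simp: reads_nth algebra_simps)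
    have "reads r (\<lambda>k. c (?j + 1 + int k))"
      unfolding reads_nth
    proof (intro allI impI)
      fix k assume k: "k < length r"
      have "int (c (j - int (length r - 1 - k))) = rev r ! (length r - 1 - k)"
        using k by (intro rr) auto
      moreover have "j - int (length r - 1 - k) = ?j + 1 + int k" using k by auto
      moreover have "rev r ! (length r - 1 - k) = r ! k" using k by (simp add: rev_nth)
      ultimately show "int (c (?j + 1 + int k)) = r ! k" by metis
    qed
    then have "rv y \<le> lam ?j c"
      using lam_ge[OF c(1) _ assms(2) dl(2) _ dl(1)] assms(1) by (simp add: Centre)
    then show False using c(2) by (auto simp: not_less[symmetric])
  next
    case (Ext w)
    have "int (c (j + 1)) \<in> set ds" using c(1) assms(3) by (auto simp: bounded_def)
    then obtain f where f: "f \<in> set F" "is_pref f (int (c (j + 1)) # w)"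
      using assms(1) by (auto simp: Ext hit_all_iff hit_iff)
    have "reads (int (c (j + 1)) # w) (\<lambda>k. c (j + 1 - int k))"
      using c(3) by (simp add: Ext algebra_simps)
    then have "reads f (\<lambda>k. c (j + 1 - int k))" by (rule is_pref_reads[OF f(2)])
    then show False
      using assms(4)[OF f(1)] c(1,2) unfolding forbidden_def by blast
  qed
qed

lemma forbs_ok_sound:
  assumes "forbs_ok lo hi ds y F es" "0 < snd y" "set ds = {1..int A}" "\<And>f. f \<in> set F \<Longrightarrow> forbidden (rv y) f"
    and "e \<in> set es"
  shows "forbidden (rv y) (forb_word e)"
  using assms(1,4,5)
proof (induction es arbitrary: F)
  case (Cons e' es)
  have e': "forbidden (rv y) (forb_word e')"
    by (rule forb_ok_sound[OF _ assms(2,3)]) (use Cons.prems in auto)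
  show ?case
  proof (cases "e = e'")
    case False
    show ?thesis
      by (rule Cons.IH[of "forb_word e' # F"]) (use Cons.prems e' False in auto)
  qed (use e' in simp)
qed simp

end

section \<open>Eventually periodic sequences\<close>

definition wseq :: "int list \<Rightarrow> int list \<Rightarrow> nat \<Rightarrow> nat" where
  "wseq t p k = nat (if k < length t then t ! k else p ! ((k - length t) mod length p))"

lemma wseq_Cons: "wseq (x # t) p 0 = nat x" "wseq (x # t) p (Suc k) = wseq t p k"
  by (auto simp: wseq_def)

text \<open>Mirrors the last clause of \<open>unroll\<close>, which reopens an exhausted pre-period
  with a fresh copy of the period.\<close>

lemma wseq_Nil: "wseq [] p = wseq p p"
proof
  fix k
  show "wseq [] p k = wseq p p k"
    using le_mod_geq[of "length p" k] by (cases "k < length p") (auto simp: wseq_def)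
qed

lemma wseq_periodic: "length t \<le> k \<Longrightarrow> wseq t p (k + length p) = wseq t p k"
proof -
  assume "length t \<le> k"
  then have "k + length p - length t = (k - length t) + length p" by simp
  then have "(k + length p - length t) mod length p = (k - length t) mod length p"
    by (metis mod_add_self2)
  then show ?thesis using \<open>length t \<le> k\<close> by (simp add: wseq_def)
qed

lemma wseq_tail: "wseq t p (length t + k) = wseq [] p k"
  by (simp add: wseq_def)

lemma length_unroll: "p \<noteq> [] \<Longrightarrow> length (unroll n t p) = n"
  by (induction n t p rule: unroll.induct) auto

lemma reads_unroll:
  assumes "\<And>d. d \<in> set t \<union> set p \<Longrightarrow> 0 \<le> d"
  shows "reads (unroll n t p) (wseq t p)"
  using assms
proof (induction n t p rule: unroll.induct)
  case (2 n x t p)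
  then show ?case by (auto simp: wseq_Cons)
next
  case (4 n x p)
  have "wseq [] (x # p) = wseq (x # p) (x # p)" by (rule wseq_Nil)
  then show ?case using 4 by (auto simp: wseq_Cons)
qed auto

lemma digits_ok_iff: "digits_ok A ds \<longleftrightarrow> (\<forall>d\<in>set ds. 1 \<le> d \<and> d \<le> A)"
  by (induction ds) auto

lemma periods_ok_iff:
  "periods_ok A ps \<longleftrightarrow> (\<forall>p\<in>set ps. p \<noteq> [] \<and> even (length p) \<and> digits_ok A p)"
  by (induction ps) auto

lemma mem_list_iff: "mem_list ps p \<longleftrightarrow> p \<in> set ps"
  by (induction ps) auto

lemma short_words_iff: "short_words K F \<longleftrightarrow> (\<forall>f\<in>set F. length f \<le> K)"
  by (induction F) auto

lemma wseq_digit: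
  assumes "digits_ok (int A) t" "digits_ok (int A) p" "p \<noteq> []"
  shows "wseq t p k \<in> {1..A}"
proof -
  define e where "e = (if k < length t then t ! k else p ! ((k - length t) mod length p))"
  have "e \<in> set t \<union> set p" using assms(3) by (auto simp: e_def)
  then have "1 \<le> e" "e \<le> int A" using assms(1,2) by (auto simp: digits_ok_iff)
  then show ?thesis unfolding wseq_def e_def[symmetric] by auto
qed

text \<open>Deviations beyond the inspected range reduce to inspected ones by shifting back one period,
  which has even length and hence preserves the parity of the position.\<close>

lemma deviation_hit:
  assumes w: "unroll (length t + length p + K) t p = c # w"
    and dev: "dev_ok ds F sg (c # u) w"
    and p: "p \<noteq> []" "even (length p)" and pos: "\<And>d. d \<in> set t \<union> set p \<Longrightarrow> 0 \<le> d"
    and F: "\<And>f. f \<in> set F \<Longrightarrow> length f \<le> K" and K: "0 < K"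
    and "1 \<le> n" "d \<in> set ds" "wrong (sg = odd n) d (int (wseq t p n))"
  shows "hit F (d # rev (map (\<lambda>i. int (wseq t p i)) [0..<n]) @ u)"
  using assms(8-)
proof (induction n rule: less_induct)
  case (less n)
  let ?M = "length t + length p + K"
  let ?W = "\<lambda>n. map (\<lambda>i. int (wseq t p i)) [0..<n]"
  have len: "length (c # w) = ?M" using length_unroll[OF p(1)] w by metis
  have nth: "(c # w) ! k = int (wseq t p k)" if "k < ?M" for k
    using reads_unroll[of t p ?M] pos that len by (simp add: w reads_nth del: reads.simps)
  show ?case
  proof (cases "n < ?M")
    case True
    then obtain m where m: "n = Suc m" using less.prems(1) by (cases n) auto
    have "w ! m = int (wseq t p n)" using nth[of n] True m by simp
    moreover have "(sg = odd n) = (sg = even m)" by (simp add: m)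
    moreover have "m < length w" using True len m by simp
    ultimately have "hit F (d # rev (take m w) @ (c # u))"
      using less.prems(2,3) by (intro dev_ok_nth[OF dev]) auto
    moreover have "?W n = c # take m w"
    proof (rule nth_equalityI)
      show "length (?W n) = length (c # take m w)" using True len m by simp
      fix i assume "i < length (?W n)"
      then show "?W n ! i = (c # take m w) ! i"
        using nth[of i] True len m K by (cases i) (auto simp del: upt_Suc)
    qed
    ultimately show ?thesis by simp
  next
    case False
    define n' where "n' = n - length p"
    have n': "n' < n" "length t + K \<le> n'" "n = n' + length p" "1 \<le> n'"
      using False p(1) K by (auto simp: n'_def)
    have per: "wseq t p (k + length p) = wseq t p k" if "length t \<le> k" for k
      using that by (rule wseq_periodic)
    have "wseq t p n = wseq t p n'" using per[of n'] n' by simp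
    moreover have "odd n = odd n'" using n'(3) p(2) by simp
    ultimately have "hit F (d # rev (?W n') @ u)"
      using less.prems n' by (intro less.IH) auto
    then obtain f where f: "f \<in> set F" "is_pref f (d # rev (?W n') @ u)" by (auto simp: hit_iff)
    \<comment> \<open>Since \<open>n'\<close> is at least \<open>length t + K\<close>, the digits
      within distance \<open>K\<close> before \<open>n\<close> and before \<open>n'\<close> all lie
      in the periodic part and coincide. No forbidden word is long enough to see a
      difference.\<close>
    have "take K (d # rev (?W n) @ u) = take K (d # rev (?W n') @ u)"
    proof (rule nth_equalityI)
      show "length (take K (d # rev (?W n) @ u)) = length (take K (d # rev (?W n') @ u))"
        using n' by simp
      fix i assume "i < length (take K (d # rev (?W n) @ u))"
      then have i: "i < K" by simp
      show "take K (d # rev (?W n) @ u) ! i = take K (d # rev (?W n') @ u) ! i"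
      proof (cases i)
        case (Suc j)
        have "wseq t p (n - Suc j) = wseq t p (n' - Suc j)"
          using per[of "n' - Suc j"] n' i Suc by simp
        then show ?thesis using i n' Suc by (simp add: nth_append rev_nth)
      qed (use i in simp)
    qed
    then have "take (length f) (take K (d # rev (?W n) @ u)) = take (length f) (take K (d # rev (?W n') @ u))"
      by simp
    then have "is_pref f (d # rev (?W n) @ u)"
      using f F[OF f(1)] by (simp add: is_pref_iff min_absorb1 del: take_Suc_Cons)
    then show ?thesis using f(1) by (auto simp: hit_iff)
  qed
qed

section \<open>Connecting a past with two continuations to the subshift\<close>

lemma splice_at_Nil: "splice_at a N [] v i = (if i \<le> int N then a i else v (nat (i - int N - 1)))"
  by (simp add: splice_at_def)

lemma splice_at_right: "splice_at a N [] v (int N + 1 + int k) = v k"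
  by (simp add: splice_at_Nil)

lemma fr_left_splice:
  "j \<le> int N + 1 \<Longrightarrow> fr_left (splice_at a N [] v) j = fr_left a j"
  by (simp add: fr_left_def splice_at_Nil)

lemma fr_right_splice: "fr_right (splice_at a N [] v) (int N) = fr v"
  by (simp add: fr_right_def splice_at_right)

text \<open>Lying between two values, unlike an inequality, survives an antitone map. Stated with
  \<open>min\<close> and \<open>max\<close>, the descent from position \<open>N\<close> to the left
  needs no parity bookkeeping.\<close>

lemma reciprocal_between:
  fixes d x y z :: real
  assumes "0 \<le> d" "0 < x" "0 < y" "0 < z" "min x y \<le> z" "z \<le> max x y"
  shows "min (1 / (d + x)) (1 / (d + y)) \<le> 1 / (d + z)" "1 / (d + z) \<le> max (1 / (d + x)) (1 / (d + y))"
proof -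
  have "1 / (d + max x y) \<le> 1 / (d + z)" "1 / (d + z) \<le> 1 / (d + min x y)"
    using assms by (auto intro!: divide_left_mono mult_pos_pos add_nonneg_pos simp: min_def)
  then show "min (1 / (d + x)) (1 / (d + y)) \<le> 1 / (d + z)"
    "1 / (d + z) \<le> max (1 / (d + x)) (1 / (d + y))"
    by (auto simp: min_def max_def split: if_splits)
qed

text \<open>For \<open>j\<close> up to \<open>N\<close> the digit and the left tail belong to the
  common past, so \<open>lam j\<close> depends on the continuation through the right tail only, and
  that tail stays between the two given ones.\<close>

lemma lam_splice_le_max:
  assumes pos: "positive_biseq (splice_at a N [] v)" "positive_biseq (splice_at a N [] v1)"
      "positive_biseq (splice_at a N [] v2)"
    and fr: "min (fr v1) (fr v2) \<le> fr v" "fr v \<le> max (fr v1) (fr v2)"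
    and j: "j \<le> int N"
  shows "lam j (splice_at a N [] v) \<le> max (lam j (splice_at a N [] v1)) (lam j (splice_at a N [] v2))"
proof -
  let ?c = "\<lambda>v. splice_at a N [] v"
  have between: "min (fr_right (?c v1) (int N - int m)) (fr_right (?c v2) (int N - int m)) \<le> fr_right (?c v) (int N - int m)
      \<and> fr_right (?c v) (int N - int m) \<le> max (fr_right (?c v1) (int N - int m)) (fr_right (?c v2) (int N - int m))" for m
  proof (induction m)
    case 0
    then show ?case using fr by (simp add: fr_right_splice)
  next
    case (Suc m)
    let ?j = "int N - int (Suc m)"
    have j1: "?j + 1 = int N - int m" by simp
    have eq: "fr_right (?c v') ?j = 1 / (real (a (?j + 1)) + fr_right (?c v') (int N - int m))"
      if "positive_biseq (?c v')" for v'
      using fr_right_unfold[OF that, of ?j] unfolding j1 by (simp add: splice_at_Nil)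
    show ?case
      unfolding eq[OF pos(1)] eq[OF pos(2)] eq[OF pos(3)]
      using Suc fr_right_bounds(1) pos by (intro conjI reciprocal_between) auto
  qed
  have "j = int N - int (nat (int N - j))" using j by simp
  then have "fr_right (?c v) j \<le> max (fr_right (?c v1) j) (fr_right (?c v2) j)"
    using between[of "nat (int N - j)"] by metis
  moreover have "lam j (?c v') = real (a j) + fr_right (?c v') j + fr_left a j"
    if "positive_biseq (?c v')" for v'
    using lam_eq[OF that, of j] j by (simp add: fr_left_splice splice_at_Nil)
  ultimately show ?thesis using pos by auto
qed

lemma lam_shift: "lam j (\<lambda>i. a (i - k)) = lam (j - k) a"
proof -
  have "(\<lambda>n. a (j + int n - k)) = (\<lambda>n. a (j - k + int n))"
    "(\<lambda>n. if n = 0 then 0 else a (j - int n - k)) = (\<lambda>n. if n = 0 then 0 else a (j - k - int n))"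
    by (auto simp: algebra_simps)
  then show ?thesis by (simp add: lam_def)
qed

text \<open>Prepending digits contracts the difference of the left tails, and reverses its sign each time.\<close>

lemma fr_left_contract:
  assumes pos: "positive_biseq c" "positive_biseq c'"
    and eq: "\<And>k. 0 \<le> k \<Longrightarrow> c (q + k) = c' (q + k)" and "even m"
    and per: "fr_left c' (q + int m) = fr_left c' q"
  shows "fr_left c (q + int m) \<le> max (fr_left c q) (fr_left c' (q + int m))"
proof -
  define D where "D = (\<lambda>k. fr_left c (q + int k) - fr_left c' (q + int k))"
  have step: "(0 \<le> D k \<longrightarrow> - D k \<le> D (Suc k) \<and> D (Suc k) \<le> 0)
    \<and> (D k \<le> 0 \<longrightarrow> 0 \<le> D (Suc k) \<and> D (Suc k) \<le> - D k)" for k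
  proof -
    let ?d = "real (c (q + int k))" and ?x = "fr_left c (q + int k)" and ?y = "fr_left c' (q + int k)"
    have d: "1 \<le> ?d" using pos(1) by (simp add: positive_biseq_def Suc_le_eq)
    have x: "0 < ?x" "0 < ?y" using pos by (auto intro!: fr_left_bounds)
    have "fr_left c (q + int (Suc k)) = 1 / (?d + ?x)" "fr_left c' (q + int (Suc k)) = 1 / (?d + ?y)"
      using fr_left_unfold[OF pos(1), of "q + int (Suc k)"] fr_left_unfold[OF pos(2), of "q + int (Suc k)"]
        eq[of "int k"] by (simp_all add: algebra_simps)
    then have D: "D (Suc k) = (?y - ?x) / ((?d + ?x) * (?d + ?y))"
      using d x by (simp add: D_def diff_frac_eq)
    have ge: "1 \<le> (?d + ?x) * (?d + ?y)"
      using mult_mono[of 1 "?d + ?x" 1 "?d + ?y"] d x by simp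
    have Dk: "D k = ?x - ?y" by (simp add: D_def)
    have "\<bar>D (Suc k)\<bar> = \<bar>D k\<bar> / ((?d + ?x) * (?d + ?y))"
      unfolding D Dk using ge by (simp add: abs_divide abs_minus_commute)
    also have "\<dots> \<le> \<bar>D k\<bar> / 1"
      using ge by (intro divide_left_mono) auto
    finally have "\<bar>D (Suc k)\<bar> \<le> \<bar>D k\<bar>" by simp
    moreover have "0 \<le> D k \<longrightarrow> D (Suc k) \<le> 0" "D k \<le> 0 \<longrightarrow> 0 \<le> D (Suc k)"
      unfolding D Dk using ge by (auto simp: divide_le_0_iff zero_le_divide_iff)
    ultimately show ?thesis by auto
  qed
  have main: "(0 \<le> D 0 \<longrightarrow> 0 \<le> D (2 * k) \<and> D (2 * k) \<le> D 0) \<and> (D 0 \<le> 0 \<longrightarrow> D (2 * k) \<le> 0)" for k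
  proof (induction k)
    case (Suc k)
    then show ?case using step[of "2 * k"] step[of "Suc (2 * k)"] by auto
  qed simp
  obtain k where "m = 2 * k" using \<open>even m\<close> by blast
  \<comment> \<open>By periodicity \<open>D 0\<close> and \<open>D m\<close> subtract the same
    number. A nonnegative difference has shrunk, which gives the bound by
    \<open>fr_left c q\<close>; a nonpositive one stays nonpositive, which gives the bound by the
    orbit.\<close>
  then show ?thesis
    using main[of k] per by (cases "0 \<le> D 0") (auto simp: D_def)
qed

lemma periodic_nth:
  fixes p :: "int list"
  defines "c \<equiv> \<lambda>i. nat (p ! nat (i mod int (length p)))"
  shows "c (i + int (length p)) = c i" "c (int k) = wseq [] p k"
  by (simp_all add: c_def wseq_def nat_mod_distrib)

lemma periodic_nth_left:
  fixes p :: "int list"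
  assumes "p \<noteq> []"
  shows "nat (p ! nat ((- 1 - int k) mod int (length p))) = wseq [] (rev p) k"
proof -
  let ?m = "length p"
  have m: "0 < ?m" using assms by simp
  have "(- 1 - int k) mod int ?m = (int ?m - 1 - int (k mod ?m)) mod int ?m"
  proof -
    have "int k = int ?m * int (k div ?m) + int (k mod ?m)"
      by (metis mult_div_mod_eq of_nat_add of_nat_mult)
    then have "- 1 - int k = (int ?m - 1 - int (k mod ?m)) + int ?m * (- 1 - int (k div ?m))"
      by (simp add: algebra_simps)
    then show ?thesis by (metis mod_mult_self2)
  qed
  also have "\<dots> = int ?m - 1 - int (k mod ?m)"
    using m mod_less_divisor[OF m, of k] by (intro mod_pos_pos_trivial) auto
  finally have "nat ((- 1 - int k) mod int ?m) = ?m - Suc (k mod ?m)" by simp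
  then show ?thesis
    using m mod_less_divisor[OF m, of k] by (simp add: wseq_def rev_nth)
qed

lemma periodic_digit:
  assumes "digits_ok (int B) p" "p \<noteq> []"
  shows "nat (p ! nat (i mod int (length p))) \<in> {1..B}"
proof -
  have "p ! nat (i mod int (length p)) \<in> set p"
    using assms(2) by (intro nth_mem) (simp add: nat_less_iff)
  then show ?thesis using assms(1) by (auto simp: digits_ok_iff)
qed

context digit_bounds
begin

text \<open>A first deviation of \<open>v\<close> to the wrong side would complete a forbidden word
  in the very splice that \<open>v\<close> defines, contradicting that all values of this splice are
  below \<open>y\<close>. The sign \<open>sg\<close> selects whether the reference word is minimal
  or maximal.\<close>

lemma fr_le_by_deviations:
  assumes w: "unroll (length t + length p + K) t p = ch # w"
    and dev: "dev_ok ds F sg (ch # u) w"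
    and p: "p \<noteq> []" "even (length p)" "digits_ok (int A) t" "digits_ok (int A) p"
    and F: "\<And>f. f \<in> set F \<Longrightarrow> length f \<le> K \<and> forbidden y f" and K: "0 < K"
    and ds: "set ds = {1..int A}"
    and c: "bounded (splice_at a N [] v)" "\<And>i. lam i (splice_at a N [] v) < y"
    and u: "reads u (\<lambda>k. a (int N - int k))" and v0: "int (v 0) = ch"
  shows "if sg then fr (wseq t p) \<le> fr v else fr v \<le> fr (wseq t p)"
proof -
  let ?c = "splice_at a N [] v" and ?s = "wseq t p"
  have pos: "\<And>d. d \<in> set t \<union> set p \<Longrightarrow> 0 \<le> d"
    using p(3,4) by (force simp: digits_ok_iff)
  have vd: "v k \<in> {1..A}" for k
    using c(1) splice_at_right[of a N v k] unfolding bounded_def by metis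
  have sd: "?s k \<in> {1..A}" for k using wseq_digit p by blast
  have "?s 0 = v 0"
    using reads_unroll[of t p "length t + length p + K"] pos v0 by (simp add: w)
  have no: "\<not> wrong (sg = odd n) (int (v n)) (int (?s n))" if eq: "\<And>k. k < n \<Longrightarrow> v k = ?s k" for n
  proof
    assume wr: "wrong (sg = odd n) (int (v n)) (int (?s n))"
    have n: "1 \<le> n"
    proof (rule ccontr)
      assume "\<not> 1 \<le> n"
      then have "n = 0" by simp
      then show False using wr \<open>?s 0 = v 0\<close> by (cases sg) auto
    qed
    have "int (v n) \<in> set ds" using vd[of n] ds by auto
    then have "hit F (int (v n) # rev (map (\<lambda>i. int (?s i)) [0..<n]) @ u)"
      using F wr n K by (intro deviation_hit[OF w dev p(1,2) pos]) auto
    then obtain f where f: "f \<in> set F" "is_pref f (int (v n) # rev (map (\<lambda>i. int (?s i)) [0..<n]) @ u)"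
      by (auto simp: hit_iff)
    \<comment> \<open>Leftwards from position N + 1 + n one meets the deviating digit, the
      \<open>n\<close> digits shared with the reference word, and then the past.\<close>
    have "reads (int (v n) # rev (map (\<lambda>i. int (?s i)) [0..<n]) @ u) (\<lambda>k. ?c (int N + 1 + int n - int k))"
    proof -
      have "reads (rev (map (\<lambda>i. int (?s i)) [0..<n])) (\<lambda>k. ?c (int N + 1 + int n - int (Suc k)))"
        unfolding reads_nth
      proof (intro allI impI)
        fix k assume k: "k < length (rev (map (\<lambda>i. int (?s i)) [0..<n]))"
        then have "int N + 1 + int n - int (Suc k) = int N + 1 + int (n - Suc k)" by simp
        then have "?c (int N + 1 + int n - int (Suc k)) = v (n - Suc k)"
          using splice_at_right by metis
        then show "int (?c (int N + 1 + int n - int (Suc k))) = rev (map (\<lambda>i. int (?s i)) [0..<n]) ! k"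
          using k eq[of "n - Suc k"] by (simp add: rev_nth)
      qed
      moreover have "reads u (\<lambda>k. ?c (int N + 1 + int n - int (Suc (k + n))))"
        by (rule reads_cong[OF u]) (simp add: splice_at_Nil)
      ultimately show ?thesis
        using splice_at_right[of a N v n] by (simp add: reads_append)
    qed
    then have "reads f (\<lambda>k. ?c (int N + 1 + int n - int k))" by (rule is_pref_reads[OF f(2)])
    then show False using F[OF f(1)] c unfolding forbidden_def by blast
  qed
  show ?thesis
  proof (cases sg)
    case True
    have "fr ?s \<le> fr v"
    proof (rule fr_le_if_no_wrong_deviation)
      show "\<not> (if even n then ?s n < v n else v n < ?s n)" if "\<And>k. k < n \<Longrightarrow> ?s k = v k" for n
        using no[of n] that True by (cases "even n") auto
    qed (use vd sd in \<open>auto simp: Suc_le_eq\<close>)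
    then show ?thesis using True by simp
  next
    case False
    have "fr v \<le> fr ?s"
    proof (rule fr_le_if_no_wrong_deviation)
      show "\<not> (if even n then v n < ?s n else ?s n < v n)" if "\<And>k. k < n \<Longrightarrow> v k = ?s k" for n
        using no[of n] that False by (cases "even n") auto
    qed (use vd sd in \<open>auto simp: Suc_le_eq\<close>)
    then show ?thesis using False by simp
  qed
qed

lemma fr_le_by_head:
  assumes "\<And>k. s k \<in> {1..A}" "\<And>k. s' k \<in> {1..A}" "s' 0 < s 0"
  shows "fr s \<le> fr s'"
  using assms fr_mono_first_difference[of s s' 0] by (auto simp: Suc_le_eq)

lemma leaf_between:
  assumes leaf: "leaf_ok R K lo hi th ds F ps b1 b2 u t p" "b1 < b2"
    and ps: "periods_ok (int A) ps"
    and F: "\<And>f. f \<in> set F \<Longrightarrow> length f \<le> K \<and> forbidden y f" and K: "0 < K"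
    and ds: "ds = [1..int A]"
    and c1: "bounded (splice_at a N [] v1)" "\<And>i. lam i (splice_at a N [] v1) < y"
    and c2: "bounded (splice_at a N [] v2)" "\<And>i. lam i (splice_at a N [] v2) < y"
    and u: "reads u (\<lambda>k. a (int N - int k))" and v: "int (v1 0) = b1" "int (v2 0) = b2"
  shows "fr v2 \<le> fr (wseq t p)" "fr (wseq t p) \<le> fr v1"
proof -
  have p: "p \<noteq> []" "even (length p)" "digits_ok (int A) t" "digits_ok (int A) p"
    using leaf(1) ps by (auto simp: mem_list_iff periods_ok_iff ds)
  have pos: "\<And>d. d \<in> set t \<union> set p \<Longrightarrow> 0 \<le> d"
    using p(3,4) by (force simp: digits_ok_iff)
  have vd: "v1 k \<in> {1..A}" "v2 k \<in> {1..A}" for k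
    using c1(1) c2(1) splice_at_right[of a N _ k] unfolding bounded_def by metis+
  have sd: "wseq t p k \<in> {1..A}" for k using wseq_digit p by blast
  have dset: "set ds = {1..int A}" by (simp add: ds)
  obtain ch w where w: "unroll (length t + length p + K) t p = ch # w"
    and first: "first_ok ds F b1 b2 u (ch # w)"
    using leaf(1) by (cases "unroll (length t + length p + K) t p") auto
  have ch: "int (wseq t p 0) = ch"
    using reads_unroll[of t p "length t + length p + K"] pos by (simp add: w)
  note dev = fr_le_by_deviations[OF w _ p F K dset _ _ u]
  have "fr v2 \<le> fr (wseq t p) \<and> fr (wseq t p) \<le> fr v1"
  proof -
    consider "ch = b1" "dev_ok ds F True (ch # u) w" | "ch = b2" "dev_ok ds F False (ch # u) w"
      | "b1 < ch" "ch < b2"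
      using first by auto
    then show ?thesis
    proof cases
      case 1
      then show ?thesis
        using dev[where sg = True and v = v1] c1 v ch leaf(2) fr_le_by_head[OF vd(2) sd] by auto
    next
      case 2
      then show ?thesis
        using dev[where sg = False and v = v2] c2 v ch leaf(2) fr_le_by_head[OF sd vd(1)] by auto
    next
      case 3
      then show ?thesis
        using v ch fr_le_by_head[OF vd(2) sd] fr_le_by_head[OF sd vd(1)] by auto
    qed
  qed
  then show "fr v2 \<le> fr (wseq t p)" "fr (wseq t p) \<le> fr v1" by auto
qed

text \<open>The pre-period is covered by \<open>safe_num\<close> and the first period by
  \<open>safe_tail\<close>. Every later period follows by induction from the one before it, because
  the left tail cannot have moved away from that of the orbit; so a single period is
  inspected.\<close>

lemma leaf_safe:
  assumes leaf: "leaf_ok R K lo hi th ds F ps b1 b2 u t p"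
    and ps: "periods_ok (int A) ps" and ds: "ds = [1..int A]" and th: "0 < snd th"
    and a: "\<And>i. i \<le> int N \<Longrightarrow> a i \<in> {1..A}"
    and u: "reads u (\<lambda>k. a (int N - int k))"
    and X: "\<And>i. lam i (\<lambda>i. nat (p ! nat (i mod int (length p)))) \<le> X"
  shows "lam (int N + 1 + int n) (splice_at a N [] (wseq t p)) \<le> max (rv th) X"
proof -
  let ?c = "splice_at a N [] (wseq t p)"
  have p: "p \<noteq> []" "even (length p)" "digits_ok (int A) t" "digits_ok (int A) p"
    using leaf(1) ps by (auto simp: mem_list_iff periods_ok_iff ds)
  have pos: "\<And>d. d \<in> set t \<union> set p \<Longrightarrow> 0 \<le> d"
    using p(3,4) by (force simp: digits_ok_iff)
  have sd: "wseq t p k \<in> {1..A}" for k using wseq_digit p by blast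
  have c: "bounded ?c" using a sd by (simp add: bounded_def splice_at_Nil)
  define J where "J = int N + 1 + int (length t)"
  define c0 where "c0 = (\<lambda>i. nat (p ! nat (i mod int (length p))))"
  \<comment> \<open>The periodic orbit, placed so that it agrees with the new sequence from the
    start \<open>J\<close> of the periodic part on.\<close>
  define c' where "c' = (\<lambda>i. c0 (i - J))"
  have c0d: "c0 i \<in> {1..A}" for i
    unfolding c0_def by (rule periodic_digit[OF p(4,1)])
  have c': "bounded c'" using c0d by (simp add: bounded_def c'_def)
  have per: "c0 (i + int (length p)) = c0 i" for i
    unfolding c0_def by (rule periodic_nth)
  have per': "c' (i + int (length p)) = c' i" for i
    using per[of "i - J"] by (simp add: c'_def algebra_simps)
  have X': "lam i c' \<le> X" for i
    using X[of "i - J"] lam_shift[of i c0 J] by (simp add: c'_def c0_def)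
  have tail: "c' (J + k) = ?c (J + k)" if "0 \<le> k" for k
  proof -
    have "?c (int N + 1 + int (length t + nat k)) = wseq [] p (nat k)"
      by (simp only: splice_at_right wseq_tail)
    moreover have "c0 (int (nat k)) = wseq [] p (nat k)"
      unfolding c0_def by (rule periodic_nth)
    ultimately show ?thesis using that by (simp add: J_def c'_def algebra_simps)
  qed
  have left: "reads (rev t @ u) (\<lambda>k. ?c (J - 1 - int k))"
  proof -
    have "reads (rev t) (\<lambda>k. ?c (J - 1 - int k))"
      unfolding reads_nth
    proof (intro allI impI)
      fix k assume k: "k < length (rev t)"
      then have "J - 1 - int k = int N + 1 + int (length t - Suc k)" by (simp add: J_def)
      then have "?c (J - 1 - int k) = wseq t p (length t - Suc k)"
        using splice_at_right by metis
      moreover have lt: "length t - Suc k < length t" using k by simp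
      moreover from lt have "0 \<le> t ! (length t - Suc k)" by (intro pos) simp
      ultimately show "int (?c (J - 1 - int k)) = rev t ! k"
        using k lt by (simp add: wseq_def rev_nth)
    qed
    moreover have "reads u (\<lambda>k. ?c (J - 1 - int (k + length (rev t))))"
      by (rule reads_cong[OF u]) (simp add: splice_at_Nil J_def)
    ultimately show ?thesis by (simp add: reads_append)
  qed
  have first: "lam (int N + 1 + int i) ?c \<le> rv th" if i: "i < length t" for i
  proof (rule safe_num_sound[OF c th])
    show "safe_num R lo hi th u (length t) (unroll (length t + snd R) t p)" using leaf by simp
    show "reads u (\<lambda>k. ?c (int N + 1 - 1 - int k))"
      by (rule reads_cong[OF u]) (simp add: splice_at_Nil)
    show "reads (unroll (length t + snd R) t p) (\<lambda>k. ?c (int N + 1 + int k))"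
      using reads_unroll[OF pos] by (simp add: splice_at_right)
  qed (rule i)
  have period: "lam (J + int i) ?c \<le> max (rv th) (lam (J + int i) c')" if i: "i < length p" for i
  proof (rule safe_tail_sound[OF c c' th])
    show "safe_tail R lo hi th (rev t @ u) (unroll (length t + length u) [] (rev p)) (length p)
         (unroll (length p + snd R) [] p)"
      using leaf by simp
    show "reads (unroll (length p + snd R) [] p) (\<lambda>k. ?c (J + int k))"
    proof (rule reads_cong[OF reads_unroll])
      show "\<And>d. d \<in> set [] \<union> set p \<Longrightarrow> 0 \<le> d" using pos by auto
      fix k
      show "?c (J + int k) = wseq [] p k"
        using splice_at_right[of a N "wseq t p" "length t + k"] wseq_tail[of t p k]
        by (simp add: J_def algebra_simps)
    qed
    show "reads (unroll (length t + length u) [] (rev p)) (\<lambda>k. c' (J - 1 - int k))"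
    proof (rule reads_cong[OF reads_unroll])
      show "\<And>d. d \<in> set [] \<union> set (rev p) \<Longrightarrow> 0 \<le> d" using pos by auto
      fix k
      show "c' (J - 1 - int k) = wseq [] (rev p) k"
        using periodic_nth_left[OF p(1), of k] by (simp add: c'_def c0_def)
    qed
  qed (use left tail i in auto)
  have all: "lam (J + int i) ?c \<le> max (rv th) X" for i
  proof (induction i rule: less_induct)
    case (less i)
    show ?case
    proof (cases "i < length p")
      case True
      then show ?thesis using period X'[of "J + int i"] by fastforce
    next
      case False
      define i' where "i' = i - length p"
      have i': "i = i' + length p" "i' < i"
        using False p(1) length_greater_0_conv[of p] unfolding i'_def by linarith+
      let ?q = "J + int i'"
      have eq: "?c (?q + k) = c' (?q + k)" if "0 \<le> k" for k
        using tail[of "int i' + k"] that by (simp add: algebra_simps)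
      have perc': "fr_left c' (?q + int (length p)) = fr_left c' ?q"
        unfolding fr_left_def using per'[of "?q - 1 - int n" for n] by (simp add: algebra_simps)
      \<comment> \<open>One period later the digit and the right tail are unchanged, and the left
        tail is at most its former value or at most that of the orbit. Hence so is the whole
        value.\<close>
      have L: "fr_left ?c (?q + int (length p)) \<le> max (fr_left ?c ?q) (fr_left c' (?q + int (length p)))"
        by (rule fr_left_contract[OF bounded_positive[OF c] bounded_positive[OF c'] eq p(2) perc'])
      have R1: "fr_right ?c (?q + int (length p)) = fr_right ?c ?q"
        unfolding fr_right_def
        using eq[of "1 + int n" for n] eq[of "int (length p) + 1 + int n" for n] per'[of "?q + 1 + int n" for n]
        by (simp add: algebra_simps)
      have R2: "fr_right ?c (?q + int (length p)) = fr_right c' (?q + int (length p))"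
        unfolding fr_right_def
        using eq[of "int (length p) + 1 + int n" for n] by (simp add: algebra_simps)
      have d: "?c (?q + int (length p)) = ?c ?q" "?c (?q + int (length p)) = c' (?q + int (length p))"
        using eq[of 0] eq[of "int (length p)"] per'[of ?q] by auto
      have "lam (?q + int (length p)) ?c \<le> max (lam ?q ?c) (lam (?q + int (length p)) c')"
        using L R1 R2 d lam_eq[OF bounded_positive[OF c]] lam_eq[OF bounded_positive[OF c']] by auto
      moreover have "lam ?q ?c \<le> max (rv th) X" using less i' by blast
      ultimately show ?thesis using X'[of "?q + int (length p)"] i'(1) by (simp add: algebra_simps)
    qed
  qed
  show ?thesis
  proof (cases "n < length t")
    case True
    then show ?thesis using first[OF True] by simp
  next
    case False
    then show ?thesis using all[of "n - length t"] by (simp add: J_def of_nat_diff algebra_simps)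
  qed
qed

end

text \<open>Needed because \<open>one_sided\<close> reads a sequence from index 0, while the
  continuation inside a splice starts at N + 1.\<close>

lemma sft_shift:
  assumes "subshift_of_finite_type S" "a \<in> S"
  shows "(\<lambda>i. a (i + k)) \<in> S"
proof -
  obtain A F where S: "S = {a. (\<forall>i. a i \<in> {1..A}) \<and> (\<forall>w\<in>F. \<not> occurs_in w a)}"
    using assms(1) by (auto simp: subshift_of_finite_type_def)
  have "occurs_in w a" if occ: "occurs_in w (\<lambda>i. a (i + k))" for w
  proof -
    obtain i where "occurs_at w (\<lambda>i. a (i + k)) i" using occ by (auto simp: occurs_in_def)
    then have "occurs_at w a (i + k)" by (simp add: occurs_at_def algebra_simps)
    then show ?thesis by (auto simp: occurs_in_def)
  qed
  then show ?thesis using assms(2) unfolding S by blast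
qed

lemma lam_less_of_markov:
  "markov_value c < ereal y \<Longrightarrow> lam i c < y"
  unfolding markov_value_def by (metis UNIV_I SUP_lessD ereal_less_eq(3) less_ereal.simps(1))

lemma markov_le:
  "(\<And>i. ereal (lam i c) \<le> z) \<Longrightarrow> markov_value c \<le> z"
  unfolding markov_value_def by (intro SUP_least)

lemma lam_le_markov: "ereal (lam i c) \<le> markov_value c"
  unfolding markov_value_def by (intro SUP_upper) auto

lemma lo_ok_digit_bounds:
  assumes "lo_ok (int A) lo"
  shows "digit_bounds A lo (hi_of lo)"
proof -
  obtain p q where lo: "lo = (p, q)" by fastforce
  have p: "0 < p" "0 < q" and le: "int A * p * p + int A * p * q \<le> q * q"
    using assms by (auto simp: lo)
  have "real A * of_int p * of_int p + real A * of_int p * of_int q \<le> real_of_int q * of_int q"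
    using le by (metis of_int_add of_int_le_iff of_int_mult of_int_of_nat_eq)
  then have "(real A * of_int p * of_int p + real A * of_int p * of_int q) / (of_int q * of_int q) \<le> 1"
    using p by (simp add: divide_le_eq)
  moreover have "real A * rv lo * rv lo + real A * rv lo
      = (real A * of_int p * of_int p + real A * of_int p * of_int q) / (of_int q * of_int q)"
    using p by (simp add: rv_def lo field_simps)
  ultimately have *: "0 \<le> rv lo" "real A * rv lo * rv lo + real A * rv lo \<le> 1"
    using p by (simp_all add: rv_def lo)
  have hi: "rv (hi_of lo) = 1 / (1 + rv lo)" using p by (simp add: rv_def lo field_simps)
  show ?thesis
  proof
    show "pos_pair lo" "pos_pair (hi_of lo)" using p by (simp_all add: pos_pair_def lo)
    show "rv lo \<le> fr s" "fr s \<le> rv (hi_of lo)" if "\<And>k. s k \<in> {1..A}" for s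
      using fr_digit_bounds[OF *, of s] that hi by auto
  qed
qed

text \<open>A digit \<open>A + 1\<close> would already force the value \<open>A + 1 + 2 / (A + 2)\<close>.\<close>

lemma level_ok_digits:
  assumes level: "level_ok (int A) y" and c: "positive_biseq c" "\<And>i. lam i c < rv y"
  shows "c i \<in> {1..A}"
proof -
  obtain p q where y: "y = (p, q)" by fastforce
  have q: "0 < q" and le: "p * (int A + 2) \<le> ((int A + 1) * (int A + 2) + 2) * q"
    using level by (auto simp: y)
  have "real_of_int (p * (int A + 2)) \<le> real_of_int (((int A + 1) * (int A + 2) + 2) * q)"
    using le by (simp only: of_int_le_iff)
  then have "of_int p * (real A + 2) \<le> ((real A + 1) * (real A + 2) + 2) * of_int q" by simp
  then have "of_int p / of_int q \<le> ((real A + 1) * (real A + 2) + 2) / (real A + 2)"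
    using q by (simp add: divide_simps mult.commute)
  also have "\<dots> = real A + 1 + 2 / (real A + 2)"
    by (simp add: add_divide_distrib)
  finally have yle: "rv y \<le> real A + 1 + 2 / (real A + 2)" by (simp add: rv_def y)
  \<comment> \<open>This crude bound on all digits comes first: it keeps the tails on both sides of
    a digit from being smaller than 1/(A + 2).\<close>
  have small: "c k \<le> A + 1" for k
  proof -
    have "real (c k) < lam k c"
      using lam_eq[OF c(1), of k] fr_left_bounds(1)[OF c(1), of k] fr_right_bounds(1)[OF c(1), of k] by simp
    also have "\<dots> < real A + 1 + 2 / (real A + 2)" using c(2)[of k] yle by simp
    also have "\<dots> \<le> real A + 2"
    proof -
      have "2 / (real A + 2) \<le> 1" by simp
      then show ?thesis by linarith
    qed
    finally have "real (c k) < real (A + 2)" by simp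
    then show ?thesis by linarith
  qed
  have "c i \<noteq> A + 1"
  proof
    assume i: "c i = A + 1"
    have "1 / (real A + 2) \<le> fr_right c i"
    proof -
      have "real (c (i + 1)) + fr_right c (i + 1) \<le> real A + 2"
        using small[of "i + 1"] fr_right_bounds(2)[OF c(1), of "i + 1"] by linarith
      then show ?thesis
        using fr_right_bounds(1)[OF c(1), of "i + 1"]
        by (subst fr_right_unfold[OF c(1)]) (auto intro!: divide_left_mono mult_pos_pos add_nonneg_pos)
    qed
    moreover have "1 / (real A + 2) \<le> fr_left c i"
    proof -
      have "real (c (i - 1)) + fr_left c (i - 1) \<le> real A + 2"
        using small[of "i - 1"] fr_left_bounds(2)[OF c(1), of "i - 1"] by linarith
      then show ?thesis
        using fr_left_bounds(1)[OF c(1), of "i - 1"]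
        by (subst fr_left_unfold[OF c(1)]) (auto intro!: divide_left_mono mult_pos_pos add_nonneg_pos)
    qed
    ultimately have "real A + 1 + 2 / (real A + 2) \<le> lam i c"
      using lam_eq[OF c(1), of i] i by simp
    then show False using c(2)[of i] yle by simp
  qed
  moreover have "0 < c i" using c(1) by (simp add: positive_biseq_def)
  ultimately show ?thesis using small[of i] by auto
qed

context digit_bounds
begin

lemma trees_ok_member:
  assumes "trees_ok R K lo hi th ds F ps b1 b2 u es ts" "d \<in> set es"
  shows "\<exists>t\<in>set ts. tree_ok R K lo hi th ds F ps b1 b2 (u @ [d]) t"
  using assms
proof (induction es arbitrary: ts)
  case (Cons e es)
  then obtain t ts' where "ts = t # ts'" by (cases ts) auto
  then show ?case using Cons by auto
qed simp

text \<open>The tree is descended along the actual digits of the past. The descent cannot end in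
  \<open>Dead\<close>, since then one of the two splices would contain a forbidden word.\<close>

lemma tree_ok_leaf:
  assumes F: "\<And>f. f \<in> set F \<Longrightarrow> forbidden y f" and ds: "ds = [1..int A]"
    and a: "\<And>i. i \<le> int N \<Longrightarrow> a i \<in> {1..A}"
    and c1: "bounded (splice_at a N [] v1)" "\<And>i. lam i (splice_at a N [] v1) < y"
    and c2: "bounded (splice_at a N [] v2)" "\<And>i. lam i (splice_at a N [] v2) < y"
    and v: "int (v1 0) = b1" "int (v2 0) = b2"
    and "tree_ok R K lo hi th ds F ps b1 b2 u t" "reads u (\<lambda>k. a (int N - int k))"
  shows "\<exists>u t p. leaf_ok R K lo hi th ds F ps b1 b2 u t p \<and> reads u (\<lambda>k. a (int N - int k))"
  using assms(10,11)
proof (induction t arbitrary: u)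
  case Dead
  have no_hit: "\<not> hit_any F (int (v 0) # u)"
    if c: "bounded (splice_at a N [] v)" "\<And>i. lam i (splice_at a N [] v) < y" for v
  proof
    let ?r = "int (v 0) # u" and ?c = "splice_at a N [] v"
    assume "hit_any F ?r"
    then obtain k f where k: "k < length ?r" "f \<in> set F" "is_pref f (drop k ?r)"
      by (auto simp: hit_any_iff hit_iff)
    have "reads u (\<lambda>k. ?c (int N + 1 - int (Suc k)))"
      by (rule reads_cong[OF Dead.prems(2)]) (simp add: splice_at_Nil)
    then have "reads ?r (\<lambda>k. ?c (int N + 1 - int k))"
      using splice_at_right[of a N v 0] by simp
    then have "reads (take k ?r @ drop k ?r) (\<lambda>k. ?c (int N + 1 - int k))" by simp
    then have "reads (drop k ?r) (\<lambda>i. ?c (int N + 1 - int (i + length (take k ?r))))"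
      unfolding reads_append by blast
    then have "reads (drop k ?r) (\<lambda>i. ?c ((int N + 1 - int k) - int i))"
      using k(1) by (simp add: algebra_simps min_absorb2)
    then have "reads f (\<lambda>i. ?c ((int N + 1 - int k) - int i))"
      by (rule is_pref_reads[OF k(3)])
    then show False using F[OF k(2)] c unfolding forbidden_def by blast
  qed
  then show ?case using Dead.prems(1) c1 c2 v by auto
next
  case (Leaf t p)
  then show ?case by auto
next
  case (Node ts)
  define d where "d = int (a (int N - int (length u)))"
  have "d \<in> set ds" using a[of "int N - int (length u)"] by (auto simp: d_def ds)
  then obtain t where t: "t \<in> set ts" "tree_ok R K lo hi th ds F ps b1 b2 (u @ [d]) t"
    using trees_ok_member Node.prems(1) by fastforce
  have "reads (u @ [d]) (\<lambda>k. a (int N - int k))"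
    using Node.prems(2) by (simp add: reads_append d_def)
  then show ?case using Node.IH t by blast
qed

lemma row_ok_member:
  assumes "row_ok R K lo hi th ds F ps b1 bs ts" "b2 \<in> set bs"
  shows "\<exists>t. tree_ok R K lo hi th ds F ps b1 b2 [] t"
  using assms
proof (induction bs arbitrary: ts)
  case (Cons e es)
  then obtain t ts' where "ts = t # ts'" by (cases ts) auto
  then show ?case using Cons by auto
qed simp

text \<open>Only pairs \<open>b1 < b2\<close> are tabulated: the row of a digit runs over the digits
  after it in the increasing list, so the last row is empty.\<close>

lemma rows_ok_member:
  assumes "rows_ok R K lo hi th ds F ps bs tss" "sorted_wrt (<) bs" "b1 \<in> set bs" "b2 \<in> set bs" "b1 < b2"
  shows "\<exists>t. tree_ok R K lo hi th ds F ps b1 b2 [] t"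
  using assms
proof (induction bs arbitrary: tss)
  case (Cons e es)
  then obtain ts tss' where tss: "tss = ts # tss'" by (cases tss) auto
  show ?case
  proof (cases "b1 = e")
    case True
    then have "b2 \<in> set es" using Cons.prems(4,5) by auto
    moreover have "row_ok R K lo hi th ds F ps e es ts" using Cons.prems(1) by (simp add: tss)
    ultimately show ?thesis using row_ok_member True by blast
  next
    case False
    then have b1: "b1 \<in> set es" using Cons.prems(3) by simp
    then have "e < b1" using Cons.prems(2) by simp
    then have b2: "b2 \<in> set es" using Cons.prems(4,5) by auto
    have "rows_ok R K lo hi th ds F ps es tss'" "sorted_wrt (<) es"
      using Cons.prems(1,2) by (simp_all add: tss)
    then show ?thesis using Cons.IH b1 b2 Cons.prems(5) by blast
  qed
qed simp

lemma connection:
  assumes ds: "ds = [1..int A]"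
    and F: "\<And>f. f \<in> set F \<Longrightarrow> length f \<le> K \<and> forbidden y f" and K: "0 < K"
    and rows: "rows_ok R K lo hi th ds F ps ds tss" and ps: "periods_ok (int A) ps" and th: "0 < snd th"
    and c1: "bounded (splice_at a N [] v1)" "\<And>i. lam i (splice_at a N [] v1) < y"
    and c2: "bounded (splice_at a N [] v2)" "\<And>i. lam i (splice_at a N [] v2) < y"
    and v: "v1 0 < v2 0"
    and X: "\<And>p i. p \<in> set ps \<Longrightarrow> lam i (\<lambda>i. nat (p ! nat (i mod int (length p)))) \<le> X"
  shows "\<exists>t p. p \<in> set ps \<and> digits_ok (int A) t
    \<and> (\<forall>j. lam j (splice_at a N [] (wseq t p))
          \<le> max (max (lam j (splice_at a N [] v1)) (lam j (splice_at a N [] v2))) (max (rv th) X))"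
proof -
  have a: "a i \<in> {1..A}" if "i \<le> int N" for i
    using c1(1) that by (auto simp: bounded_def splice_at_Nil split: if_splits)
  have vd: "v1 0 \<in> {1..A}" "v2 0 \<in> {1..A}"
    using c1(1) c2(1) splice_at_right[of a N _ 0] unfolding bounded_def by metis+
  have "sorted_wrt (<) ds" by (simp add: ds)
  moreover have "int (v1 0) \<in> set ds" "int (v2 0) \<in> set ds" using vd by (auto simp: ds)
  ultimately obtain t0 where t0: "tree_ok R K lo hi th ds F ps (int (v1 0)) (int (v2 0)) [] t0"
    using rows_ok_member[OF rows, of "int (v1 0)" "int (v2 0)"] v by auto
  have "\<exists>u t p. leaf_ok R K lo hi th ds F ps (int (v1 0)) (int (v2 0)) u t p
      \<and> reads u (\<lambda>k. a (int N - int k))"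
  proof (rule tree_ok_leaf[OF _ ds a c1 c2 refl refl t0])
    show "forbidden y f" if "f \<in> set F" for f using F[OF that] by simp
  qed simp_all
  then obtain u t p where leaf: "leaf_ok R K lo hi th ds F ps (int (v1 0)) (int (v2 0)) u t p"
    and u: "reads u (\<lambda>k. a (int N - int k))"
    by blast
  have p: "p \<in> set ps" "p \<noteq> []" "digits_ok (int A) t" "digits_ok (int A) p"
    using leaf ps by (auto simp: mem_list_iff periods_ok_iff ds)
  have between: "fr v2 \<le> fr (wseq t p)" "fr (wseq t p) \<le> fr v1"
    using leaf_between[OF leaf _ ps F K ds c1 c2 u refl refl] v by auto
  have wd: "wseq t p k \<in> {1..A}" for k using wseq_digit p by blast
  have c: "bounded (splice_at a N [] (wseq t p))"
    using a wd by (simp add: bounded_def splice_at_Nil)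
  have "lam j (splice_at a N [] (wseq t p))
      \<le> max (max (lam j (splice_at a N [] v1)) (lam j (splice_at a N [] v2))) (max (rv th) X)" for j
  proof (cases "j \<le> int N")
    case True
    then have "lam j (splice_at a N [] (wseq t p))
      \<le> max (lam j (splice_at a N [] v1)) (lam j (splice_at a N [] v2))"
      using between bounded_positive c c1 c2 by (intro lam_splice_le_max) auto
    then show ?thesis by auto
  next
    case False
    then have "j = int N + 1 + int (nat (j - int N - 1))" by simp
    then have "lam j (splice_at a N [] (wseq t p)) \<le> max (rv th) X"
      using leaf_safe[OF leaf ps ds th a u X[OF p(1)]] by metis
    then show ?thesis by auto
  qed
  then show ?thesis using p by blast
qed

end

lemma markov_splice_le:
  assumes "\<And>j. lam j c \<le> max (max (lam j c1) (lam j c2)) z"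
  shows "markov_value c \<le> max (max (markov_value c1) (markov_value c2)) (ereal z)"
proof (rule markov_le)
  fix j
  have "ereal (lam j c) \<le> max (max (ereal (lam j c1)) (ereal (lam j c2))) (ereal z)"
    using assms[of j] by (simp add: le_max_iff_disj)
  also have "\<dots> \<le> max (max (markov_value c1) (markov_value c2)) (ereal z)"
    by (intro max.mono lam_le_markov order.refl)
  finally show "ereal (lam j c) \<le> max (max (markov_value c1) (markov_value c2)) (ereal z)" .
qed

text \<open>The pre-period plays the part of \<tau>, and the purely periodic rest that of the
  sequence taken from the smaller subshift.\<close>

lemma splice_at_wseq:
  "splice_at a N (map nat t) (wseq [] p) = splice_at a N [] (wseq t p)"
  by (auto simp: splice_at_def wseq_def fun_eq_iff Let_def)

text \<open>Either the level \<open>\<theta>\<close> is reached inside the subshift \<open>SB\<close>, or every sequence below \<open>\<theta>\<close> already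
  belongs to \<open>SB\<close> and no change of the continuation is needed.\<close>

lemma good_piece_from_connection:
  assumes cert: "connect_ok R K lo (int A) ds y th fs ps tss"
    and SB: "symmetric_transitive_sft SB" "SB \<subseteq> {a. \<forall>i. a i \<in> {1..A}}"
    and x: "ereal x = (SUP b\<in>SB. markov_value b)"
    and ps: "\<And>p. p \<in> set ps \<Longrightarrow> (\<lambda>i. nat (p ! nat (i mod int (length p)))) \<in> SB"
    and th: "rv th \<le> x \<or> (\<forall>c. positive_biseq c \<and> markov_value c < ereal (rv th) \<longrightarrow> c \<in> SB)"
  shows "good_piece x (rv y)"
proof -
  let ?hi = "hi_of lo" and ?F = "map forb_word fs"
  have lo: "lo_ok (int A) lo" and level: "level_ok (int A) y" and th0: "0 < snd th"
    and ds: "ds = [1..int A]" and K: "0 < K" and pok: "periods_ok (int A) ps"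
    and short: "short_words K ?F" and forbs: "forbs_ok lo ?hi ds y [] fs"
    and rows: "rows_ok R K lo ?hi th ds ?F ps ds tss"
    using cert by (auto simp: connect_ok_def)
  interpret digit_bounds A lo ?hi by (rule lo_ok_digit_bounds[OF lo])
  have y0: "0 < snd y" using level by (cases y) simp
  have F: "length f \<le> K \<and> forbidden (rv y) f" if "f \<in> set ?F" for f
    using that short forbs_ok_sound[OF forbs y0] by (auto simp: short_words_iff ds)
  have bnd: "bounded c" if "positive_biseq c" "markov_value c < ereal (rv y)" for c
    using level_ok_digits[OF level that(1)] lam_less_of_markov[OF that(2)] by (auto simp: bounded_def)
  have X: "lam i (\<lambda>i. nat (p ! nat (i mod int (length p)))) \<le> x" if p: "p \<in> set ps" for p i
  proof -
    have "ereal (lam i (\<lambda>i. nat (p ! nat (i mod int (length p))))) \<le> ereal x"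
      unfolding x using lam_le_markov by (rule SUP_upper2[OF ps[OF p]])
    then show ?thesis by simp
  qed
  define SC where "SC = {a :: biseq. \<forall>i. a i \<in> {1..A}}"
  have A0: "0 < A"
  proof -
    obtain b where "b \<in> SB" using SB(1) by (auto simp: symmetric_transitive_sft_def transitive_subshift_def)
    then have "b 0 \<in> {1..A}" using SB(2) by blast
    then show ?thesis by simp
  qed
  have connect: "\<exists>t. \<exists>vB\<in>one_sided SB. (\<forall>d\<in>set t. 0 < d) \<and>
      markov_value (splice_at a N t vB)
        \<le> max (max (markov_value (splice_at a N [] v1)) (markov_value (splice_at a N [] v2))) (ereal x)"
    if a: "positive_biseq a" and v: "v1 \<in> one_sided SC" "v2 \<in> one_sided SC" "v1 0 < v2 0"
      and m: "markov_value (splice_at a N [] v1) < ereal (rv y)" "markov_value (splice_at a N [] v2) < ereal (rv y)"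
    for a N v1 v2
  proof -
    have pos: "positive_biseq (splice_at a N [] v)" if "v \<in> one_sided SC" for v
      using that a by (auto simp: positive_biseq_def splice_at_Nil one_sided_def SC_def Suc_le_eq)
    have c: "bounded (splice_at a N [] v1)" "bounded (splice_at a N [] v2)"
      using bnd pos v m by auto
    obtain t p where p: "p \<in> set ps" and t: "digits_ok (int A) t"
      and lam: "\<And>j. lam j (splice_at a N [] (wseq t p))
          \<le> max (max (lam j (splice_at a N [] v1)) (lam j (splice_at a N [] v2))) (max (rv th) x)"
      using connection[OF ds F K rows pok th0 c(1) lam_less_of_markov[OF m(1)] c(2) lam_less_of_markov[OF m(2)]
          v(3) X] by blast
    let ?M = "max (markov_value (splice_at a N [] v1)) (markov_value (splice_at a N [] v2))"
    have le: "markov_value (splice_at a N [] (wseq t p)) \<le> max ?M (ereal (max (rv th) x))"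
      using lam by (rule markov_splice_le)
    have vB: "wseq [] p \<in> one_sided SB"
      unfolding one_sided_def
      by (rule rev_image_eqI[OF ps[OF p]]) (simp add: periodic_nth fun_eq_iff)
    have t0: "\<forall>d\<in>set (map nat t). 0 < d" using t by (auto simp: digits_ok_iff)
    show ?thesis
    proof (cases "ereal (rv th) \<le> max ?M (ereal x)")
      case True
      then have "ereal (max (rv th) x) \<le> max ?M (ereal x)" by (cases "rv th \<le> x") auto
      then have "max ?M (ereal (max (rv th) x)) \<le> max ?M (ereal x)"
        by (intro max.boundedI max.cobounded1)
      then have "markov_value (splice_at a N (map nat t) (wseq [] p)) \<le> max ?M (ereal x)"
        using le unfolding splice_at_wseq by (rule order_trans[rotated])
      then show ?thesis using vB t0 by blast
    next
      case False
      then have "markov_value (splice_at a N [] v1) < ereal (rv th)" "\<not> rv th \<le> x"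
        by (auto simp: le_max_iff_disj)
      \<comment> \<open>By the second alternative for \<open>th\<close> the splice with
        \<open>v1\<close> already lies in \<open>SB\<close>, so \<open>v1\<close> itself continues
        the past, with an empty word in between.\<close>
      then have "splice_at a N [] v1 \<in> SB" using th pos[OF v(1)] by blast
      then have "(\<lambda>i. splice_at a N [] v1 (i + (int N + 1))) \<in> SB"
        using SB(1) by (intro sft_shift) (auto simp: symmetric_transitive_sft_def)
      then have "v1 \<in> one_sided SB"
        unfolding one_sided_def
        by (rule rev_image_eqI) (simp add: splice_at_Nil fun_eq_iff)
      then show ?thesis by (intro exI[of _ "[]"] bexI[of _ v1]) (auto simp: le_max_iff_disj)
    qed
  qed
  show ?thesis
    unfolding good_piece_def
  proof (rule exI[of _ SB], rule exI[of _ SC], intro conjI allI impI ballI)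
    show "SB \<subseteq> SC" using SB(2) by (simp add: SC_def)
    show "symmetric_transitive_sft SC"
      unfolding SC_def by (rule full_shift_symmetric_transitive_sft[OF A0])
    fix c
    assume "positive_biseq c \<and> markov_value c < ereal (rv y)"
    then show "c \<in> SC" using bnd by (auto simp: SC_def bounded_def)
  next
    fix a N v1 v2
    assume a: "positive_biseq a \<and> markov_value a = ereal (lam 0 a) \<and> ereal (lam 0 a) < ereal (rv y)"
      and v: "v1 \<in> one_sided SC" "v2 \<in> one_sided SC"
      and m: "v1 0 \<noteq> v2 0 \<and> markov_value (splice_at a N [] v1) < ereal (rv y) \<and>
        markov_value (splice_at a N [] v2) < ereal (rv y)"
    show "\<exists>t. \<exists>vB\<in>one_sided SB. (\<forall>d\<in>set t. 0 < d) \<and>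
      markov_value (splice_at a N t vB)
        \<le> max (max (markov_value (splice_at a N [] v1)) (markov_value (splice_at a N [] v2))) (ereal x)"
    proof (cases "v1 0 < v2 0")
      case True
      then show ?thesis using connect a v m by blast
    next
      case False
      then have "v2 0 < v1 0" using m by linarith
      then show ?thesis
        using connect[of a v2 v1 N] a v m by (simp add: max.commute)
    qed
  qed (use SB x in auto)
qed

lemma reads_drop: "reads xs s \<Longrightarrow> reads (drop k xs) (\<lambda>i. s (i + k))"
proof (induction xs arbitrary: k s)
  case (Cons x xs)
  then show ?case by (cases k) auto
qed simp

lemma reads_take: "reads xs s \<Longrightarrow> reads (take k xs) s"
  by (simp add: reads_nth)

lemma reads_unique: "reads xs s \<Longrightarrow> reads xs t \<Longrightarrow> k < length xs \<Longrightarrow> s k = t k"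
  by (metis reads_nth of_nat_eq_iff)

lemma safe_num_nth:
  assumes "safe_num R lo hi th r n w" "i < n"
  shows "i < length w \<and> safe_at R lo hi th (rev (take i w) @ r) (w ! i) (drop (Suc i) w)"
  using assms
proof (induction n arbitrary: r w i)
  case (Suc n)
  then obtain x w' where "w = x # w'" by (cases w) auto
  then show ?case using Suc by (cases i) auto
qed simp

lemma offsets_ok_member:
  assumes "offsets_ok L c ps os" "p \<in> set ps"
  shows "\<exists>k. is_pref (unroll (length p + L) [] p) (drop k (unroll (k + (length p + L)) [] c))"
  using assms
proof (induction ps arbitrary: os)
  case (Cons q ps)
  then obtain k os' where "os = k # os'" by (cases os) auto
  then show ?case using Cons by auto
qed simp

context digit_bounds
begin

text \<open>A member of the window shift is known only within distance \<open>M\<close> of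
  \<open>j\<close>, and the two tests of \<open>safe_at\<close> look no further.\<close>

lemma safe_at_window:
  assumes b: "bounded b" and safe: "safe_at R lo hi th r x w" "0 < snd th" "fst R \<le> M" "snd R \<le> M"
    and r: "reads (take M r) (\<lambda>k. b (j - 1 - int k))" and w: "reads (take M w) (\<lambda>k. b (j + 1 + int k))"
    and x: "int (b j) = x"
  shows "lam j b \<le> rv th"
proof -
  have take: "reads (take n r) (\<lambda>k. b (j - 1 - int k))" "reads (take n w) (\<lambda>k. b (j + 1 + int k))"
    if "n \<le> M" for n
    using reads_take[OF r, of n] reads_take[OF w, of n] that by (simp_all add: min_absorb1)
  obtain m n where R: "R = (m, n)" by fastforce
  have "m \<le> M" "n \<le> M" using safe by (auto simp: R)
  then show ?thesis
    using safe(1) lam_le[OF b _ safe(2) take(1)[of m] take(2)[of m] x]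
      lam_le[OF b _ safe(2) take(1)[of n] take(2)[of n] x]
    by (auto simp: R cf_bound_upto_eq)
qed

end

text \<open>The supremum x over the window shift is at least \<open>th\<close>, because the defining
  orbit belongs to it and reaches \<open>th\<close> at its first digit; it is at most
  \<open>X\<close>, because every position is the centre of a window of that orbit. This also shows
  that x is a real number.\<close>

lemma orbit_piece:
  assumes cert: "connect_ok R K lo (int A) ds y th fs ps tss"
    and orbit: "orbit_ok h g lo (int A) th X c s ps os"
  shows "\<exists>x. x \<le> rv X \<and> good_piece x (rv y)"
proof -
  let ?hi = "hi_of lo" and ?L = "2 * snd h + 1" and ?n = "length c"
  have lo: "lo_ok (int A) lo" and th0: "0 < snd th" and pok: "periods_ok (int A) ps"
    using cert by (auto simp: connect_ok_def)
  have c: "c \<noteq> []" "digits_ok (int A) c" and s: "s \<le> ?n" "rev c = drop s c @ take s c"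
    and X0: "0 < snd X" and h: "fst h \<le> snd h"
    and high: "high_ok lo ?hi th (unroll g [] (rev c)) (unroll g [] c)"
    and safe: "safe_num h lo ?hi X (unroll (snd h) [] (rev c)) ?n (unroll (?n + snd h) [] c)"
    and offsets: "offsets_ok ?L c ps os"
    using orbit by (auto simp: orbit_ok_def)
  interpret digit_bounds A lo ?hi by (rule lo_ok_digit_bounds[OF lo])
  define c0 where "c0 = (\<lambda>i. nat (c ! nat (i mod int ?n)))"
  define SB where "SB = window_shift ?L c0"
  have n: "0 < ?n" using c(1) by simp
  have per: "c0 (i + int ?n) = c0 i" for i unfolding c0_def by (rule periodic_nth)
  have c0w: "c0 (int k) = wseq [] c k" for k unfolding c0_def by (rule periodic_nth)
  have c0l: "c0 (- 1 - int k) = wseq [] (rev c) k" for k unfolding c0_def by (rule periodic_nth_left[OF c(1)])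
  have digit: "c0 i \<in> {1..A}" for i unfolding c0_def by (rule periodic_digit[OF c(2,1)])
  have pos: "\<And>d. d \<in> set [] \<union> set c \<Longrightarrow> 0 \<le> d" "\<And>d. d \<in> set [] \<union> set (rev c) \<Longrightarrow> 0 \<le> d"
    using c(2) by (force simp: digits_ok_iff)+
  have right: "reads (unroll m [] c) (\<lambda>k. c0 (int k))" for m
    using reads_unroll[of "[]" c m] pos(1) by (simp add: c0w)
  have left: "reads (unroll m [] (rev c)) (\<lambda>k. c0 (- 1 - int k))" for m
    using reads_unroll[of "[]" "rev c" m] pos(2) by (simp add: c0l)
  \<comment> \<open>Position -1 - k carries \<open>rev c ! k\<close>, which is digit s + k of the
    orbit since \<open>rev c\<close> is \<open>c\<close> rotated by \<open>s\<close>. With i = k + 1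
    this gives the offset s - 1.\<close>
  have symm: "c0 (- i) = c0 (int s - 1 + i)" for i
  proof -
    define k where "k = nat ((i - 1) mod int ?n)"
    have k: "k < ?n" "int k = (i - 1) mod int ?n" using n by (auto simp: k_def nat_less_iff)
    define q where "q = (i - 1) div int ?n"
    have i: "i = 1 + int k + int ?n * q"
      using mult_div_mod_eq[of "int ?n" "i - 1"] by (simp add: k q_def)
    have "- i = (- 1 - int k) + int ?n * (- q)" by (simp add: i)
    then have "c0 (- i) = c0 (- 1 - int k)"
      using periodic_add_mult[of c0 "int ?n", OF per] by metis
    also have "\<dots> = nat (rev c ! k)" using k(1) by (simp add: c0l wseq_def)
    also have "rev c ! k = c ! ((s + k) mod ?n)"
    proof (cases "s = ?n")
      case True
      then show ?thesis using s(2) k(1) by simp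
    next
      case False
      then have "rev c = rotate s c" using s by (simp add: rotate_drop_take)
      then show ?thesis using k(1) by (simp add: nth_rotate)
    qed
    also have "nat (c ! ((s + k) mod ?n)) = c0 (int (s + k))"
      using c0w[of "s + k"] by (simp add: wseq_def)
    also have "\<dots> = c0 (int (s + k) + int ?n * q)"
      using periodic_add_mult[of c0 "int ?n", OF per] by metis
    also have "int (s + k) + int ?n * q = int s - 1 + i" by (simp add: i)
    finally show ?thesis .
  qed
  have SB: "symmetric_transitive_sft SB"
    unfolding symmetric_transitive_sft_def SB_def
    using window_shift_sft[of ?L c0 A] digit window_shift_symmetric[of c0, OF symm]
      window_shift_transitive[of c0, OF per n] by auto
  have sub: "SB \<subseteq> {a. \<forall>i. a i \<in> {1..A}}"
  proof (intro subsetI CollectI allI)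
    fix b i assume "b \<in> SB"
    then obtain j where "b i = c0 j" using window_shift_digit[of b ?L c0 i] by (auto simp: SB_def)
    then show "b i \<in> {1..A}" using digit by metis
  qed
  have lam_X: "lam j b \<le> rv X" if b: "b \<in> SB" for b j
  proof -
    let ?w = "unroll (?n + snd h) [] c" and ?r = "unroll (snd h) [] (rev c)"
    obtain j' where "\<forall>k<?L. b (j - int (snd h) + int k) = c0 (j' + int k)"
      using b by (auto simp: SB_def window_shift_def)
    then have win: "b (j - int (snd h) + int k) = c0 (j' + int k)" if "k < ?L" for k
      using that by blast
    \<comment> \<open>The centre of the window, reduced modulo the period, is one of the positions
      that \<open>safe_num\<close> has tested.\<close>
    define i where "i = nat ((j' + int (snd h)) mod int ?n)"
    have i: "i < ?n" "int i = (j' + int (snd h)) mod int ?n" using n by (auto simp: i_def nat_less_iff)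
    have shift: "c0 (j' + int (snd h) + t) = c0 (int i + t)" for t
    proof -
      have "j' + int (snd h) + t = int i + t + int ?n * ((j' + int (snd h)) div int ?n)"
        using mult_div_mod_eq[of "int ?n" "j' + int (snd h)"] by (simp add: i)
      then show ?thesis using periodic_add_mult[of c0 "int ?n", OF per] by metis
    qed
    have bc: "b (j + t) = c0 (int i + t)" if "- int (snd h) \<le> t" "t \<le> int (snd h)" for t
      using win[of "nat (t + int (snd h))"] that shift[of t] by (simp add: algebra_simps)
    have si: "i < length ?w" "safe_at h lo ?hi X (rev (take i ?w) @ ?r) (?w ! i) (drop (Suc i) ?w)"
      using safe_num_nth[OF safe i(1)] by auto
    have wi: "int (c0 (int k)) = ?w ! k" if "k < length ?w" for k
      using right[of "?n + snd h"] that by (simp add: reads_nth)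
    have rdl: "reads (rev (take i ?w) @ ?r) (\<lambda>k. c0 (int i - 1 - int k))"
    proof -
      have "reads (rev (take i ?w)) (\<lambda>k. c0 (int i - 1 - int k))"
        unfolding reads_nth
      proof (intro allI impI)
        fix k assume k: "k < length (rev (take i ?w))"
        then have ki: "k < i" by simp
        have "int i - 1 - int k = int (i - Suc k)" using ki by simp
        moreover have "rev (take i ?w) ! k = ?w ! (i - Suc k)" using si(1) ki by (simp add: rev_nth)
        ultimately show "int (c0 (int i - 1 - int k)) = rev (take i ?w) ! k"
          using wi[of "i - Suc k"] si(1) by simp
      qed
      moreover have "reads ?r (\<lambda>k. c0 (int i - 1 - int (k + length (rev (take i ?w)))))"
        using left[of "snd h"] si(1) by (simp add: min_absorb2)
      ultimately show ?thesis by (simp add: reads_append)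
    qed
    have rdr: "reads (drop (Suc i) ?w) (\<lambda>k. c0 (int i + 1 + int k))"
      using reads_drop[OF right[of "?n + snd h"], of "Suc i"] by (simp add: algebra_simps)
    show ?thesis
    proof (rule safe_at_window[OF _ si(2) X0 h order.refl])
      show "bounded b" using b sub by (auto simp: bounded_def)
      show "int (b j) = ?w ! i" using bc[of 0] wi[OF si(1)] by simp
      show "reads (take (snd h) (rev (take i ?w) @ ?r)) (\<lambda>k. b (j - 1 - int k))"
      proof (rule reads_cong[OF reads_take[OF rdl]])
        fix k assume "k < length (take (snd h) (rev (take i ?w) @ ?r))"
        then have "k < snd h" by simp
        then show "b (j - 1 - int k) = c0 (int i - 1 - int k)"
          using bc[of "- 1 - int k"] by (simp add: algebra_simps)
      qed
      show "reads (take (snd h) (drop (Suc i) ?w)) (\<lambda>k. b (j + 1 + int k))"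
      proof (rule reads_cong[OF reads_take[OF rdr]])
        fix k assume "k < length (take (snd h) (drop (Suc i) ?w))"
        then have "k < snd h" by simp
        then show "b (j + 1 + int k) = c0 (int i + 1 + int k)"
          using bc[of "1 + int k"] by (simp add: algebra_simps)
      qed
    qed
  qed
  have c0_SB: "c0 \<in> SB" unfolding SB_def by (rule window_shift_self)
  have th_le: "rv th \<le> lam 0 c0"
  proof -
    obtain x r where xr: "unroll g [] c = x # r" and sum: "sum_ge (cf_bound lo ?hi (unroll g [] (rev c))) (cf_bound lo ?hi r) x th"
      using high by (cases "unroll g [] c") auto
    have rd: "reads (x # r) (\<lambda>k. c0 (int k))" using right[of g] by (simp add: xr)
    show ?thesis
      by (rule lam_ge[OF _ sum th0])
         (use left[of g] rd digit in \<open>auto simp: bounded_def\<close>)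
  qed
  define S where "S = (SUP b\<in>SB. markov_value b)"
  have "S \<le> ereal (rv X)"
    unfolding S_def using lam_X by (intro SUP_least markov_le) simp
  moreover have th_S: "ereal (rv th) \<le> S"
    unfolding S_def using th_le lam_le_markov[of 0 c0] c0_SB
    by (intro SUP_upper2[of c0]) (auto intro: order_trans[OF _ lam_le_markov])
  ultimately obtain x where x: "S = ereal x" "x \<le> rv X" "rv th \<le> x"
    by (cases S) auto
  have "good_piece x (rv y)"
  proof (rule good_piece_from_connection[OF cert SB sub])
    show "ereal x = (SUP b\<in>SB. markov_value b)" using x(1) by (simp add: S_def)
    show "rv th \<le> x \<or> (\<forall>c. positive_biseq c \<and> markov_value c < ereal (rv th) \<longrightarrow> c \<in> SB)"
      using x(3) by simp
    fix p assume p: "p \<in> set ps"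
    let ?a = "\<lambda>i. nat (p ! nat (i mod int (length p)))"
    have pp: "p \<noteq> []" "digits_ok (int A) p" using p pok by (auto simp: periods_ok_iff)
    obtain k where k: "is_pref (unroll (length p + ?L) [] p) (drop k (unroll (k + (length p + ?L)) [] c))"
      using offsets_ok_member[OF offsets p] by blast
    have rd1: "reads (unroll (length p + ?L) [] p) (\<lambda>i. c0 (int (i + k)))"
      by (rule is_pref_reads[OF k reads_drop[OF right]])
    have rd2: "reads (unroll (length p + ?L) [] p) (wseq [] p)"
      using pp(2) by (intro reads_unroll) (force simp: digits_ok_iff)
    show "?a \<in> SB"
      unfolding SB_def
    proof (rule window_shift_mem)
      show "?a (i + int (length p)) = ?a i" for i by (rule periodic_nth)
      show "0 < length p" using pp by simp
      fix m assume m: "m < length p + ?L"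
      have "wseq [] p m = c0 (int (m + k))"
        using reads_unique[OF rd2 rd1, of m] m by (simp add: length_unroll[OF pp(1)])
      then show "?a (int m) = c0 (int k + int m)"
        by (simp add: periodic_nth add.commute)
    qed
  qed
  then show ?thesis using x(2) by blast
qed

section \<open>The intervals\<close>

lemma good_interval_piece:
  assumes "good_piece x y" "x \<le> \<nu>" "\<mu> \<le> y"
  shows "good_interval \<nu> \<mu>"
  unfolding good_interval_def using assms by (intro exI[of _ "{(x, y)}"]) auto

text \<open>A piece requires its x at the left end and its level y at the right end; where no single
  pair of subshifts serves both ends, successive pieces trade a larger x for a larger y.\<close>

lemma good_interval_join:
  assumes "good_interval a b" "good_interval b c"
  shows "good_interval a c"
proof -
  obtain P Q where "\<forall>(x, y)\<in>P. good_piece x y" "{a..<b} \<subseteq> (\<Union>(x, y)\<in>P. {x..<y})"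
    "\<forall>(x, y)\<in>Q. good_piece x y" "{b..<c} \<subseteq> (\<Union>(x, y)\<in>Q. {x..<y})"
    using assms by (auto simp: good_interval_def)
  moreover have "{a..<c} \<subseteq> {a..<b} \<union> {b..<c}" by auto
  ultimately show ?thesis
    unfolding good_interval_def by (intro exI[of _ "P \<union> Q"]) blast
qed

lemma certified_interval:
  assumes "connect_ok R K lo A ds y th fs ps tss" "orbit_ok h g lo A th X c s ps os"
    and "0 \<le> A" "rv X \<le> \<nu>" "\<mu> \<le> rv y"
  shows "good_interval \<nu> \<mu>"
proof -
  have "int (nat A) = A" using assms(3) by simp
  then show ?thesis
    using orbit_piece[of R K lo "nat A" ds y th fs ps tss h g X c s os] assms good_interval_piece
    by (metis order_trans)
qed

text \<open>Over the digits 1 and 2 no tail exceeds [0; 1, 2, 1, 2, ...] = sqrt 3 - 1, and 2 + 2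
  (sqrt 3 - 1) = sqrt 12.\<close>

lemma markov_value_two_digits:
  assumes "\<And>i. c i \<in> {1..2}"
  shows "markov_value c \<le> ereal (sqrt 12)"
proof (rule markov_le)
  fix i
  have pos: "positive_biseq c" using assms by (auto simp: positive_biseq_def Suc_le_eq)
  \<comment> \<open>The positive root of 2 x^2 + 2 x = 1, that is [0; 2, 1, 2, 1, ...].\<close>
  define lo :: real where "lo = (sqrt 3 - 1) / 2"
  have "1 \<le> sqrt (3 :: real)" by simp
  then have lo: "0 \<le> lo" "real 2 * lo * lo + real 2 * lo \<le> 1"
    by (auto simp: lo_def field_simps)
  have "(sqrt 3 - 1) * (1 + lo) = 1" by (simp add: lo_def field_simps)
  then have "1 / (1 + lo) = sqrt 3 - 1" using lo(1) by (simp add: divide_eq_eq)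
  then have "fr_left c i \<le> sqrt 3 - 1" "fr_right c i \<le> sqrt 3 - 1"
    using fr_digit_bounds(2)[OF lo, of "\<lambda>n. c (i - 1 - int n)"]
      fr_digit_bounds(2)[OF lo, of "\<lambda>n. c (i + 1 + int n)"] assms
    by (auto simp: fr_left_def fr_right_def)
  moreover have "real (c i) \<le> 2" using assms[of i] by simp
  ultimately have "lam i c \<le> 2 * sqrt 3" using lam_eq[OF pos, of i] by simp
  also have "2 * sqrt 3 = sqrt (12 :: real)"
    using real_sqrt_mult[of 4 3] by simp
  finally show "ereal (lam i c) \<le> ereal (sqrt 12)" by simp
qed

text \<open>The smaller subshift is the full shift on two digits here: any other sequence has Markov value
  at least \<open>7 / 2\<close>.\<close>

lemma sqrt_12_interval:
  assumes cert: "connect_ok R K lo 3 ds y (7, 2) fs ps tss"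
    and ps: "\<And>p. p \<in> set ps \<Longrightarrow> digits_ok 2 p" and mu: "\<mu> \<le> rv y"
  shows "good_interval (sqrt 12) \<mu>"
proof -
  define SB where "SB = {a :: biseq. \<forall>i. a i \<in> {1..2}}"
  define S where "S = (SUP b\<in>SB. markov_value b)"
  have pok: "periods_ok 3 ps" using cert by (simp add: connect_ok_def)
  have "S \<le> ereal (sqrt 12)"
    unfolding S_def by (intro SUP_least markov_value_two_digits) (auto simp: SB_def)
  \<comment> \<open>The constant sequence serves only to bound the supremum from below, so that it
    is a real number.\<close>
  moreover have "ereal (lam 0 (\<lambda>_. 1)) \<le> S"
    unfolding S_def
    by (intro SUP_upper2[of "(\<lambda>_. 1) :: biseq"] lam_le_markov) (simp add: SB_def)
  ultimately obtain x where x: "S = ereal x" "x \<le> sqrt 12"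
    by (cases S) auto
  have "good_piece x (rv y)"
  proof (rule good_piece_from_connection[where A = 3 and SB = SB])
    show "connect_ok R K lo (int 3) ds y (7, 2) fs ps tss" using cert by simp
    show "symmetric_transitive_sft SB"
      unfolding SB_def by (rule full_shift_symmetric_transitive_sft) simp
    show "SB \<subseteq> {a. \<forall>i. a i \<in> {1..3}}"
    proof (intro subsetI CollectI allI)
      fix b i assume "b \<in> SB"
      then have "b i \<in> {1..2}" by (simp add: SB_def)
      then show "b i \<in> {1..3}" by simp
    qed
    show "ereal x = (SUP b\<in>SB. markov_value b)" using x(1) by (simp add: S_def)
    show "(\<lambda>i. nat (p ! nat (i mod int (length p)))) \<in> SB" if "p \<in> set ps" for p
    proof -
      have "p \<noteq> []" using that pok by (auto simp: periods_ok_iff)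
      then show ?thesis
        unfolding SB_def using periodic_digit[of 2 p] ps[OF that] by simp
    qed
    \<comment> \<open>7/2 is A + 1 + 2/(A + 2) at A = 2, the value forced by a digit 3. As it
      exceeds sqrt 12, the second alternative for \<open>th\<close> is the one that applies.\<close>
    have "c \<in> SB" if "positive_biseq c" "markov_value c < ereal (rv (7, 2))" for c
      using level_ok_digits[of 2 "(7, 2)" c] that(1) lam_less_of_markov[OF that(2)] by (simp add: SB_def)
    then show "rv (7, 2) \<le> x \<or> (\<forall>c. positive_biseq c \<and> markov_value c < ereal (rv (7, 2)) \<longrightarrow> c \<in> SB)"
      by blast
  qed
  then show ?thesis using x(2) mu by (rule good_interval_piece)
qed

section \<open>The certificates\<close>

text \<open>The data were found by a computer search: the trees by refining the left context until an
  extremal continuation is safe, and the long periods by joining all the periodic tails and a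
  window of sufficiently high value.  The rational levels are the simplest fractions that still work.\<close>

lemma connect_1:
  "connect_ok (5, 10) 20 (56, 153) 2 [1, 2] (3603, 1154) (4863, 1594)
     [Centre [1] 2 [1], Centre [2, 2, 1, 1, 1] 2 [1, 2], Centre [2, 2, 1, 2] 2 [1, 2], Centre [2, 2,
      1] 2 [1, 2, 2, 1, 1], Centre [2, 2, 1, 1, 2, 2, 1] 2 [1, 2, 2, 1, 2, 2], Ext [2, 1, 2, 2, 1,
      2, 2, 2, 1, 1, 2, 2, 1], Ext [1, 2, 2, 1, 2, 2, 2, 1, 1, 2, 2, 1], Centre [2, 2, 1] 2 [1, 2,
      2, 2], Ext [2, 2, 1, 2, 2, 2, 1, 1, 2, 2, 1], Ext [2, 1, 2, 2, 2, 1, 1, 2, 2, 1], Centre [2,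
      2, 1, 1, 2, 2] 2 [1, 2, 2, 1, 2, 2, 1], Centre [1, 2] 2 [2, 2, 1, 1, 1], Centre [2, 2, 1, 1,
      2, 2, 2, 1, 1] 2 [1, 2, 2, 1, 2, 2, 2, 1, 1, 2], Ext [1, 1, 2, 2, 2, 1, 2, 2, 1, 2, 2, 2, 1,
      1, 2, 2, 2, 1, 1], Ext [1, 2, 2, 2, 1, 2, 2, 1, 2, 2, 2, 1, 1, 2, 2, 2, 1, 1], Centre [2, 2,
      1, 1, 2, 2] 2 [1, 2, 2, 1, 2, 2, 2, 2], Ext [2, 2, 2, 1, 2, 2, 1, 2, 2, 2, 1, 1, 2, 2, 2, 1,
      1], Ext [2, 2, 1, 2, 2, 1, 2, 2, 2, 1, 1, 2, 2, 2, 1, 1], Ext [2, 1, 2, 2, 1, 2, 2, 2, 1, 1,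
      2, 2, 2, 1, 1], Ext [1, 2, 2, 1, 2, 2, 2, 1, 1, 2, 2, 2, 1, 1], Ext [2, 2, 1, 2, 2, 2, 1, 1,
      2, 2, 2, 1, 1], Ext [2, 1, 2, 2, 2, 1, 1, 2, 2, 2, 1, 1], Centre [1, 2, 2, 1, 1] 2 [2, 2, 1],
      Centre [1, 2, 2, 1, 2, 2, 1] 2 [2, 2, 1, 1, 2, 2], Ext [2, 1, 1, 2, 2, 2, 1, 2, 2, 1, 2, 2,
      1], Ext [1, 1, 2, 2, 2, 1, 2, 2, 1, 2, 2, 1], Ext [1, 2, 2, 2, 1, 2, 2, 1, 2, 2, 1], Centre
      [1, 2, 2, 1, 2, 2, 2, 2] 2 [2, 2, 1, 1, 2, 2], Ext [2, 1, 1, 2, 2, 2, 1, 2, 2, 1, 2, 2, 2, 2],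
      Ext [1, 1, 2, 2, 2, 1, 2, 2, 1, 2, 2, 2, 2], Ext [1, 2, 2, 2, 1, 2, 2, 1, 2, 2, 2, 2], Centre
      [1, 2, 2, 2] 2 [2, 2, 1], Centre [2, 2, 1, 1, 2, 2, 2, 2] 2 [1, 2, 2, 1, 2, 2], Ext [2, 1, 2,
      2, 1, 2, 2, 2, 1, 1, 2, 2, 2, 2], Ext [1, 2, 2, 1, 2, 2, 2, 1, 1, 2, 2, 2, 2], Ext [2, 2, 1,
      2, 2, 2, 1, 1, 2, 2, 2, 2], Ext [2, 1, 2, 2, 2, 1, 1, 2, 2, 2, 2]]
     [[1, 1, 2, 2, 2, 1]]
     [[Node [Node [Leaf [] [1, 1, 2, 2, 2, 1], Node [Dead, Node [Leaf [] [1, 1, 2, 2, 2, 1], Node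
      [Node [Node [Dead, Leaf [] [1, 1, 2, 2, 2, 1]], Dead], Leaf [] [1, 1, 2, 2, 2, 1]]]]], Node
      [Dead, Node [Leaf [] [1, 1, 2, 2, 2, 1], Node [Node [Leaf [] [1, 1, 2, 2, 2, 1], Node [Dead,
      Node [Node [Dead, Node [Dead, Node [Dead, Node [Node [Node [Dead, Node [Dead, Dead]], Dead],
      Dead]]]], Dead]]], Leaf [] [1, 1, 2, 2, 2, 1]]]]]], []]"
  by code_simp

lemma orbit_1:
  "orbit_ok (5, 8) 12 (56, 153) 2 (4863, 1594) (1861, 610)
     [2, 2, 2, 1, 1, 1] 3
     [[1, 1, 2, 2, 2, 1]]
     [4]"
  by code_simp

lemma connect_2:
  "connect_ok (5, 8) 15 (56, 153) 2 [1, 2] (10267, 3129) (1374, 439)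
     [Centre [1, 2, 2, 1, 1] 2 [1], Centre [1, 2, 2, 2] 2 [1], Centre [1, 1, 1] 2 [1, 2], Centre [1,
      1, 2, 1, 1] 2 [1, 2], Centre [1, 2] 2 [1, 1, 2, 1, 1], Centre [1, 1, 2, 2] 2 [1, 2], Centre
      [1, 2] 2 [1, 2], Centre [1, 2] 2 [1, 1, 1], Centre [1, 2, 1] 2 [1], Centre [1] 2 [1, 2, 2, 1,
      1], Centre [1, 2, 2, 1, 2, 2] 2 [1, 1, 2, 1, 2, 2, 1, 2], Ext [1, 2, 2, 1, 2, 1, 1, 2, 1, 2,
      2, 1, 2, 2], Centre [1] 2 [1, 2, 2, 2], Ext [2, 2, 1, 2, 1, 1, 2, 1, 2, 2, 1, 2, 2], Ext [2,
      1, 2, 1, 1, 2, 1, 2, 2, 1, 2, 2], Ext [1, 2, 1, 1, 2, 1, 2, 2, 1, 2, 2], Centre [1, 2] 2 [1,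
      1, 2, 2], Ext [2, 1, 1, 2, 1, 2, 2, 1, 2, 2], Ext [1, 1, 2, 1, 2, 2, 1, 2, 2], Ext [1, 2, 1,
      2, 2, 1, 2, 2]]
     [[2, 2, 1, 2]]
     [[Node [Node [Leaf [] [2, 2, 1, 2], Node [Node [Node [Dead, Node [Node [Dead, Dead], Dead]],
      Dead], Leaf [] [2, 2, 1, 2]]], Node [Node [Leaf [] [2, 2, 1, 2], Node [Dead, Node [Leaf [] [2,
      2, 1, 2], Dead]]], Leaf [] [2, 2, 1, 2]]]], []]"
  by code_simp

lemma orbit_2:
  "orbit_ok (5, 7) 9 (56, 153) 2 (1374, 439) (241, 77)
     [2, 2, 2, 1] 3
     [[2, 2, 1, 2]]
     [1]"
  by code_simp

lemma connect_3:
  "connect_ok (5, 10) 20 (56, 153) 2 [1, 2] (5168, 1573) (1277, 391)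
     [Centre [1, 1, 1] 2 [1, 2], Centre [1, 2] 2 [1, 2], Centre [1, 2] 2 [1, 1, 1], Centre [1, 2, 2,
      2] 2 [1, 1, 2, 1, 1], Centre [1, 2, 1] 2 [1], Centre [1, 2, 2, 2, 1, 1, 1] 2 [1, 1, 2, 1, 2,
      2], Ext [2, 1, 2, 1, 1, 2, 1, 2, 2, 2, 1, 1, 1], Ext [1, 2, 1, 1, 2, 1, 2, 2, 2, 1, 1, 1],
      Centre [1, 2] 2 [1, 1, 2, 2], Ext [2, 1, 1, 2, 1, 2, 2, 2, 1, 1, 1], Ext [1, 1, 2, 1, 2, 2, 2,
      1, 1, 1], Ext [1, 2, 1, 2, 2, 2, 1, 1, 1], Centre [1, 2, 2, 2, 1, 2] 2 [1, 1, 2, 1, 2, 2], Ext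
      [2, 1, 2, 1, 1, 2, 1, 2, 2, 2, 1, 2], Ext [1, 2, 1, 1, 2, 1, 2, 2, 2, 1, 2], Ext [2, 1, 1, 2,
      1, 2, 2, 2, 1, 2], Ext [1, 1, 2, 1, 2, 2, 2, 1, 2], Ext [1, 2, 1, 2, 2, 2, 1, 2], Centre [1,
      2, 2, 2, 1] 2 [1, 1, 2, 1, 2, 2, 1], Centre [1, 1, 2, 1, 2, 2] 2 [1, 2, 2, 2, 1, 1, 1], Centre
      [1, 1, 2, 1, 2, 2, 2, 1, 1, 2] 2 [1, 2, 2, 2, 1, 1, 2, 1, 1], Centre [1, 1, 2, 2] 2 [1, 2],
      Ext [1, 2, 1, 1, 2, 2, 2, 1, 2, 1, 1, 2, 1, 2, 2, 2, 1, 1, 2], Centre [1, 1, 2, 1, 2, 2] 2 [1,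
      2, 2, 2, 1, 1, 2, 2], Ext [2, 1, 1, 2, 2, 2, 1, 2, 1, 1, 2, 1, 2, 2, 2, 1, 1, 2], Ext [1, 1,
      2, 2, 2, 1, 2, 1, 1, 2, 1, 2, 2, 2, 1, 1, 2], Centre [1, 1, 2, 1, 2, 2] 2 [1, 2, 2, 2, 1, 2],
      Ext [1, 2, 2, 2, 1, 2, 1, 1, 2, 1, 2, 2, 2, 1, 1, 2], Centre [1, 2, 2, 2, 1] 2 [1, 1, 2, 1, 2,
      2, 2, 2], Ext [2, 2, 2, 1, 2, 1, 1, 2, 1, 2, 2, 2, 1, 1, 2], Ext [2, 2, 1, 2, 1, 1, 2, 1, 2,
      2, 2, 1, 1, 2], Ext [2, 1, 2, 1, 1, 2, 1, 2, 2, 2, 1, 1, 2], Ext [1, 2, 1, 1, 2, 1, 2, 2, 2,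
      1, 1, 2], Ext [2, 1, 1, 2, 1, 2, 2, 2, 1, 1, 2], Ext [1, 1, 2, 1, 2, 2, 2, 1, 1, 2], Ext [1,
      2, 1, 2, 2, 2, 1, 1, 2]]
     [[1, 1, 2, 1], [2, 2, 1, 2]]
     [[Node [Node [Leaf [] [1, 1, 2, 1], Node [Node [Node [Dead, Leaf [] [1, 1, 2, 1]], Dead], Leaf
      [] [1, 1, 2, 1]]], Node [Node [Node [Leaf [] [2, 2, 1, 2], Leaf [] [2, 2, 1, 2]], Leaf [] [2,
      2, 1, 2]], Leaf [] [1, 1, 2, 1]]]], []]"
  by code_simp

text \<open>The orbits of 1 1 2 1 and 2 2 1 2 have to lie in one transitive subshift, so a single
  period runs along both of them, each for at least 4 + 7 digits, where 7 is the window length. With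
  \<open>s\<close> equal to 1 the period is symmetric about its first digit.\<close>

lemma orbit_3:
  "orbit_ok (3, 3) 13 (56, 153) 2 (1277, 391) (187, 57)
     [2, 1, 1, 1, 2, 1, 1, 1, 2, 1, 1, 1, 2, 1, 1, 1, 2, 1, 1, 1, 2, 1, 1, 1, 2, 1, 1, 1, 2, 1, 1,
      1, 1, 2, 2, 2, 1, 2, 2, 2, 1, 2, 2, 2, 1, 1, 1, 1, 2, 1, 1, 1, 2, 1, 1, 1, 2, 1, 1, 1, 2, 1,
      1, 1, 2, 1, 1, 1, 2, 1, 1, 1, 2, 1, 1, 1] 1
     [[1, 1, 2, 1], [2, 2, 1, 2]]
     [2, 34]"
  by code_simp

lemma connect_4:
  "connect_ok (5, 12) 17 (56, 153) 2 [1, 2] (286, 87) (2987, 909)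
     [Centre [1, 1, 1] 2 [1, 2], Centre [1, 2] 2 [1, 2], Centre [1, 2] 2 [1, 1, 1], Centre [1, 2] 2
      [1, 1, 2, 2], Centre [1, 2, 2, 2, 1] 2 [1, 1, 2, 1, 1, 1, 1], Centre [1, 2, 2, 2, 1, 1, 1] 2
      [1, 1, 2, 1, 1, 1, 2, 1, 1], Ext [1, 2, 1, 1, 1, 2, 1, 1, 2, 1, 2, 2, 2, 1, 1, 1], Centre [1,
      2, 2, 2, 1, 1, 1] 2 [1, 1, 2, 1, 1, 1, 2, 2], Ext [2, 1, 1, 1, 2, 1, 1, 2, 1, 2, 2, 2, 1, 1,
      1], Ext [1, 1, 1, 2, 1, 1, 2, 1, 2, 2, 2, 1, 1, 1], Centre [1, 2, 2, 2] 2 [1, 1, 2, 1, 1, 2],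
      Ext [1, 1, 2, 1, 1, 2, 1, 2, 2, 2, 1, 1, 1], Centre [1, 2, 1] 2 [1], Centre [1, 1, 2, 1, 1, 2]
      2 [1, 2, 2, 2], Centre [1, 1, 2, 2] 2 [1, 2], Centre [1, 2, 2, 2, 1, 2] 2 [1, 1, 2, 1, 1]]
     [[1, 1, 2, 1]]
     [[Node [Leaf [] [1, 1, 2, 1], Node [Node [Node [Leaf [2, 2, 1, 2, 1, 1, 2, 1, 2, 2, 1, 2, 1, 1,
      2, 1, 1, 2, 1, 2, 2] [1, 1, 2, 1], Node [Node [Leaf [1, 1, 2, 1, 2, 2] [1, 1, 2, 1], Dead],
      Leaf [1, 1, 2, 1, 2, 2] [1, 1, 2, 1]]], Leaf [2, 2, 1, 2, 1, 1, 2, 1, 2, 2, 1, 2, 1, 1, 2, 1,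
      1, 2, 1, 2, 2] [1, 1, 2, 1]], Leaf [] [1, 1, 2, 1]]]], []]"
  by code_simp

text \<open>The leaf orbit of 1 1 2 1 has values of at most about 3.265, below \<open>th\<close> =
  2987/909 = 3.286... The long period passes through this orbit and through a digit whose value is
  at least \<open>th\<close>, which makes the supremum large enough.\<close>

lemma orbit_4:
  "orbit_ok (5, 12) 12 (56, 153) 2 (2987, 909) (4469, 1360)
     [2, 1, 1, 2, 1, 1, 2, 1, 2, 2, 1, 1, 1, 1, 1, 1, 2, 1, 1, 1, 2, 1, 1, 1, 2, 1, 1, 1, 2, 1, 1,
      1, 2, 1, 1, 1, 2, 1, 1, 1, 2, 1, 1, 1, 1, 1, 1, 2, 2, 1, 2, 1, 1, 2, 1, 1, 2, 1, 2, 2, 1, 1,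
      2, 1, 1, 1, 2, 1, 1, 1, 1, 1, 2, 1, 1, 1, 2, 1, 1, 1, 2, 1, 1, 1, 2, 1, 1, 1, 2, 1, 1, 1, 2,
      1, 1, 1, 2, 1, 1, 1, 1, 1, 2, 1, 1, 1, 2, 1, 1, 2, 2, 1] 57
     [[1, 1, 2, 1]]
     [14]"
  by code_simp

lemma connect_5:
  "connect_ok (5, 14) 14 (56, 153) 2 [1, 2] (191, 58) (343363, 104272)
     [Centre [1, 1, 1] 2 [1, 2], Centre [1, 2, 1] 2 [1], Centre [1, 2] 2 [1, 2], Centre [1, 2] 2 [1,
      1, 1], Centre [1, 2, 2, 2, 1, 2] 2 [1, 1, 2, 2], Centre [1, 1, 2, 2, 1] 2 [1, 2, 2, 2], Centre
      [1, 2, 2, 2] 2 [1, 1, 2, 2, 1], Centre [1, 1, 2, 2, 2, 2] 2 [1, 2, 2, 2, 1]]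
     [[1, 1, 2, 1], [1, 1, 2, 1, 2, 2, 2, 1, 2, 1, 1, 2], [1, 1, 2, 1, 2, 2], [2, 2, 1, 2, 1, 1, 2,
      2]]
     [[Node [Leaf [] [1, 1, 2, 1], Node [Leaf [] [1, 1, 2, 1, 2, 2, 2, 1, 2, 1, 1, 2], Node [Leaf []
      [1, 1, 2, 1, 2, 2], Node [Node [Leaf [] [2, 2, 1, 2, 1, 1, 2, 2], Node [Node [Node [Dead, Node
      [Leaf [] [2, 2, 1, 2, 1, 1, 2, 2], Node [Dead, Node [Leaf [] [2, 2, 1, 2, 1, 1, 2, 2],
      Dead]]]], Dead], Leaf [] [2, 2, 1, 2, 1, 1, 2, 2]]], Leaf [] [2, 2, 1, 2, 1, 1, 2, 2]]]]]],
      []]"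
  by code_simp

lemma orbit_5:
  "orbit_ok (5, 14) 16 (56, 153) 2 (343363, 104272) (1169, 355)
     [2, 1, 1, 2, 2, 2, 2, 1, 2, 1, 1, 2, 2, 2, 2, 1, 1, 1, 2, 1, 1, 1, 2, 1, 1, 1, 2, 1, 1, 1, 2,
      1, 1, 1, 2, 1, 1, 1, 2, 1, 1, 1, 2, 1, 1, 1, 2, 1, 1, 1, 2, 1, 1, 1, 2, 2, 2, 2, 1, 1, 2, 1,
      2, 2, 2, 2, 1, 1, 2, 1, 2, 2, 2, 2, 2, 1, 2, 1, 1, 2, 2, 2, 2, 1, 1, 2, 1, 2, 2, 1, 1, 2, 1,
      2, 2, 1, 1, 2, 1, 2, 2, 1, 1, 2, 1, 2, 2, 1, 1, 2, 1, 2, 2, 1, 1, 2, 1, 2, 2, 1, 1, 2, 1, 2,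
      2, 1, 2, 2, 2, 2, 1, 1, 2, 1, 2, 2, 2, 2, 1, 1, 2, 1, 2, 2, 2, 2, 1, 1, 2, 1, 2, 2, 2, 2, 1,
      1, 2, 1, 2, 2, 2, 2, 1, 1, 2, 1, 2, 2, 2, 2, 1, 2, 2, 2, 1, 2, 1, 1, 2, 1, 1, 2, 1, 2, 2, 2,
      1, 2, 1, 1, 2, 1, 1, 2, 1, 2, 2, 2, 1, 2, 1, 1, 2, 1, 1, 2, 1, 2, 2, 2, 1, 2, 1, 1, 2, 1, 1,
      2, 1, 2, 2, 2, 1, 2, 2, 2, 2, 1, 2, 1, 1, 2, 2, 2, 2, 1, 2, 1, 1, 2, 2, 2, 2, 1, 2, 1, 1, 2,
      2, 2, 2, 1, 2, 1, 1, 2, 2, 2, 2, 1, 2, 1, 1, 2, 2, 2, 2, 1, 2, 2, 1, 2, 1, 1, 2, 2, 1, 2, 1,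
      1, 2, 2, 1, 2, 1, 1, 2, 2, 1, 2, 1, 1, 2, 2, 1, 2, 1, 1, 2, 2, 1, 2, 1, 1, 2, 2, 1, 2, 1, 1,
      2, 2, 2, 2, 1, 1, 2, 1, 2, 2, 2, 2, 2, 1] 69
     [[1, 1, 2, 1], [1, 1, 2, 1, 2, 2, 2, 1, 2, 1, 1, 2], [1, 1, 2, 1, 2, 2], [2, 2, 1, 2, 1, 1, 2,
      2]]
     [16, 179, 83, 225]"
  by code_simp

lemma connect_6:
  "connect_ok (5, 10) 18 (56, 153) 2 [1, 2] (2526, 767) (517, 157)
     [Centre [1, 1, 1] 2 [1, 2], Centre [1, 2, 1] 2 [1], Centre [1, 2] 2 [1, 2], Centre [1, 2] 2 [1,
      1, 1], Centre [1, 2, 2, 2] 2 [1, 1, 2, 2, 1], Centre [1, 2, 2, 2, 1, 2] 2 [1, 1, 2, 2, 2, 1,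
      1], Centre [1, 2, 2, 2, 1, 2, 1] 2 [1, 1, 2, 2, 2, 1, 2, 1, 1, 2], Ext [1, 1, 2, 1, 2, 2, 2,
      1, 1, 2, 1, 2, 2, 2, 1, 2, 1], Ext [1, 2, 1, 2, 2, 2, 1, 1, 2, 1, 2, 2, 2, 1, 2, 1], Centre
      [1, 2, 2, 2, 1, 2, 1] 2 [1, 1, 2, 2, 2, 1, 2, 2], Ext [2, 1, 2, 2, 2, 1, 1, 2, 1, 2, 2, 2, 1,
      2, 1], Ext [1, 2, 2, 2, 1, 1, 2, 1, 2, 2, 2, 1, 2, 1], Centre [1, 2, 2, 2, 1, 2] 2 [1, 1, 2,
      2, 2, 2], Ext [2, 2, 2, 1, 1, 2, 1, 2, 2, 2, 1, 2, 1], Ext [2, 2, 1, 1, 2, 1, 2, 2, 2, 1, 2,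
      1]]
     [[1, 1, 2, 1], [1, 1, 2, 1, 2, 2, 2, 1, 2, 1, 1, 2], [2, 2, 1, 2, 1, 1, 2, 2]]
     [[Node [Leaf [] [1, 1, 2, 1], Node [Leaf [] [1, 1, 2, 1, 2, 2, 2, 1, 2, 1, 1, 2], Leaf [] [2,
      2, 1, 2, 1, 1, 2, 2]]]], []]"
  by code_simp

lemma orbit_6:
  "orbit_ok (5, 7) 5 (56, 153) 2 (517, 157) (4337, 1317)
     [2, 1, 1, 2, 2, 2, 1, 2, 1, 1, 2, 1, 1, 2, 1, 2, 2, 2, 1, 2, 1, 1, 2, 1, 1, 2, 1, 2, 2, 2, 1,
      2, 1, 1, 2, 1, 1, 2, 1, 2, 2, 2, 1, 1, 2, 1, 2, 2, 2, 1, 1, 2, 1, 1, 2, 1, 2, 2, 2, 2, 1, 1,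
      2, 1, 2, 2, 2, 2, 1, 1, 2, 1, 2, 2, 2, 2, 1, 1, 1, 2, 1, 1, 1, 2, 1, 1, 1, 2, 1, 1, 1, 2, 1,
      1, 1, 2, 2, 2, 2, 1, 2, 1, 1, 2, 2, 2, 2, 1, 2, 1, 1, 2, 2, 2, 2, 1, 2, 1, 1, 2, 1, 1, 2, 2,
      2, 1] 45
     [[1, 1, 2, 1], [1, 1, 2, 1, 2, 2, 2, 1, 2, 1, 1, 2], [2, 2, 1, 2, 1, 1, 2, 2]]
     [77, 11, 97]"
  by code_simp

lemma connect_7:
  "connect_ok (5, 10) 16 (56, 153) 2 [1, 2] (3138, 941) (12429, 3728)
     [Centre [1, 1, 1, 1, 1] 2 [1, 2, 1], Centre [1, 2] 2 [1, 2], Centre [1, 2, 2, 2] 2 [1, 1, 1,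
      2], Centre [1, 2] 2 [1, 1, 1, 2, 1], Centre [1, 2, 2, 1, 1, 2] 2 [1, 1, 1, 2, 2, 1, 1], Centre
      [1, 2, 2, 1, 1, 2] 2 [1, 1, 1, 2, 2, 1, 2, 1, 1], Ext [1, 2, 1, 2, 2, 1, 1, 1, 2, 1, 2, 2, 1,
      1, 2], Centre [1, 2, 2, 1, 1, 2] 2 [1, 1, 1, 2, 2, 1, 2, 2], Ext [2, 1, 2, 2, 1, 1, 1, 2, 1,
      2, 2, 1, 1, 2], Ext [1, 2, 2, 1, 1, 1, 2, 1, 2, 2, 1, 1, 2], Centre [1, 2, 2, 1, 1, 2] 2 [1,
      1, 1, 2, 2, 2], Ext [2, 2, 1, 1, 1, 2, 1, 2, 2, 1, 1, 2], Ext [2, 1, 1, 1, 2, 1, 2, 2, 1, 1,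
      2]]
     [[1, 1, 2, 1, 2, 2, 2, 1, 2, 1, 1, 1], [2, 2, 1, 2, 1, 1, 1, 1, 1, 2, 1, 2], [1, 2, 2, 2, 1, 2,
      1, 1, 1, 1, 1, 2]]
     [[Node [Node [Node [Leaf [] [1, 1, 2, 1, 2, 2, 2, 1, 2, 1, 1, 1], Leaf [] [2, 2, 1, 2, 1, 1, 1,
      1, 1, 2, 1, 2]], Node [Leaf [2, 2, 1, 2, 1, 1] [1, 2, 2, 2, 1, 2, 1, 1, 1, 1, 1, 2], Node
      [Node [Leaf [2, 2, 1, 2, 1, 1] [1, 2, 2, 2, 1, 2, 1, 1, 1, 1, 1, 2], Node [Node [Leaf [2, 2,
      1, 2, 1, 1] [1, 2, 2, 2, 1, 2, 1, 1, 1, 1, 1, 2], Dead], Leaf [2, 2, 1, 2, 1, 1] [1, 2, 2, 2,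
      1, 2, 1, 1, 1, 1, 1, 2]]], Leaf [2, 2, 1, 2, 1, 1] [1, 2, 2, 2, 1, 2, 1, 1, 1, 1, 1, 2]]]],
      Leaf [] [2, 2, 1, 2, 1, 1, 1, 1, 1, 2, 1, 2]]], []]"
  by code_simp

lemma orbit_7:
  "orbit_ok (5, 12) 16 (56, 153) 2 (12429, 3728) (5321, 1596)
     [2, 1, 2, 1, 1, 2, 1, 2, 1, 1, 1, 1, 2, 1, 1, 1, 1, 1, 2, 1, 2, 2, 2, 1, 2, 1, 1, 1, 1, 1, 2,
      1, 2, 2, 2, 1, 2, 1, 1, 1, 1, 1, 2, 1, 2, 2, 2, 1, 2, 1, 1, 1, 1, 1, 2, 1, 2, 2, 2, 1, 2, 1,
      1, 1, 1, 1, 2, 1, 1, 1, 1, 2, 1, 2, 1, 1, 2, 1, 2, 1, 1, 1, 1, 2, 2, 1, 2, 1, 1, 2, 1, 1, 1,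
      1, 1, 2, 1, 2, 2, 2, 1, 2, 1, 1, 1, 1, 1, 2, 1, 2, 2, 2, 1, 2, 1, 1, 1, 1, 1, 2, 1, 2, 2, 2,
      1, 2, 1, 1, 1, 1, 1, 2, 1, 2, 2, 2, 1, 2, 1, 1, 1, 1, 1, 2, 1, 1, 2, 1, 2, 2, 1, 1, 1, 1] 79
     [[1, 1, 2, 1, 2, 2, 2, 1, 2, 1, 1, 1], [2, 2, 1, 2, 1, 1, 1, 1, 1, 2, 1, 2], [1, 2, 2, 2, 1, 2,
      1, 1, 1, 1, 1, 2]]
     [16, 21, 19]"
  by code_simp

text \<open>One forbidden word suffices here: 1 2 1 2 1 2, whose large value is at its fourth
  digit.\<close>

lemma connect_8:
  "connect_ok (5, 8) 8 (56, 153) 2 [1, 2] (89, 26) (309, 92)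
     [Centre [1, 2, 1] 2 [1, 2]]
     [[1, 1, 2, 1, 2, 1]]
     [[Node [Node [Leaf [] [1, 1, 2, 1, 2, 1], Node [Node [Leaf [] [1, 1, 2, 1, 2, 1], Node [Dead,
      Leaf [] [1, 1, 2, 1, 2, 1]]], Leaf [] [1, 1, 2, 1, 2, 1]]], Leaf [] [1, 1, 2, 1, 2, 1]]], []]"
  by code_simp

lemma orbit_8:
  "orbit_ok (4, 4) 10 (56, 153) 2 (309, 92) (131, 39)
     [2, 1, 2, 1, 1, 1] 3
     [[1, 1, 2, 1, 2, 1]]
     [4]"
  by code_simp

section \<open>Certificates over the digits 1, 2, 3, which serve levels up to 22/5\<close>

lemma connect_9:
  "connect_ok (5, 5) 7 (24, 91) 3 [1, 2, 3] (127, 33) (7, 2)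
     [Centre [1, 1, 1] 3 [], Centre [1, 2] 3 [], Centre [1] 3 [1], Centre [1] 3 [2], Centre [1, 1,
      2] 3 [3, 1, 1], Centre [] 3 [1, 2], Centre [1, 3] 3 [], Ext [1, 3, 3, 1, 1, 2], Centre [1] 3
      [3, 2], Centre [1] 3 [3, 3], Ext [3, 3, 1, 1, 2], Ext [3, 1, 1, 2], Centre [2] 3 [1], Centre
      [3, 2] 3 [1], Centre [3, 3] 3 [1]]
     [[1, 2], [2, 1]]
     [[Node [Leaf [1] [1, 2], Leaf [1] [1, 2], Node [Dead, Dead, Node [Dead, Dead, Dead]]], Leaf [2]
      [2, 1]], [Node [Node [Leaf [] [2, 1], Dead, Dead], Leaf [] [2, 1], Leaf [] [2, 1]]], []]"
  by code_simp

text \<open>For the first digits 1 and 3 the leaf begins with 2, strictly between them, so no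
  deviation has to be excluded. The forbidden words are needed for the neighbouring pairs.\<close>

lemma connect_10:
  "connect_ok (5, 11) 23 (24, 91) 3 [1, 2, 3] (18942, 4819) (11282, 2913)
     [Centre [2, 1, 1] 3 [1], Centre [2, 3] 3 [1], Centre [2] 3 [1, 1, 1], Centre [2] 3 [1, 1, 2],
      Centre [1] 3 [1], Centre [2, 1, 2, 1, 1] 3 [1, 1, 3, 2, 1], Centre [1] 3 [2, 2], Centre [1] 3
      [2, 3], Ext [2, 3, 1, 1, 3, 2, 1, 2, 1, 1], Centre [2, 1, 2] 3 [1, 1, 3, 3], Ext [3, 1, 1, 3,
      2, 1, 2, 1, 1], Ext [1, 1, 3, 2, 1, 2, 1, 1], Centre [] 3 [1, 2], Centre [1, 3] 3 [], Ext [1,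
      3, 2, 1, 2, 1, 1], Centre [1] 3 [2, 1, 1], Centre [2, 1, 2, 1, 2, 1, 1] 3 [1, 1, 3, 2, 1, 2,
      1], Centre [1, 1, 3, 2] 3 [2, 1, 2, 2], Centre [1, 1, 3, 2] 3 [2, 1, 2, 3], Ext [2, 1, 2, 3,
      1, 1, 3, 2, 1, 2, 1, 2, 1, 1], Centre [1, 2] 3 [], Ext [1, 2, 3, 1, 1, 3, 2, 1, 2, 1, 2, 1,
      1], Ext [2, 3, 1, 1, 3, 2, 1, 2, 1, 2, 1, 1], Ext [3, 1, 1, 3, 2, 1, 2, 1, 2, 1, 1], Ext [1,
      1, 3, 2, 1, 2, 1, 2, 1, 1], Ext [1, 3, 2, 1, 2, 1, 2, 1, 1], Centre [1, 1, 3, 2, 1] 3 [2, 1,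
      2, 1, 1], Centre [1, 1, 3, 2, 1, 2, 1] 3 [2, 1, 2, 1, 2, 1, 1], Centre [1, 1, 3, 2, 1, 2, 1,
      2, 1] 3 [2, 1, 2, 1, 2, 1, 2, 1, 1], Centre [1, 1, 3, 2, 1, 2, 1, 2, 1, 2] 3 [2, 1, 2, 1, 2,
      1, 2, 1, 2, 1, 1], Centre [1, 1, 3, 2, 1, 2, 1, 2, 1, 2, 1] 3 [2, 1, 2, 1, 2, 1, 2, 1, 2, 1,
      2], Ext [1, 2, 1, 2, 1, 2, 1, 2, 1, 2, 3, 1, 1, 3, 2, 1, 2, 1, 2, 1, 2, 1], Centre [1, 1, 3,
      2, 1, 2, 1, 2, 1, 2] 3 [2, 1, 2, 1, 2, 1, 2, 1, 2, 2], Centre [1, 1, 3, 2, 1, 2, 1, 2, 1, 2] 3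
      [2, 1, 2, 1, 2, 1, 2, 1, 2, 3], Ext [2, 1, 2, 1, 2, 1, 2, 1, 2, 3, 1, 1, 3, 2, 1, 2, 1, 2, 1,
      2, 1], Ext [1, 2, 1, 2, 1, 2, 1, 2, 3, 1, 1, 3, 2, 1, 2, 1, 2, 1, 2, 1], Centre [1, 1, 3, 2,
      1, 2, 1, 2] 3 [2, 1, 2, 1, 2, 1, 2, 2], Centre [1, 1, 3, 2, 1, 2, 1, 2] 3 [2, 1, 2, 1, 2, 1,
      2, 3], Ext [2, 1, 2, 1, 2, 1, 2, 3, 1, 1, 3, 2, 1, 2, 1, 2, 1, 2, 1], Ext [1, 2, 1, 2, 1, 2,
      3, 1, 1, 3, 2, 1, 2, 1, 2, 1, 2, 1], Centre [1, 1, 3, 2, 1, 2] 3 [2, 1, 2, 1, 2, 2], Centre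
      [1, 1, 3, 2, 1, 2] 3 [2, 1, 2, 1, 2, 3], Ext [2, 1, 2, 1, 2, 3, 1, 1, 3, 2, 1, 2, 1, 2, 1, 2,
      1], Ext [1, 2, 1, 2, 3, 1, 1, 3, 2, 1, 2, 1, 2, 1, 2, 1], Ext [2, 1, 2, 3, 1, 1, 3, 2, 1, 2,
      1, 2, 1, 2, 1], Ext [1, 2, 3, 1, 1, 3, 2, 1, 2, 1, 2, 1, 2, 1], Ext [2, 3, 1, 1, 3, 2, 1, 2,
      1, 2, 1, 2, 1], Ext [3, 1, 1, 3, 2, 1, 2, 1, 2, 1, 2, 1], Ext [1, 1, 3, 2, 1, 2, 1, 2, 1, 2,
      1], Ext [1, 3, 2, 1, 2, 1, 2, 1, 2, 1], Centre [2, 1, 2, 1, 2, 1, 2, 2] 3 [1, 1, 3, 2, 1, 2,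
      1, 2], Ext [1, 2, 1, 2, 3, 1, 1, 3, 2, 1, 2, 1, 2, 1, 2, 2], Ext [2, 1, 2, 3, 1, 1, 3, 2, 1,
      2, 1, 2, 1, 2, 2], Ext [1, 2, 3, 1, 1, 3, 2, 1, 2, 1, 2, 1, 2, 2], Ext [2, 3, 1, 1, 3, 2, 1,
      2, 1, 2, 1, 2, 2], Ext [3, 1, 1, 3, 2, 1, 2, 1, 2, 1, 2, 2], Ext [1, 1, 3, 2, 1, 2, 1, 2, 1,
      2, 2], Ext [1, 3, 2, 1, 2, 1, 2, 1, 2, 2], Centre [2, 1, 2, 1, 2, 1, 2, 3] 3 [1, 1, 3, 2, 1,
      2, 1, 2], Ext [1, 2, 1, 2, 3, 1, 1, 3, 2, 1, 2, 1, 2, 1, 2, 3], Ext [2, 1, 2, 3, 1, 1, 3, 2,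
      1, 2, 1, 2, 1, 2, 3], Ext [1, 2, 3, 1, 1, 3, 2, 1, 2, 1, 2, 1, 2, 3], Ext [2, 3, 1, 1, 3, 2,
      1, 2, 1, 2, 1, 2, 3], Ext [3, 1, 1, 3, 2, 1, 2, 1, 2, 1, 2, 3], Ext [1, 1, 3, 2, 1, 2, 1, 2,
      1, 2, 3], Ext [1, 3, 2, 1, 2, 1, 2, 1, 2, 3], Centre [2, 1, 2, 1, 2, 2] 3 [1, 1, 3, 2, 1, 2],
      Ext [1, 2, 3, 1, 1, 3, 2, 1, 2, 1, 2, 2], Ext [2, 3, 1, 1, 3, 2, 1, 2, 1, 2, 2], Ext [3, 1, 1,
      3, 2, 1, 2, 1, 2, 2], Ext [1, 1, 3, 2, 1, 2, 1, 2, 2], Ext [1, 3, 2, 1, 2, 1, 2, 2], Centre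
      [2, 1, 2, 1, 2, 3] 3 [1, 1, 3, 2, 1, 2], Ext [1, 2, 3, 1, 1, 3, 2, 1, 2, 1, 2, 3], Ext [2, 3,
      1, 1, 3, 2, 1, 2, 1, 2, 3], Ext [3, 1, 1, 3, 2, 1, 2, 1, 2, 3], Ext [1, 1, 3, 2, 1, 2, 1, 2,
      3], Ext [1, 3, 2, 1, 2, 1, 2, 3], Centre [2, 1, 2, 2] 3 [1, 1, 3, 2], Ext [3, 1, 1, 3, 2, 1,
      2, 2], Ext [1, 1, 3, 2, 1, 2, 2], Ext [1, 3, 2, 1, 2, 2], Centre [2, 1, 2, 3] 3 [1, 1, 3, 2],
      Ext [3, 1, 1, 3, 2, 1, 2, 3], Ext [1, 1, 3, 2, 1, 2, 3], Ext [1, 3, 2, 1, 2, 3], Centre [2, 2]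
      3 [1]]
     [[2, 3], [2, 1]]
     [[Node [Node [Leaf [] [2, 3], Node [Node [Leaf [] [2, 3], Node [Node [Leaf [] [2, 3], Node
      [Leaf [] [2, 3], Leaf [] [2, 3], Leaf [] [2, 3]], Dead], Leaf [] [2, 3], Leaf [] [2, 3]],
      Dead], Leaf [] [2, 3], Leaf [] [2, 3]], Dead], Leaf [] [2, 3], Node [Dead, Node [Leaf [] [2,
      3], Dead, Dead], Leaf [] [2, 3]]], Leaf [] [2, 1]], [Leaf [] [2, 1]], []]"
  by code_simp

text \<open>The orbit of 2 3 has the value sqrt 15 = 3.87298..., which lies between
  \<open>th\<close> and \<open>X\<close>; the long blocks of 2 3 around the first digit bring its
  value up to \<open>th\<close>.\<close>

lemma orbit_10:
  "orbit_ok (5, 7) 9 (24, 91) 3 (11282, 2913) (2409, 622)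
     [3, 2, 3, 2, 3, 2, 3, 2, 3, 2, 2, 3, 2, 3, 2, 3, 2, 3, 2, 3, 2, 3, 2, 3, 2, 3, 2, 1, 2, 1, 2,
      1, 2, 1, 2, 1, 2, 1, 2, 1, 2, 1, 2, 1, 2, 3, 2, 3, 2, 3, 2, 3, 2, 3, 2, 3, 2, 3, 2, 3, 2, 2,
      3, 2, 3, 2, 3, 2, 3, 2] 1
     [[2, 3], [2, 1]]
     [10, 26]"
  by code_simp

lemma connect_11:
  "connect_ok (5, 11) 15 (24, 91) 3 [1, 2, 3] (6119, 1554) (73618, 18703)
     [Centre [2] 3 [1, 1, 1], Centre [2, 1, 1] 3 [1, 1, 2], Centre [1] 3 [1], Centre [2, 1, 1] 3 [1,
      1, 3, 2], Centre [2, 1, 1] 3 [1, 1, 3, 3], Ext [3, 1, 1, 3, 2, 1, 1], Ext [1, 1, 3, 2, 1, 1],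
      Centre [] 3 [1, 2], Centre [1, 3] 3 [], Ext [1, 3, 2, 1, 1], Centre [2, 3] 3 [1], Centre [2,
      1, 2] 3 [1, 1, 2], Centre [1, 1, 1] 3 [2], Centre [1, 1, 1, 3] 3 [3, 3], Centre [1, 2] 3 [],
      Centre [3, 3] 3 [1, 1, 1, 3], Centre [3, 3, 1, 1, 1] 3 [1, 1, 1, 2, 1, 1, 1], Centre [3, 3, 1,
      1, 1, 2] 3 [1, 1, 1, 2, 1, 1, 2], Centre [1, 1, 2, 1, 1] 3 [2], Centre [3, 3, 1, 1, 1, 2] 3
      [1, 1, 1, 2, 1, 1, 3, 3], Ext [3, 1, 1, 2, 1, 1, 1, 3, 3, 3, 1, 1, 1, 2], Ext [1, 1, 2, 1, 1,
      1, 3, 3, 3, 1, 1, 1, 2], Centre [3, 3, 1] 3 [1, 1, 1, 2, 1, 2], Ext [1, 2, 1, 1, 1, 3, 3, 3,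
      1, 1, 1, 2], Centre [2, 2] 3 [1]]
     [[2, 3], [2, 1]]
     [[Node [Node [Leaf [] [2, 3], Node [Leaf [2, 3, 1, 1, 3, 3, 1, 1, 1, 3, 3] [2, 1], Node [Node
      [Leaf [2, 3, 1, 1, 3, 3, 1, 1, 1, 3, 3] [2, 1], Node [Leaf [1, 1, 3, 3, 3, 1, 1, 1, 2] [2, 3],
      Leaf [1, 1, 3, 3, 3, 1, 1, 1, 2] [2, 3], Leaf [2, 3, 1, 1, 3, 3, 1, 1, 1, 3, 3] [2, 1]],
      Dead], Leaf [2, 3, 1, 1, 3, 3, 1, 1, 1, 3, 3] [2, 1], Leaf [2, 3, 1, 1, 3, 3, 1, 1, 1, 3, 3]
      [2, 1]], Leaf [1, 1, 3, 3, 3, 1, 1, 1, 2] [2, 3]], Dead], Leaf [] [2, 3], Leaf [] [2, 3]],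
      Leaf [] [2, 1]], [Leaf [] [2, 1]], []]"
  by code_simp

lemma orbit_11:
  "orbit_ok (5, 11) 13 (24, 91) 3 (73618, 18703) (24601, 6250)
     [3, 1, 1, 1, 2, 2, 3, 2, 3, 2, 2, 3, 2, 1, 2, 1, 2, 1, 2, 1, 2, 1, 2, 1, 2, 1, 2, 1, 2, 1, 2,
      1, 2, 1, 2, 1, 2, 1, 2, 3, 2, 2, 3, 2, 3, 2, 2, 1, 1, 1, 3, 3, 3, 1, 1, 1, 2, 2, 1, 2, 3, 1,
      1, 3, 3, 2, 3, 2, 3, 2, 3, 2, 3, 2, 3, 2, 3, 2, 3, 2, 3, 2, 3, 2, 3, 2, 3, 2, 3, 2, 3, 3, 1,
      1, 3, 2, 1, 2, 2, 1, 1, 1, 3, 3] 51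
     [[2, 3], [2, 1]]
     [65, 12]"
  by code_simp

lemma connect_12:
  "connect_ok (5, 8) 14 (24, 91) 3 [1, 2, 3] (1872, 475) (13919, 3535)
     [Centre [2] 3 [1, 1, 1], Centre [2, 1, 1] 3 [1, 1, 2], Centre [1] 3 [1], Centre [2, 1, 1] 3 [1,
      1, 3, 2], Centre [2, 1, 1] 3 [1, 1, 3, 3], Ext [3, 1, 1, 3, 2, 1, 1], Ext [1, 1, 3, 2, 1, 1],
      Centre [] 3 [1, 2], Centre [1, 3] 3 [], Ext [1, 3, 2, 1, 1], Centre [2, 3] 3 [1], Centre [2,
      1, 2] 3 [1, 1, 2], Centre [1, 1, 1] 3 [2], Centre [1, 1, 1, 3] 3 [3, 3, 1], Centre [1, 1, 1,
      3] 3 [3, 3, 2], Centre [1, 1, 1, 3, 3, 1, 1, 3] 3 [3, 3, 3, 1, 1], Ext [1, 3, 3, 3, 3, 1, 1,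
      1, 3, 3, 1, 1, 3], Centre [1, 1, 1, 3] 3 [3, 3, 3, 2], Centre [1, 1, 1, 3] 3 [3, 3, 3, 3], Ext
      [3, 3, 3, 3, 1, 1, 1, 3, 3, 1, 1, 3], Ext [3, 3, 3, 1, 1, 1, 3, 3, 1, 1, 3], Centre [1, 2] 3
      [], Centre [2, 2] 3 [1]]
     [[2, 3], [2, 1]]
     [[Node [Node [Leaf [] [2, 3], Leaf [2, 3, 1, 1, 3, 3, 1, 1, 1, 3, 3] [2, 1], Dead], Leaf [] [2,
      3], Leaf [] [2, 3]], Leaf [] [2, 1]], [Leaf [] [2, 1]], []]"
  by code_simp

lemma orbit_12:
  "orbit_ok (5, 8) 9 (24, 91) 3 (13919, 3535) (63, 16)
     [3, 1, 1, 1, 2, 1, 2, 3, 3, 2, 1, 2, 1, 2, 1, 2, 1, 2, 1, 2, 1, 2, 1, 2, 1, 2, 1, 2, 1, 2, 3,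
      3, 2, 1, 2, 1, 1, 1, 3, 3, 3, 2, 3, 2, 1, 1, 2, 3, 2, 3, 2, 3, 2, 3, 2, 3, 2, 3, 2, 3, 2, 3,
      2, 3, 2, 3, 2, 1, 1, 2, 3, 2, 3, 3] 39
     [[2, 3], [2, 1]]
     [46, 9]"
  by code_simp

lemma connect_13:
  "connect_ok (5, 10) 19 (24, 91) 3 [1, 2, 3] (5675, 1439) (197, 50)
     [Centre [2] 3 [1, 1, 1], Centre [2, 1, 1] 3 [1, 1, 2], Centre [1] 3 [1], Centre [2, 1, 1, 1, 1]
      3 [1, 1, 3, 2], Centre [2, 1, 1] 3 [1, 1, 3, 3], Ext [3, 1, 1, 3, 2, 1, 1, 1, 1], Ext [1, 1,
      3, 2, 1, 1, 1, 1], Centre [] 3 [1, 2], Centre [1, 3] 3 [], Ext [1, 3, 2, 1, 1, 1, 1], Centre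
      [2, 3] 3 [1], Centre [2, 1, 1, 1, 2] 3 [1, 1, 3, 2, 1], Centre [1] 3 [2, 2], Centre [1] 3 [2,
      3], Ext [2, 3, 1, 1, 3, 2, 1, 1, 1, 2], Ext [3, 1, 1, 3, 2, 1, 1, 1, 2], Ext [1, 1, 3, 2, 1,
      1, 1, 2], Ext [1, 3, 2, 1, 1, 1, 2], Centre [1, 1, 1] 3 [2], Centre [3, 3, 1, 1, 1, 1, 1, 3] 3
      [1, 1, 1, 3, 3, 1, 1, 1, 1], Centre [3, 3, 1, 1, 1, 1, 1, 3] 3 [1, 1, 1, 3, 3, 1, 1, 1, 2],
      Centre [3, 3, 1, 1, 1, 1, 1, 3] 3 [1, 1, 1, 3, 3, 1, 1, 1, 3, 3], Ext [3, 1, 1, 1, 3, 3, 1, 1,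
      1, 3, 3, 3, 1, 1, 1, 1, 1, 3], Ext [1, 1, 1, 3, 3, 1, 1, 1, 3, 3, 3, 1, 1, 1, 1, 1, 3], Centre
      [3, 3, 1, 1, 1, 1, 1, 3] 3 [1, 1, 1, 3, 3, 1, 1, 2], Centre [3, 3, 1, 1, 1, 1, 1] 3 [1, 1, 1,
      3, 3, 1, 1, 3], Ext [1, 1, 3, 3, 1, 1, 1, 3, 3, 3, 1, 1, 1, 1, 1, 3], Ext [1, 3, 3, 1, 1, 1,
      3, 3, 3, 1, 1, 1, 1, 1, 3], Centre [3, 3, 1, 1, 1] 3 [1, 1, 1, 3, 3, 2], Centre [3, 3, 1, 1,
      1] 3 [1, 1, 1, 3, 3, 3], Ext [3, 3, 1, 1, 1, 3, 3, 3, 1, 1, 1, 1, 1, 3], Ext [3, 1, 1, 1, 3,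
      3, 3, 1, 1, 1, 1, 1, 3], Centre [1, 2] 3 [], Centre [2, 1, 1, 2] 3 [1], Centre [2, 1, 1, 3] 3
      [1], Centre [3, 3, 1, 1, 1, 2] 3 [1, 1, 1, 3, 3, 1, 1], Ext [1, 3, 3, 1, 1, 1, 3, 3, 3, 1, 1,
      1, 2], Ext [3, 3, 1, 1, 1, 3, 3, 3, 1, 1, 1, 2], Ext [3, 1, 1, 1, 3, 3, 3, 1, 1, 1, 2], Centre
      [2, 2] 3 [1]]
     [[2, 3], [1, 2], [2, 1]]
     [[Node [Node [Node [Node [Leaf [] [2, 3], Leaf [] [2, 3], Leaf [1, 1, 3, 3, 3, 1, 1] [1, 2]],
      Leaf [] [2, 3], Leaf [] [2, 3]], Leaf [1, 1, 3, 3, 3, 1, 1] [1, 2], Dead], Leaf [] [2, 3],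
      Leaf [] [2, 3]], Leaf [] [2, 1]], [Leaf [] [2, 1]], []]"
  by code_simp

lemma orbit_13:
  "orbit_ok (5, 8) 5 (24, 91) 3 (197, 50) (1738, 441)
     [3, 1, 1, 1, 3, 3, 1, 1, 1, 1, 2, 1, 2, 1, 2, 1, 2, 1, 2, 1, 2, 1, 2, 1, 2, 1, 2, 1, 2, 1, 1,
      1, 1, 3, 3, 1, 1, 1, 3, 3, 3, 3, 1, 1, 1, 2, 2, 3, 2, 3, 2, 3, 2, 3, 2, 3, 2, 3, 2, 3, 2, 3,
      2, 3, 2, 3, 2, 2, 1, 1, 1, 3, 3, 3] 39
     [[2, 3], [1, 2], [2, 1]]
     [46, 9, 10]"
  by code_simp

lemma connect_14:
  "connect_ok (5, 10) 21 (24, 91) 3 [1, 2, 3] (4208, 1067) (2311, 586)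
     [Centre [2] 3 [1, 1, 1], Centre [2, 1, 1] 3 [1, 1, 2], Centre [1] 3 [1], Centre [2, 1, 1, 1, 1]
      3 [1, 1, 3, 2], Centre [2, 1, 1] 3 [1, 1, 3, 3], Ext [3, 1, 1, 3, 2, 1, 1, 1, 1], Ext [1, 1,
      3, 2, 1, 1, 1, 1], Centre [] 3 [1, 2], Centre [1, 3] 3 [], Ext [1, 3, 2, 1, 1, 1, 1], Centre
      [2, 3] 3 [1], Centre [2, 1, 1, 1, 2] 3 [1, 1, 3, 2, 1], Centre [1] 3 [2, 2], Centre [1] 3 [2,
      3], Ext [2, 3, 1, 1, 3, 2, 1, 1, 1, 2], Ext [3, 1, 1, 3, 2, 1, 1, 1, 2], Ext [1, 1, 3, 2, 1,
      1, 1, 2], Ext [1, 3, 2, 1, 1, 1, 2], Centre [1, 2] 3 [], Centre [2, 1, 1, 2] 3 [1], Centre [2,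
      1, 1, 3] 3 [1], Centre [1, 1, 1] 3 [2], Centre [3, 3, 1, 1, 1, 2, 1] 3 [1, 1, 1, 3, 3, 1, 1],
      Ext [1, 3, 3, 1, 1, 1, 3, 3, 3, 1, 1, 1, 2, 1], Centre [3, 3, 1, 1, 1, 2] 3 [1, 1, 1, 3, 3,
      2], Centre [3, 3, 1, 1, 1] 3 [1, 1, 1, 3, 3, 3], Ext [3, 3, 1, 1, 1, 3, 3, 3, 1, 1, 1, 2, 1],
      Ext [3, 1, 1, 1, 3, 3, 3, 1, 1, 1, 2, 1], Centre [3, 3, 1, 1, 1, 2, 2] 3 [1, 1, 1, 3, 3, 1,
      1], Ext [1, 3, 3, 1, 1, 1, 3, 3, 3, 1, 1, 1, 2, 2], Ext [3, 3, 1, 1, 1, 3, 3, 3, 1, 1, 1, 2,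
      2], Ext [3, 1, 1, 1, 3, 3, 3, 1, 1, 1, 2, 2], Centre [1, 1, 2] 3 [2, 1, 1], Centre [3, 3, 1,
      1, 1, 2] 3 [1, 1, 1, 3, 3, 1, 1, 1, 1], Centre [3, 3, 1, 1, 1, 2] 3 [1, 1, 1, 3, 3, 1, 1, 1,
      2], Centre [3, 3, 1, 1, 1, 2, 3, 1, 1, 3] 3 [1, 1, 1, 3, 3, 1, 1, 1, 3, 3], Ext [3, 1, 1, 1,
      3, 3, 1, 1, 1, 3, 3, 3, 1, 1, 1, 2, 3, 1, 1, 3], Ext [1, 1, 1, 3, 3, 1, 1, 1, 3, 3, 3, 1, 1,
      1, 2, 3, 1, 1, 3], Centre [3, 3, 1, 1, 1, 2] 3 [1, 1, 1, 3, 3, 1, 1, 2], Centre [3, 3, 1, 1,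
      1, 2] 3 [1, 1, 1, 3, 3, 1, 1, 3], Ext [1, 1, 3, 3, 1, 1, 1, 3, 3, 3, 1, 1, 1, 2, 3, 1, 1, 3],
      Ext [1, 3, 3, 1, 1, 1, 3, 3, 3, 1, 1, 1, 2, 3, 1, 1, 3], Ext [3, 3, 1, 1, 1, 3, 3, 3, 1, 1, 1,
      2, 3, 1, 1, 3], Ext [3, 1, 1, 1, 3, 3, 3, 1, 1, 1, 2, 3, 1, 1, 3], Centre [3, 3, 1, 1, 1, 2,
      3, 2] 3 [1, 1, 1, 3, 3, 1, 1, 1, 3, 3], Ext [3, 1, 1, 1, 3, 3, 1, 1, 1, 3, 3, 3, 1, 1, 1, 2,
      3, 2], Ext [1, 1, 1, 3, 3, 1, 1, 1, 3, 3, 3, 1, 1, 1, 2, 3, 2], Ext [1, 1, 3, 3, 1, 1, 1, 3,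
      3, 3, 1, 1, 1, 2, 3, 2], Ext [1, 3, 3, 1, 1, 1, 3, 3, 3, 1, 1, 1, 2, 3, 2], Ext [3, 3, 1, 1,
      1, 3, 3, 3, 1, 1, 1, 2, 3, 2], Ext [3, 1, 1, 1, 3, 3, 3, 1, 1, 1, 2, 3, 2], Centre [3, 3, 1,
      1, 1, 2, 3, 3] 3 [1, 1, 1, 3, 3, 1, 1], Ext [1, 3, 3, 1, 1, 1, 3, 3, 3, 1, 1, 1, 2, 3, 3], Ext
      [3, 3, 1, 1, 1, 3, 3, 3, 1, 1, 1, 2, 3, 3], Ext [3, 1, 1, 1, 3, 3, 3, 1, 1, 1, 2, 3, 3],
      Centre [2, 2] 3 [1]]
     [[2, 3], [2, 1], [1, 2]]
     [[Node [Node [Node [Node [Leaf [] [2, 3], Leaf [] [2, 3], Leaf [2, 3, 1, 1, 3] [2, 1]], Leaf []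
      [2, 3], Leaf [] [2, 3]], Node [Leaf [1, 1, 3, 3, 3, 1, 1] [1, 2], Leaf [1, 1, 3, 3, 3, 1, 1]
      [1, 2], Node [Node [Node [Dead, Dead, Leaf [1, 1, 3, 3, 3, 1, 1] [1, 2]], Dead, Dead], Leaf
      [1, 1, 3, 3, 3, 1, 1] [1, 2], Leaf [1, 1, 3, 3, 3, 1, 1] [1, 2]]], Dead], Leaf [] [2, 3], Leaf
      [] [2, 3]], Leaf [] [2, 1]], [Leaf [] [2, 1]], []]"
  by code_simp

lemma orbit_14:
  "orbit_ok (5, 7) 8 (24, 91) 3 (2311, 586) (1191, 302)
     [3, 1, 1, 1, 3, 3, 3, 2, 1, 2, 1, 2, 1, 2, 1, 2, 1, 2, 1, 2, 1, 2, 1, 2, 1, 2, 1, 2, 3, 3, 3,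
      1, 1, 1, 3, 3, 3, 1, 1, 2, 3, 2, 3, 2, 3, 2, 3, 2, 3, 2, 3, 2, 3, 2, 3, 2, 3, 2, 3, 2, 3, 2,
      1, 1, 3, 3] 35
     [[2, 3], [2, 1], [1, 2]]
     [39, 7, 8]"
  by code_simp

lemma connect_15:
  "connect_ok (5, 10) 19 (24, 91) 3 [1, 2, 3] (4476, 1127) (9517, 2413)
     [Centre [1] 3 [1], Centre [1, 1, 1, 1, 1] 3 [2], Centre [3, 3] 3 [1, 2], Centre [1, 3] 3 [],
      Centre [1, 1, 1, 3] 3 [2], Centre [1, 1, 1] 3 [2, 1, 1], Centre [1, 1, 1] 3 [2, 1, 2], Centre
      [1, 2] 3 [2], Centre [1, 1, 1, 1, 2] 3 [2, 1, 3, 3], Ext [3, 1, 2, 3, 1, 1, 1, 1, 2], Ext [1,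
      2, 3, 1, 1, 1, 1, 2], Centre [1, 1, 1] 3 [2, 2], Centre [1] 3 [2, 3], Ext [2, 3, 1, 1, 1, 1,
      2], Centre [2, 1, 1] 3 [1, 1, 1], Centre [2, 1, 2] 3 [1, 1, 1], Centre [1, 1, 1, 1, 3, 2, 1,
      3] 3 [2, 1, 3, 3, 1, 1, 1, 1, 1], Centre [1, 2, 3, 1, 1, 1, 1, 3] 3 [3, 1, 1, 1, 1, 2, 1],
      Centre [1, 1, 1, 1, 3, 2, 1, 3] 3 [2, 1, 3, 3, 1, 1, 1, 1, 2, 2], Centre [1, 1, 1, 1, 3, 2, 1,
      3] 3 [2, 1, 3, 3, 1, 1, 1, 1, 2, 3], Ext [2, 1, 1, 1, 1, 3, 3, 1, 2, 3, 1, 1, 1, 1, 3, 2, 1,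
      3], Centre [1, 2, 3, 1, 1, 1, 1] 3 [3, 1, 1, 1, 1, 3], Ext [1, 1, 1, 1, 3, 3, 1, 2, 3, 1, 1,
      1, 1, 3, 2, 1, 3], Centre [1, 1, 1, 1, 3, 2, 1, 3] 3 [2, 1, 3, 3, 1, 1, 1, 2], Centre [1, 1,
      1, 1, 3, 2, 1, 3] 3 [2, 1, 3, 3, 1, 1, 1, 3], Ext [1, 1, 1, 3, 3, 1, 2, 3, 1, 1, 1, 1, 3, 2,
      1, 3], Centre [1, 2] 3 [3, 1, 1, 2], Centre [1, 2] 3 [3, 1, 1, 3], Ext [1, 1, 3, 3, 1, 2, 3,
      1, 1, 1, 1, 3, 2, 1, 3], Centre [1, 1, 1, 1, 3, 2, 1, 3] 3 [2, 1, 3, 3, 1, 2], Ext [1, 3, 3,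
      1, 2, 3, 1, 1, 1, 1, 3, 2, 1, 3], Centre [1, 2] 3 [3, 2], Centre [1, 2] 3 [3, 3], Ext [3, 3,
      1, 2, 3, 1, 1, 1, 1, 3, 2, 1, 3], Ext [3, 1, 2, 3, 1, 1, 1, 1, 3, 2, 1, 3], Ext [1, 2, 3, 1,
      1, 1, 1, 3, 2, 1, 3], Ext [2, 3, 1, 1, 1, 1, 3, 2, 1, 3], Centre [2, 2] 3 [1, 1, 2], Centre
      [2, 3] 3 [1, 1], Centre [1, 1, 1, 1, 3, 3] 3 [2, 1, 3, 3, 1], Ext [3, 3, 1, 2, 3, 1, 1, 1, 1,
      3, 3], Ext [3, 1, 2, 3, 1, 1, 1, 1, 3, 3], Ext [1, 2, 3, 1, 1, 1, 1, 3, 3], Ext [2, 3, 1, 1,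
      1, 1, 3, 3], Centre [1, 1, 1, 2] 3 [2], Centre [2] 3 [1, 2], Centre [3, 2] 3 [1, 2], Centre
      [2, 2] 3 [1, 1, 1], Centre [2, 2] 3 [1, 1, 3, 2], Centre [2, 2] 3 [1, 1, 3, 3], Ext [3, 1, 1,
      3, 2, 2], Ext [1, 1, 3, 2, 2], Ext [1, 3, 2, 2], Centre [2, 3] 3 [1], Centre [1, 2, 1] 3 [],
      Centre [1, 2, 2] 3 [3, 1, 1], Centre [] 3 [1, 2, 1], Centre [3, 1, 2, 2] 3 [1, 2, 2], Centre
      [1, 2, 2] 3 [3, 1, 2, 3], Ext [2, 1, 3, 3, 1, 2, 2], Ext [1, 3, 3, 1, 2, 2], Ext [3, 3, 1, 2,
      2], Ext [3, 1, 2, 2]]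
     [[1, 1, 3, 3, 3, 1], [2, 3], [2, 1], [3, 3, 1, 1, 1, 3]]
     [[Node [Node [Node [Leaf [] [1, 1, 3, 3, 3, 1], Leaf [] [1, 1, 3, 3, 3, 1], Node [Dead, Node
      [Node [Dead, Dead, Leaf [] [1, 1, 3, 3, 3, 1]], Dead, Dead], Leaf [] [1, 1, 3, 3, 3, 1]]],
      Leaf [] [1, 1, 3, 3, 3, 1], Node [Dead, Dead, Node [Leaf [] [1, 1, 3, 3, 3, 1], Dead, Dead]]],
      Leaf [] [2, 3], Leaf [] [2, 3]], Leaf [] [2, 1]], [Node [Leaf [] [2, 1], Leaf [] [2, 1], Node
      [Node [Node [Node [Leaf [] [3, 3, 1, 1, 1, 3], Dead, Dead], Leaf [] [3, 3, 1, 1, 1, 3], Leaf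
      [] [3, 3, 1, 1, 1, 3]], Dead, Dead], Leaf [] [3, 3, 1, 1, 1, 3], Leaf [] [3, 3, 1, 1, 1,
      3]]]], []]"
  by code_simp

lemma orbit_15:
  "orbit_ok (5, 9) 11 (24, 91) 3 (9517, 2413) (14029, 3557)
     [3, 1, 1, 1, 3, 3, 3, 1, 1, 1, 3, 3, 3, 1, 1, 1, 3, 3, 3, 1, 1, 1, 3, 3, 3, 1, 1, 1, 3, 3, 3,
      1, 1, 1, 3, 3, 3, 1, 1, 1, 3, 3, 3, 1, 1, 1, 1, 2, 1, 2, 1, 2, 1, 2, 1, 2, 1, 2, 1, 2, 1, 2,
      1, 2, 1, 2, 1, 2, 3, 2, 3, 2, 3, 2, 3, 2, 3, 2, 3, 2, 3, 2, 3, 2, 3, 2, 3, 2, 3, 2, 1, 2, 1,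
      2, 1, 2, 1, 2, 1, 2, 1, 2, 1, 2, 1, 2, 1, 2, 1, 2, 1, 1, 1, 1, 3, 3, 3, 1, 1, 1, 3, 3, 3, 1,
      1, 1, 3, 3, 3, 1, 1, 1, 3, 3, 3, 1, 1, 1, 3, 3] 17
     [[1, 1, 3, 3, 3, 1], [2, 3], [2, 1], [3, 3, 1, 1, 1, 3]]
     [2, 67, 47, 5]"
  by code_simp

lemma connect_16:
  "connect_ok (5, 8) 12 (24, 91) 3 [1, 2, 3] (279, 70) (2977, 748)
     [Centre [2] 3 [1, 2], Centre [1, 3] 3 [], Centre [2, 1, 1] 3 [1, 1, 1], Centre [1] 3 [1, 1],
      Centre [2, 2] 3 [1, 1, 2, 1, 1], Centre [2, 2] 3 [1, 1, 2, 1, 2], Centre [1] 3 [1], Centre [1,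
      2] 3 [2], Centre [2, 2] 3 [1, 1, 2, 1, 3, 3], Ext [3, 1, 2, 1, 1, 3, 2, 2], Ext [1, 2, 1, 1,
      3, 2, 2], Centre [2, 2] 3 [1, 1, 2, 2], Centre [2, 2] 3 [1, 1, 2, 3], Ext [2, 1, 1, 3, 2, 2],
      Centre [2, 3] 3 [1, 1], Centre [1, 1, 1, 2] 3 [2], Centre [3, 3] 3 [1, 2], Centre [1, 1, 1, 3]
      3 [2], Centre [1, 1, 2] 3 [2, 2, 1], Centre [1, 1, 2] 3 [2, 2, 2], Centre [1, 1, 2] 3 [2, 2,
      3, 1, 1], Ext [1, 3, 2, 2, 3, 1, 1, 2], Centre [1, 1, 2] 3 [2, 2, 3, 2], Centre [1, 1, 2] 3
      [2, 2, 3, 3], Ext [3, 2, 2, 3, 1, 1, 2], Ext [2, 2, 3, 1, 1, 2], Centre [1] 3 [2, 3], Centre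
      [1, 1, 1] 3 [2, 2], Centre [2, 3] 3 [1], Centre [1, 2, 1] 3 [3, 1, 1], Centre [1, 2, 1] 3 [3,
      1, 2], Ext [1, 3, 3, 1, 2, 1], Centre [1, 2, 1] 3 [3, 2], Centre [1, 2] 3 [3, 3], Ext [3, 3,
      1, 2, 1], Ext [3, 1, 2, 1], Centre [3, 2, 1] 3 [1, 2], Centre [3, 2] 3 [1, 2, 1], Centre [3,
      2] 3 [1, 2, 2], Centre [3, 2, 2] 3 [1, 2, 3, 1, 1], Ext [1, 3, 2, 1, 3, 3, 2, 2], Centre [3,
      2] 3 [1, 2, 3, 2], Centre [3, 2] 3 [1, 2, 3, 3], Ext [3, 2, 1, 3, 3, 2, 2], Ext [2, 1, 3, 3,
      2, 2], Centre [3, 2, 3, 2] 3 [1, 2, 3, 1, 1, 1, 1], Centre [2] 3 [1, 1, 1, 2], Centre [2] 3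
      [1, 1, 1, 3], Ext [1, 1, 1, 3, 2, 1, 3, 3, 2, 3, 2], Centre [3, 2, 3, 2] 3 [1, 2, 3, 1, 1, 2],
      Centre [3, 2, 3, 2] 3 [1, 2, 3, 1, 1, 3], Ext [1, 1, 3, 2, 1, 3, 3, 2, 3, 2], Ext [1, 3, 2, 1,
      3, 3, 2, 3, 2], Ext [3, 2, 1, 3, 3, 2, 3, 2], Ext [2, 1, 3, 3, 2, 3, 2], Centre [3, 2, 3, 3] 3
      [1, 2, 3, 1, 1], Ext [1, 3, 2, 1, 3, 3, 2, 3, 3], Ext [3, 2, 1, 3, 3, 2, 3, 3], Ext [2, 1, 3,
      3, 2, 3, 3]]
     [[2, 3, 1, 1], [1, 1, 3, 3, 3, 1], [1, 1, 3, 2], [2, 3], [2, 1], [3, 3, 1, 1, 1, 3]]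
     [[Node [Node [Node [Leaf [] [2, 3, 1, 1], Leaf [] [2, 3, 1, 1], Node [Dead, Node [Node [Dead,
      Leaf [] [2, 3, 1, 1], Leaf [] [2, 3, 1, 1]], Dead, Dead], Leaf [] [2, 3, 1, 1]]], Leaf [] [1,
      1, 3, 3, 3, 1], Leaf [] [1, 1, 3, 3, 3, 1]], Node [Leaf [] [1, 1, 3, 2], Leaf [] [1, 1, 3, 2],
      Node [Node [Node [Dead, Dead, Leaf [] [1, 1, 3, 2]], Dead, Dead], Leaf [] [1, 1, 3, 2], Leaf
      [] [1, 1, 3, 2]]], Leaf [] [2, 3]], Node [Leaf [] [2, 1], Node [Leaf [] [2, 3], Leaf [] [1, 1,
      3, 2], Leaf [2, 3, 1, 1, 3, 3, 1, 2] [3, 3, 1, 1, 1, 3]], Leaf [] [2, 3]]], [Node [Leaf [] [2,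
      1], Node [Leaf [] [3, 3, 1, 1, 1, 3], Leaf [] [3, 3, 1, 1, 1, 3], Node [Dead, Leaf [] [3, 3,
      1, 1, 1, 3], Leaf [] [3, 3, 1, 1, 1, 3]]], Leaf [] [3, 3, 1, 1, 1, 3]]], []]"
  by code_simp

lemma orbit_16:
  "orbit_ok (5, 11) 9 (24, 91) 3 (2977, 748) (1588, 399)
     [3, 2, 1, 1, 3, 2, 1, 1, 3, 2, 1, 1, 3, 2, 1, 1, 1, 1, 2, 3, 1, 1, 2, 3, 1, 1, 2, 3, 1, 1, 2,
      3, 1, 1, 2, 3, 1, 1, 2, 3, 1, 1, 2, 3, 1, 1, 3, 3, 3, 1, 1, 1, 3, 3, 3, 1, 1, 1, 3, 3, 3, 1,
      1, 1, 3, 3, 3, 1, 1, 1, 3, 3, 3, 1, 1, 1, 3, 3, 3, 1, 1, 1, 3, 3, 3, 1, 1, 3, 2, 1, 1, 3, 2,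
      1, 1, 3, 2, 1, 1, 3, 2, 1, 1, 3, 2, 1, 1, 3, 2, 1, 1, 3, 2, 1, 1, 1, 1, 2, 3, 1, 1, 2, 3, 1,
      1, 2, 3, 1, 1, 2, 3, 1, 1, 2, 3, 1, 1, 2, 3, 1, 1, 2, 3, 1, 1, 2, 1, 2, 1, 2, 1, 2, 1, 2, 1,
      2, 1, 2, 1, 2, 1, 2, 1, 2, 1, 2, 1, 2, 1, 2, 1, 2, 1, 2, 3, 2, 3, 2, 3, 2, 3, 2, 3, 2, 3, 2,
      3, 2, 3, 2, 3, 2, 3, 2, 3, 2, 3, 2, 3, 2, 3, 2, 1, 2, 1, 2, 1, 2, 1, 2, 1, 2, 1, 2, 1, 2, 1,
      2, 1, 2, 1, 2, 1, 2, 1, 2, 1, 2, 1, 2, 1, 1, 3, 2, 1, 1, 3, 2, 1, 1, 3, 2, 1, 1] 131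
     [[2, 3, 1, 1], [1, 1, 3, 3, 3, 1], [1, 1, 3, 2], [2, 3], [2, 1], [3, 3, 1, 1, 1, 3]]
     [18, 44, 85, 173, 145, 47]"
  by code_simp

section \<open>Certificates over the digits 1, 2, 3, 4, which serve levels up to 16/3\<close>

lemma connect_17:
  "connect_ok (5, 12) 16 (35, 169) 4 [1, 2, 3, 4] (5188, 1147) (14141, 3128)
     [Centre [2] 4 [], Centre [1] 4 [], Centre [1, 3] 3 [1, 3], Centre [1, 2, 1, 3, 1] 3 [1, 3, 1,
      2, 1], Centre [1, 2, 1, 3, 1, 3] 3 [1, 3, 1, 2, 2], Centre [1, 2, 1, 3, 1, 3, 2] 3 [1, 3, 1,
      2, 3], Ext [2, 1, 3, 1, 3, 1, 2, 1, 3, 1, 3, 2], Centre [1, 2, 1, 3, 1, 3, 1] 3 [1, 3, 1, 2,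
      3], Ext [2, 1, 3, 1, 3, 1, 2, 1, 3, 1, 3, 1], Centre [] 4 [1], Centre [] 4 [2], Centre [3] 4
      [3, 1, 1], Centre [3] 4 [3, 1, 2], Centre [3] 4 [3, 1, 3], Ext [1, 3, 4, 3], Centre [3] 4 [3,
      2], Centre [3] 4 [3, 3], Centre [3] 4 [3, 4], Ext [3, 4, 3], Centre [4, 4] 4 [3, 2], Centre
      [4, 4] 4 [3, 3], Centre [4, 4] 4 [3, 4], Centre [3, 2] 4 [4, 3, 1], Centre [4, 3] 4 [3, 2, 1],
      Centre [4, 3] 4 [3, 2, 2], Centre [4, 3, 2] 4 [3, 2, 3], Ext [2, 3, 4, 4, 3, 2], Centre [4, 3]
      4 [3, 3], Centre [4, 3] 4 [3, 4], Ext [3, 4, 4, 3, 2], Centre [3, 2] 4 [4, 4], Ext [4, 4, 3,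
      2], Ext [4, 3, 2], Centre [1, 2, 1, 3, 1, 3] 3 [1, 3, 1, 2, 3, 1, 1], Centre [1, 2, 1, 3, 1,
      3] 3 [1, 3, 1, 2, 3, 1, 2], Centre [1, 2, 1, 3, 1, 3, 3, 2] 3 [1, 3, 1, 2, 3, 1, 3], Ext [1,
      3, 2, 1, 3, 1, 3, 1, 2, 1, 3, 1, 3, 3, 2], Centre [1, 2, 1, 3, 1, 3] 3 [1, 3, 1, 2, 3, 2],
      Centre [1, 2, 1, 3, 1, 3] 3 [1, 3, 1, 2, 3, 3], Ext [3, 2, 1, 3, 1, 3, 1, 2, 1, 3, 1, 3, 3,
      2], Ext [2, 1, 3, 1, 3, 1, 2, 1, 3, 1, 3, 3, 2], Centre [3, 3] 4 [4, 3], Centre [3, 3] 4 [4,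
      4], Ext [4, 4, 3, 3], Ext [4, 3, 3], Centre [1, 2, 1, 3, 1, 3, 3, 3] 3 [1, 3, 1, 2, 3, 1, 3],
      Ext [1, 3, 2, 1, 3, 1, 3, 1, 2, 1, 3, 1, 3, 3, 3], Ext [3, 2, 1, 3, 1, 3, 1, 2, 1, 3, 1, 3, 3,
      3], Ext [2, 1, 3, 1, 3, 1, 2, 1, 3, 1, 3, 3, 3], Centre [4, 3, 1] 4 [3, 2], Centre [3, 4] 4
      [4, 3], Centre [3, 4] 4 [4, 4], Ext [4, 4, 3, 4], Ext [4, 3, 4]]
     [[3, 1, 3, 1, 2, 1, 3, 1, 3, 1, 1, 1], [1, 3, 1, 1, 1, 3, 1, 3, 1, 2, 1, 3, 1, 3, 1, 1], [1, 1,
      3, 1, 3, 1, 2, 1, 3, 1, 3, 1]]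
     [[Leaf [2] [3, 1, 3, 1, 2, 1, 3, 1, 3, 1, 1, 1], Leaf [2, 3, 1, 3, 1, 2, 1, 3] [1, 3, 1, 1, 1,
      3, 1, 3, 1, 2, 1, 3, 1, 3, 1, 1], Leaf [2, 3, 1, 3, 1, 2, 1, 3] [1, 3, 1, 1, 1, 3, 1, 3, 1, 2,
      1, 3, 1, 3, 1, 1]], [Node [Leaf [3, 4, 4, 4, 3] [1, 1, 3, 1, 3, 1, 2, 1, 3, 1, 3, 1], Leaf [3]
      [3, 1, 3, 1, 2, 1, 3, 1, 3, 1, 1, 1], Leaf [3] [3, 1, 3, 1, 2, 1, 3, 1, 3, 1, 1, 1], Dead],
      Node [Dead, Dead, Leaf [3, 1, 3, 1, 2, 1, 3] [1, 3, 1, 1, 1, 3, 1, 3, 1, 2, 1, 3, 1, 3, 1, 1],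
      Dead]], [Node [Dead, Dead, Node [Leaf [4, 4, 3] [1, 1, 3, 1, 3, 1, 2, 1, 3, 1, 3, 1], Dead,
      Dead, Dead], Leaf [4, 4, 3] [1, 1, 3, 1, 3, 1, 2, 1, 3, 1, 3, 1]]], []]"
  by code_simp

lemma orbit_17:
  "orbit_ok (5, 10) 11 (35, 169) 4 (14141, 3128) (5330, 1179)
     [3, 1, 2, 1, 2, 1, 3, 3, 2, 2, 2, 1, 1, 1, 3, 1, 1, 1, 3, 1, 3, 1, 2, 1, 3, 1, 3, 1, 1, 1, 3,
      1, 1, 1, 3, 1, 3, 1, 2, 1, 3, 1, 3, 1, 1, 1, 3, 1, 1, 1, 2, 2, 2, 3, 3, 1, 2, 1, 2, 1, 3, 1,
      3, 1, 2, 1, 2, 3, 1, 3, 1, 1, 1, 1, 3, 1, 3, 1, 2, 1, 3, 1, 3, 1, 1, 1, 3, 1, 3, 1, 2, 1, 3,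
      1, 3, 1, 1, 1, 3, 1, 3, 1, 2, 1, 3, 1, 3, 1, 1, 1, 1, 3, 1, 3, 2, 1, 2, 1, 3, 1] 61
     [[3, 1, 3, 1, 2, 1, 3, 1, 3, 1, 1, 1], [1, 3, 1, 1, 1, 3, 1, 3, 1, 2, 1, 3, 1, 3, 1, 1], [1, 1,
      3, 1, 3, 1, 2, 1, 3, 1, 3, 1]]
     [74, 13, 72]"
  by code_simp

lemma connect_18:
  "connect_ok (5, 8) 14 (35, 169) 4 [1, 2, 3, 4] (16223, 3583) (2525, 558)
     [Centre [2] 4 [], Centre [1] 4 [], Centre [1, 3, 2] 3 [1, 3], Centre [1, 3, 1] 3 [1, 3], Centre
      [1, 3] 3 [1, 3, 1], Centre [1, 3] 3 [1, 3, 2], Centre [1, 3, 3] 3 [1, 3, 3], Centre [] 4 [1],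
      Centre [] 4 [2], Centre [1, 3, 3] 3 [1, 3, 4, 3], Centre [1, 3, 3] 3 [1, 3, 4, 4], Ext [4, 3,
      1, 3, 1, 3, 3], Ext [3, 1, 3, 1, 3, 3], Centre [3, 1, 1] 4 [3], Centre [3, 1, 2] 4 [3], Centre
      [3] 4 [3, 1, 1], Centre [3] 4 [3, 1, 2], Centre [3, 1, 3, 1, 1] 4 [3, 1, 3], Ext [1, 3, 4, 3,
      1, 3, 1, 1], Centre [3] 4 [3, 2], Centre [3] 4 [3, 3], Centre [3] 4 [3, 4], Ext [3, 4, 3, 1,
      3, 1, 1], Centre [3, 1, 3] 4 [3, 1, 3, 1, 1], Centre [3, 1, 3, 1, 2] 4 [3, 1, 3, 1, 2], Centre
      [1, 3, 4, 3] 3 [1, 3, 3], Centre [3, 1, 3, 1, 2, 1, 1] 4 [3, 1, 3, 1, 3, 4], Ext [3, 1, 3, 1,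
      3, 4, 3, 1, 3, 1, 2, 1, 1], Ext [1, 3, 1, 3, 4, 3, 1, 3, 1, 2, 1, 1], Centre [3, 1, 3] 4 [3,
      1, 3, 2], Centre [3, 1, 3] 4 [3, 1, 3, 3], Centre [3, 1, 3] 4 [3, 1, 3, 4], Ext [3, 1, 3, 4,
      3, 1, 3, 1, 2, 1, 1], Ext [1, 3, 4, 3, 1, 3, 1, 2, 1, 1], Ext [3, 4, 3, 1, 3, 1, 2, 1, 1],
      Centre [3, 1, 3, 1, 2, 1, 2] 4 [3, 1, 3, 1, 3, 4], Ext [3, 1, 3, 1, 3, 4, 3, 1, 3, 1, 2, 1,
      2], Ext [1, 3, 1, 3, 4, 3, 1, 3, 1, 2, 1, 2], Ext [3, 1, 3, 4, 3, 1, 3, 1, 2, 1, 2], Ext [1,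
      3, 4, 3, 1, 3, 1, 2, 1, 2], Ext [3, 4, 3, 1, 3, 1, 2, 1, 2], Centre [3, 1, 3, 1, 2, 1, 3] 4
      [3, 1, 3, 1, 3, 4], Ext [3, 1, 3, 1, 3, 4, 3, 1, 3, 1, 2, 1, 3], Ext [1, 3, 1, 3, 4, 3, 1, 3,
      1, 2, 1, 3], Ext [3, 1, 3, 4, 3, 1, 3, 1, 2, 1, 3], Ext [1, 3, 4, 3, 1, 3, 1, 2, 1, 3], Ext
      [3, 4, 3, 1, 3, 1, 2, 1, 3], Centre [3, 1, 3, 1, 2, 2] 4 [3, 1, 3, 1, 3, 4], Ext [3, 1, 3, 1,
      3, 4, 3, 1, 3, 1, 2, 2], Ext [1, 3, 1, 3, 4, 3, 1, 3, 1, 2, 2], Ext [3, 1, 3, 4, 3, 1, 3, 1,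
      2, 2], Ext [1, 3, 4, 3, 1, 3, 1, 2, 2], Ext [3, 4, 3, 1, 3, 1, 2, 2], Centre [3, 1, 3, 1, 2,
      3] 4 [3, 1, 3, 1, 3], Ext [1, 3, 1, 3, 4, 3, 1, 3, 1, 2, 3], Ext [3, 1, 3, 4, 3, 1, 3, 1, 2,
      3], Ext [1, 3, 4, 3, 1, 3, 1, 2, 3], Ext [3, 4, 3, 1, 3, 1, 2, 3], Centre [1, 3, 4, 3, 1, 3] 3
      [1, 3, 4, 4, 3], Centre [1, 3, 4, 3, 1, 3] 3 [1, 3, 4, 4, 4, 3], Centre [1, 3, 4, 3, 1, 3] 3
      [1, 3, 4, 4, 4, 4], Ext [4, 4, 4, 3, 1, 3, 1, 3, 4, 3, 1, 3], Ext [4, 4, 3, 1, 3, 1, 3, 4, 3,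
      1, 3], Centre [3, 2] 4 [3, 1, 3, 1, 3, 4], Centre [3, 3] 4 [3, 1, 3, 1, 3, 4], Centre [3, 4] 4
      [3, 1, 3, 1, 3, 4], Centre [1, 3, 4, 4] 3 [1, 3, 4, 4], Centre [3, 1, 3, 2] 4 [3, 1, 3], Ext
      [1, 3, 4, 3, 1, 3, 2], Ext [3, 4, 3, 1, 3, 2], Centre [3, 1, 3, 3] 4 [3, 1, 3], Ext [1, 3, 4,
      3, 1, 3, 3], Ext [3, 4, 3, 1, 3, 3], Centre [3, 1, 3, 4] 4 [3, 1, 3], Ext [1, 3, 4, 3, 1, 3,
      4], Ext [3, 4, 3, 1, 3, 4], Centre [3, 2] 4 [3], Centre [3, 3] 4 [4, 3], Centre [3, 3] 4 [4,
      4], Ext [4, 4, 3, 3], Centre [3, 4] 4 [4, 3], Centre [3, 4] 4 [4, 4], Ext [4, 4, 3, 4], Centre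
      [1, 3, 4, 4] 3 [1, 3, 3], Centre [1, 3, 4, 4] 3 [1, 3, 4, 3, 1, 3, 1], Ext [3, 1, 3, 4, 3, 1,
      3, 1, 3, 4, 4], Ext [1, 3, 4, 3, 1, 3, 1, 3, 4, 4], Ext [3, 4, 3, 1, 3, 1, 3, 4, 4], Ext [4,
      3, 1, 3, 1, 3, 4, 4], Ext [3, 1, 3, 1, 3, 4, 4]]
     [[3, 1, 3, 1, 2, 1], [1, 3, 1, 3, 1, 2], [2, 1, 3, 1, 3, 1]]
     [[Leaf [2] [3, 1, 3, 1, 2, 1], Leaf [1] [1, 3, 1, 3, 1, 2], Leaf [1] [1, 3, 1, 3, 1, 2]], [Node
      [Node [Leaf [] [2, 1, 3, 1, 3, 1], Leaf [] [2, 1, 3, 1, 3, 1], Node [Node [Leaf [] [2, 1, 3,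
      1, 3, 1], Leaf [] [2, 1, 3, 1, 3, 1], Node [Dead, Dead, Dead, Leaf [] [2, 1, 3, 1, 3, 1]],
      Dead], Leaf [] [2, 1, 3, 1, 3, 1], Leaf [] [2, 1, 3, 1, 3, 1], Leaf [] [2, 1, 3, 1, 3, 1]],
      Dead], Leaf [] [2, 1, 3, 1, 3, 1], Leaf [] [2, 1, 3, 1, 3, 1], Dead], Node [Dead, Dead, Leaf
      [] [2, 1, 3, 1, 3, 1], Dead]], [Node [Dead, Dead, Leaf [] [3, 1, 3, 1, 2, 1], Node [Dead,
      Dead, Node [Node [Dead, Dead, Node [Node [Dead, Node [Node [Dead, Dead, Dead, Dead], Dead,
      Dead, Dead], Node [Dead, Dead, Dead, Node [Dead, Dead, Node [Node [Dead, Dead, Dead, Dead],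
      Dead, Dead, Dead], Dead]], Dead], Dead, Dead, Dead], Dead], Dead, Dead, Dead], Leaf [] [3, 1,
      3, 1, 2, 1]]]], []]"
  by code_simp

text \<open>The three leaf periods are rotations of one word of six digits, so its orbit alone
  defines the subshift and nothing has to be joined.\<close>

lemma orbit_18:
  "orbit_ok (5, 8) 10 (35, 169) 4 (2525, 558) (1172, 259)
     [3, 1, 3, 1, 2, 1] 3
     [[3, 1, 3, 1, 2, 1], [1, 3, 1, 3, 1, 2], [2, 1, 3, 1, 3, 1]]
     [0, 5, 4]"
  by code_simp

lemma connect_19:
  "connect_ok (5, 8) 10 (35, 169) 4 [1, 2, 3, 4] (403, 89) (575, 127)
     [Centre [2] 4 [], Centre [1] 4 [], Centre [1, 3, 2] 3 [1, 3], Centre [1, 3, 1] 3 [1, 3], Centre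
      [] 4 [1], Centre [] 4 [2], Centre [1, 3] 3 [1, 3, 1], Centre [1, 3] 3 [1, 3, 2], Centre [1, 3,
      3] 3 [1, 3, 3], Centre [1, 3, 3] 3 [1, 3, 4, 3], Centre [1, 3, 3] 3 [1, 3, 4, 4], Ext [4, 3,
      1, 3, 1, 3, 3], Ext [3, 1, 3, 1, 3, 3], Centre [4, 4] 4 [3, 3], Centre [4, 4] 4 [3, 4], Centre
      [4, 4] 4 [3, 2, 1], Centre [4, 4, 3] 4 [3, 2, 2], Centre [3, 2] 4 [3], Centre [3, 3] 4 [4, 3],
      Centre [3, 3] 4 [4, 4], Ext [4, 4, 3, 3], Centre [3, 4] 4 [4, 3], Centre [3, 4] 4 [4, 4], Ext
      [4, 4, 3, 4], Centre [4, 4] 4 [3, 2, 2, 1, 1], Centre [4, 4] 4 [3, 2, 2, 1, 2], Centre [4, 4,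
      4, 3] 4 [3, 2, 2, 1, 3], Ext [1, 2, 2, 3, 4, 4, 4, 4, 3], Centre [4, 4] 4 [3, 2, 2, 2], Centre
      [4, 4] 4 [3, 2, 2, 3], Ext [2, 2, 3, 4, 4, 4, 4, 3], Centre [4, 4, 4, 4] 4 [3, 2, 2, 1, 3],
      Ext [1, 2, 2, 3, 4, 4, 4, 4, 4], Ext [2, 2, 3, 4, 4, 4, 4, 4]]
     [[3, 1, 3, 1, 2, 1], [1, 3, 1, 3, 1, 2], [2, 1, 3, 1, 3, 1], [4, 4, 3, 2, 3, 4]]
     [[Leaf [2] [3, 1, 3, 1, 2, 1], Leaf [1] [1, 3, 1, 3, 1, 2], Leaf [1] [1, 3, 1, 3, 1, 2]], [Node
      [Node [Leaf [] [2, 1, 3, 1, 3, 1], Leaf [] [2, 1, 3, 1, 3, 1], Leaf [] [2, 1, 3, 1, 3, 1],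
      Dead], Leaf [] [2, 1, 3, 1, 3, 1], Leaf [] [2, 1, 3, 1, 3, 1], Dead], Node [Dead, Dead, Leaf
      [] [2, 1, 3, 1, 3, 1], Dead]], [Node [Dead, Dead, Leaf [] [3, 1, 3, 1, 2, 1], Node [Dead,
      Dead, Node [Leaf [] [4, 4, 3, 2, 3, 4], Dead, Dead, Dead], Node [Dead, Dead, Leaf [] [4, 4, 3,
      2, 3, 4], Leaf [] [4, 4, 3, 2, 3, 4]]]]], []]"
  by code_simp

lemma orbit_19:
  "orbit_ok (5, 5) 5 (35, 169) 4 (575, 127) (1227, 271)
     [4, 3, 2, 2, 3, 2, 1, 2, 1, 3, 1, 3, 1, 2, 1, 3, 1, 3, 1, 2, 1, 3, 1, 3, 1, 2, 1, 2, 3, 2, 2,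
      3, 4, 4, 3, 1, 3, 3, 2, 3, 4, 4, 4, 3, 2, 3, 4, 4, 4, 3, 2, 3, 4, 4, 4, 3, 2, 3, 3, 1, 3, 4] 33
     [[3, 1, 3, 1, 2, 1], [1, 3, 1, 3, 1, 2], [2, 1, 3, 1, 3, 1], [4, 4, 3, 2, 3, 4]]
     [9, 8, 7, 41]"
  by code_simp

theorem theorem3p1:
  shows "good_interval 3.05082 3.122183 \<and>
         good_interval 3.1299 3.285441 \<and>
         good_interval 3.28603 3.28729 \<and>
         good_interval 3.29296 3.29335 \<and>
         good_interval 3.33396 3.33475 \<and>
         good_interval 3.359 3.423 \<and>
         good_interval (sqrt 12) 3.8465 \<and>
         good_interval 3.873 3.930691 \<and>
         good_interval 3.93616 3.943767 \<and>
         good_interval 3.944054 3.971606 \<and>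
         good_interval 3.97995 3.9857 \<and>
         good_interval 4.520781 4.523103 \<and>
         good_interval 4.5251 4.5279"
proof (intro conjI)
  show "good_interval 3.05082 3.122183"
    by (rule certified_interval[OF connect_1 orbit_1]) (simp_all add: rv_def)
  \<comment> \<open>Here and below, a cut between two pieces is the level y of the left piece
    rounded down; the bound \<open>X\<close> of the right piece lies below it.\<close>
  have piece_2: "good_interval 3.1299 3.28124"
    by (rule certified_interval[OF connect_2 orbit_2]) (simp_all add: rv_def)
  have piece_3: "good_interval 3.28124 3.285441"
    by (rule certified_interval[OF connect_3 orbit_3]) (simp_all add: rv_def)
  show "good_interval 3.1299 3.285441"
    by (rule good_interval_join[OF piece_2
      piece_3])
  show "good_interval 3.28603 3.28729"
    by (rule certified_interval[OF connect_4 orbit_4]) (simp_all add: rv_def)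
  have piece_5: "good_interval 3.29296 3.2931"
    by (rule certified_interval[OF connect_5 orbit_5]) (simp_all add: rv_def)
  have piece_6: "good_interval 3.2931 3.29335"
    by (rule certified_interval[OF connect_6 orbit_6]) (simp_all add: rv_def)
  show "good_interval 3.29296 3.29335"
    by (rule good_interval_join[OF piece_5
      piece_6])
  show "good_interval 3.33396 3.33475"
    by (rule certified_interval[OF connect_7 orbit_7]) (simp_all add: rv_def)
  show "good_interval 3.359 3.423"
    by (rule certified_interval[OF connect_8 orbit_8]) (simp_all add: rv_def)
  show "good_interval (sqrt 12) 3.8465"
    by (rule sqrt_12_interval[OF connect_9]) (auto simp: rv_def)
  show "good_interval 3.873 3.930691"
    by (rule certified_interval[OF connect_10 orbit_10]) (simp_all add: rv_def)
  have piece_11: "good_interval 3.93616 3.93758"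
    by (rule certified_interval[OF connect_11 orbit_11]) (simp_all add: rv_def)
  have piece_12: "good_interval 3.93758 3.94105"
    by (rule certified_interval[OF connect_12 orbit_12]) (simp_all add: rv_def)
  have piece_13: "good_interval 3.94105 3.94371"
    by (rule certified_interval[OF connect_13 orbit_13]) (simp_all add: rv_def)
  have piece_14: "good_interval 3.94371 3.943767"
    by (rule certified_interval[OF connect_14 orbit_14]) (simp_all add: rv_def)
  show "good_interval 3.93616 3.943767"
    by (rule good_interval_join[OF piece_11
      good_interval_join[OF piece_12
      good_interval_join[OF piece_13
      piece_14]]])
  show "good_interval 3.944054 3.971606"
    by (rule certified_interval[OF connect_15 orbit_15]) (simp_all add: rv_def)
  show "good_interval 3.97995 3.9857"
    by (rule certified_interval[OF connect_16 orbit_16]) (simp_all add: rv_def)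
  show "good_interval 4.520781 4.523103"
    by (rule certified_interval[OF connect_17 orbit_17]) (simp_all add: rv_def)
  have piece_18: "good_interval 4.5251 4.52777"
    by (rule certified_interval[OF connect_18 orbit_18]) (simp_all add: rv_def)
  have piece_19: "good_interval 4.52777 4.5279"
    by (rule certified_interval[OF connect_19 orbit_19]) (simp_all add: rv_def)
  show "good_interval 4.5251 4.5279"
    by (rule good_interval_join[OF piece_18
      piece_19])
qed

end
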